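(* (i) Let $n\ge1$ and let $H$ be the $n\times n$ unitary upper Hessenberg matrix with parameters $\alpha_0,\dots,\alpha_{n-2}\in\mathbb C$, $|\alpha_j|<1$, and $\alpha_{n-1}=e^{i\phi}$, $|\alpha_{n-1}|=1$. Let $\lambda_j=e^{i\theta_j}$ ($j=1,\dots,n$) be its eigenvalues with the $\theta_j$ ordered, and let $q_j>0$ be the modulus of the first component of the normalized eigenvector for $\lambda_j$, so that $\sum_{j=1}^n q_j^2=1$. Then the Jacobian for the change of variables from $\{\alpha_j\}_{j=0,\dots,n-1}$ to $\{\theta_i\}_{i=1,\dots,n}$, $\{q_i\}_{i=1,\dots,n-1}$, i.e. the positive function $J$ with $\prod_{j=0}^{n-2}d\,\mathrm{Re}\,\alpha_j\,d\,\mathrm{Im}\,\alpha_j\; d\phi=J\prod_{i=1}^n d\theta_i\prod_{i=1}^{n-1}dq_i$, is equal to $$\frac{\prod_{i=0}^{n-2}(1-|\alpha_i|^2)}{q_n\prod_{i=1}^n q_i}.$$ (ii) Let $n\ge 1$ and let $H$ be the $2n\times 2n$ real orthogonal upper Hessenberg matrix of determinant $+1$ with real parameters $\alpha_0,\dots,\alpha_{2n-2}\in(-1,1)$ and $\alpha_{2n-1}=-1$. Its eigenvalues are $e^{\pm i\theta_j}$ ($j=1,\dots,n$) with $0<\theta_j<\pi$, ordered; let $q_j>0$ be such that $\tfrac12 q_j^2$ is the squared modulus of the first component of the normalized eigenvector for each of $e^{i\theta_j}$ and $e^{-i\theta_j}$, so that $\sum_{j=1}^n q_j^2=1$. Then the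 Jacobian for the change of variables from $\{\alpha_j\}_{j=0,\dots,2n-2}$ to $\{\theta_i\}_{i=1,\dots,n}$, $\{q_i\}_{i=1,\dots,n-1}$, i.e. the positive function $J$ with $\prod_{j=0}^{2n-2}d\alpha_j=J\prod_{i=1}^n d\theta_i\prod_{i=1}^{n-1}dq_i$, is equal to $$\frac{2^{n-1}}{q_n\prod_{i=1}^n q_i}\;\frac{\prod_{l=0}^{2n-2}(1-|\alpha_l|^2)}{\prod_{k=0}^{2n-2}(1-\alpha_k)^{1/2}(1+(-1)^k\alpha_k)^{1/2}}.$$
   Context: The $m\times m$ unitary upper Hessenberg matrix $H=[H_{i,j}]_{i,j=0,\dots,m-1}$ with parameters $\alpha_0,\dots,\alpha_{m-1}$ (where $|\alpha_j|<1$ for $j\le m-2$, $|\alpha_{m-1}|=1$) is defined as follows. Put $\alpha_{-1}:=-1$ and $\rho_j:=\sqrt{1-|\alpha_j|^2}$ for $0\le j\le m-2$. Then $H_{i,i}=-\alpha_{i-1}\bar\alpha_i$, $H_{i+1,i}=\rho_i$, $H_{i,j}=-\alpha_{i-1}\bar\alpha_j\prod_{l=i}^{j-1}\rho_l$ for $i<j$, and $H_{i,j}=0$ for $i>j+1$. Such matrices have distinct eigenvalues and eigenvectors with non-zero first component (normalized to unit length), and, with the $\theta_j$ ordered, the parameters $\{\alpha_j\}$ are locally in one-to-one correspondence with the variables $\{\theta_i\},\{q_i\}_{i<n}$ (where $q_n=\sqrt{1-\sum_{i<n}q_i^2}$). In part (ii), $m=2n$. The Jacobian means the absolute value of the Jacobian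 determinant. *)

theory Defs
  imports "HOL-Analysis.Analysis" "Jordan_Normal_Form.Char_Poly" "Jordan_Normal_Form.Conjugate"
begin

text \<open>The parameters are \<open>\<alpha> 0, \<dots>, \<alpha> (m - 1)\<close>; \<open>prev_param \<alpha> i\<close> is the parameter with
  index \<open>i - 1\<close>, where the parameter with index \<open>-1\<close> is \<open>-1\<close>.\<close>

definition prev_param :: "(nat \<Rightarrow> complex) \<Rightarrow> nat \<Rightarrow> complex" where
  "prev_param \<alpha> i = (if i = 0 then - 1 else \<alpha> (i - 1))"

definition rho :: "(nat \<Rightarrow> complex) \<Rightarrow> nat \<Rightarrow> real" where
  "rho \<alpha> j = sqrt (1 - (cmod (\<alpha> j))\<^sup>2)"

definition hessenberg :: "nat \<Rightarrow> (nat \<Rightarrow> complex) \<Rightarrow> complex mat" where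
  "hessenberg m \<alpha> = Matrix.mat m m (\<lambda>(i, j).
     if i > j + 1 then 0
     else if i = j + 1 then complex_of_real (rho \<alpha> j)
     else - prev_param \<alpha> i * cnj (\<alpha> j) * complex_of_real (\<Prod>l = i..<j. rho \<alpha> l))"

text \<open>\<open>w\<close> is the squared modulus of the first component of a unit eigenvector for \<open>k\<close>. It is
  determined by \<open>H\<close> and \<open>k\<close> whenever \<open>k\<close> is a simple eigenvalue, as will always be the case below.\<close>

definition eigen_weight :: "complex mat \<Rightarrow> complex \<Rightarrow> real \<Rightarrow> bool" where
  "eigen_weight H k w \<longleftrightarrow>
     (\<exists>v. eigenvector H v k \<and> v \<bullet>c v = 1 \<and> (cmod (vec_index v 0))\<^sup>2 = w)"

text \<open>Spectral data of the \<open>n\<close> by \<open>n\<close> unitary matrix. The angles are real numbers, ordered within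
  some window of length \<open>2 * pi\<close>; no particular branch of the argument is singled out.\<close>

definition unitary_spectral_data ::
  "nat \<Rightarrow> complex mat \<Rightarrow> (nat \<Rightarrow> real) \<Rightarrow> (nat \<Rightarrow> real) \<Rightarrow> bool" where
  "unitary_spectral_data n H \<theta> q \<longleftrightarrow>
     strict_mono_on {..<n} \<theta> \<and> \<theta> (n - 1) < \<theta> 0 + 2 * pi \<and>
     {k. eigenvalue H k} = (\<lambda>j. cis (\<theta> j)) ` {..<n} \<and>
     (\<forall>j<n. 0 < q j \<and> eigen_weight H (cis (\<theta> j)) ((q j)\<^sup>2))"

text \<open>Spectral data of the \<open>2 * n\<close> by \<open>2 * n\<close> real orthogonal matrix of determinant 1.\<close>

definition orthogonal_spectral_data ::
  "nat \<Rightarrow> complex mat \<Rightarrow> (nat \<Rightarrow> real) \<Rightarrow> (nat \<Rightarrow> real) \<Rightarrow> bool" where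
  "orthogonal_spectral_data n H \<theta> q \<longleftrightarrow>
     strict_mono_on {..<n} \<theta> \<and> (\<forall>j<n. 0 < \<theta> j \<and> \<theta> j < pi) \<and>
     {k. eigenvalue H k} = (\<lambda>j. cis (\<theta> j)) ` {..<n} \<union> (\<lambda>j. cis (- \<theta> j)) ` {..<n} \<and>
     (\<forall>j<n. 0 < q j \<and> eigen_weight H (cis (\<theta> j)) ((q j)\<^sup>2 / 2)
                     \<and> eigen_weight H (cis (- \<theta> j)) ((q j)\<^sup>2 / 2))"

text \<open>Both changes of variables take place in dimension \<open>2 * n - 1\<close>. A map \<open>e\<close> enumerates the
  coordinates of \<open>real ^ 'd\<close> as \<open>e 0, \<dots>, e (2 * n - 2)\<close>.

  Spectral side: the angles come first, followed by \<open>q 0, \<dots>, q (n - 2)\<close>; the last \<open>q\<close> is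
  determined by the sum of squares being 1.\<close>

definition angle_of :: "(nat \<Rightarrow> 'd) \<Rightarrow> real ^ 'd \<Rightarrow> nat \<Rightarrow> real" where
  "angle_of e x j = vec_nth x (e j)"

definition q_of :: "nat \<Rightarrow> (nat \<Rightarrow> 'd) \<Rightarrow> real ^ 'd \<Rightarrow> nat \<Rightarrow> real" where
  "q_of n e x j =
     (if j < n - 1 then vec_nth x (e (n + j))
      else sqrt (1 - (\<Sum>i<n - 1. (vec_nth x (e (n + i)))\<^sup>2)))"

text \<open>Parameter side, unitary case: real and imaginary parts of \<open>\<alpha> 0, \<dots>, \<alpha> (n - 2)\<close>, and then
  the argument of the unimodular parameter \<open>\<alpha> (n - 1)\<close>.\<close>

definition unitary_params :: "nat \<Rightarrow> (nat \<Rightarrow> 'd) \<Rightarrow> real ^ 'd \<Rightarrow> nat \<Rightarrow> complex" where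
  "unitary_params n e a j =
     (if j < n - 1 then Complex (vec_nth a (e (2 * j))) (vec_nth a (e (2 * j + 1)))
      else cis (vec_nth a (e (2 * n - 2))))"

definition unitary_domain :: "nat \<Rightarrow> (nat \<Rightarrow> 'd) \<Rightarrow> (real ^ 'd) set" where
  "unitary_domain n e = {a. \<forall>j<n - 1. cmod (unitary_params n e a j) < 1}"

text \<open>Parameter side, orthogonal case: \<open>\<alpha> 0, \<dots>, \<alpha> (2 * n - 2)\<close>, with \<open>\<alpha> (2 * n - 1) = - 1\<close>.\<close>

definition orthogonal_params :: "nat \<Rightarrow> (nat \<Rightarrow> 'd) \<Rightarrow> real ^ 'd \<Rightarrow> nat \<Rightarrow> real" where
  "orthogonal_params n e a j = (if j < 2 * n - 1 then vec_nth a (e j) else - 1)"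

definition orthogonal_domain :: "nat \<Rightarrow> (nat \<Rightarrow> 'd) \<Rightarrow> (real ^ 'd) set" where
  "orthogonal_domain n e =
     {a. \<forall>j<2 * n - 1. - 1 < orthogonal_params n e a j \<and> orthogonal_params n e a j < 1}"

definition unitary_corr :: "nat \<Rightarrow> (nat \<Rightarrow> 'd) \<Rightarrow> real ^ 'd \<Rightarrow> real ^ 'd \<Rightarrow> bool" where
  "unitary_corr n e a x \<longleftrightarrow> a \<in> unitary_domain n e \<and>
     unitary_spectral_data n (hessenberg n (unitary_params n e a)) (angle_of e x) (q_of n e x)"

definition orthogonal_corr :: "nat \<Rightarrow> (nat \<Rightarrow> 'd) \<Rightarrow> real ^ 'd \<Rightarrow> real ^ 'd \<Rightarrow> bool" where
  "orthogonal_corr n e a x \<longleftrightarrow> a \<in> orthogonal_domain n e \<and>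
     orthogonal_spectral_data n
       (hessenberg (2 * n) (\<lambda>j. complex_of_real (orthogonal_params n e a j)))
       (angle_of e x) (q_of n e x)"

text \<open>Near the related pair \<open>(a0, x0)\<close>, the relation \<open>R\<close> is the graph of a homeomorphism \<open>F\<close>,
  taking \<open>x\<close> to \<open>a\<close>, between open sets; it is differentiable and the absolute value of its Jacobian
  determinant at \<open>x0\<close> is \<open>c\<close>, that is, \<open>da = c dx\<close> there. The germ of \<open>F\<close> at \<open>x0\<close>, and hence \<open>c\<close>,
  is determined by \<open>R\<close>.\<close>

definition has_jacobian_at ::
  "(real ^ 'd \<Rightarrow> real ^ 'd \<Rightarrow> bool) \<Rightarrow> real ^ 'd::finite \<Rightarrow> real ^ 'd \<Rightarrow> real \<Rightarrow> bool" where
  "has_jacobian_at R a0 x0 c \<longleftrightarrow>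
     (\<exists>U V F G. open U \<and> x0 \<in> U \<and> open V \<and> a0 \<in> V \<and> homeomorphism U V F G \<and>
        (\<forall>x\<in>U. \<forall>a\<in>V. R a x \<longleftrightarrow> a = F x) \<and>
        F differentiable_on U \<and>
        \<bar>Determinants.det (matrix (frechet_derivative F (at x0)))\<bar> = c)"

end

theory Submission
  imports Defs
begin

text \<open>Let \<open>\<mu> = \<Sum> w\<^sub>j \<delta>(z\<^sub>j)\<close> be the spectral measure of \<open>H\<close> at the first basis vector. The monic
  polynomials generated from the parameters by the Szego recursion are orthogonal for \<open>\<mu>\<close>, and the
  left eigenvectors of \<open>H\<close> consist of their normalized values; hence the eigenvalues are the zeros
  of the last polynomial, they are simple, and \<open>w\<^sub>j\<close> is given by a Christoffel sum. Integrating the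
  recursion shows that the moment \<open>c (k + 1)\<close> is affine in the parameter with index \<open>k\<close>, with slope
  \<open>E k = (\<Prod>l<k. 1 - \<bar>\<alpha> l\<bar>\<^sup>2)\<close>, and otherwise depends on the earlier parameters only. So the
  passage from parameters to moments is triangular, with an explicit Jacobian and an explicit inverse.

  The passage from \<open>(\<theta>, q)\<close> to moments has as Jacobian matrix, up to elementary factors, a
  confluent Vandermonde matrix, with determinant of modulus \<open>(\<Prod>i<j. \<bar>z\<^sub>i - z\<^sub>j\<bar>)^4\<close>. The
  Vandermonde product is eliminated by \<open>(\<Prod>i<j. \<bar>z\<^sub>i - z\<^sub>j\<bar>\<^sup>2) * (\<Prod>j. w\<^sub>j) = (\<Prod>k. E k)\<close>, the Gram
  determinant of the orthogonal polynomials. In the orthogonal case the same argument is run in the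
  variables \<open>cos \<theta>\<^sub>j\<close> with Chebyshev polynomials, and \<open>\<Prod>j. sin \<theta>\<^sub>j\<close> is read off from the
  values of the characteristic polynomial at \<open>1\<close> and \<open>-1\<close>.\<close>

section \<open>Szego polynomials\<close>

text \<open>Eigenvalues are never differentiated. The map analysed goes from
  \<open>(\<theta>, q)\<close> to the parameters, which, apart from the last phase, depend
  rationally on the real and imaginary parts of the moments; the moments are finite trigonometric
  sums. Uniqueness of a measure with given moments then shows that the parameters so computed do
  have the prescribed spectral data.

  A parity obstacle shapes the determinants: there are \<open>2 * n - 1\<close> coordinates, but a
  confluent Vandermonde matrix has size \<open>2 * n\<close>. The additional row is the function 1,
  whose integral is the total mass; its derivatives vanish because the weights sum to 1, so
  bordering leaves the determinant unchanged.

  Count of powers in the unitary case, with G the product of \<open>\<bar>z_i - z_j\<bar>\<close>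
  over ordered pairs and Q the product of all q: the spectral side gives
  \<open>G^2 * Q^2 * (Q / q_n)\<close>, the parameter side one factor \<open>E k\<close> per real
  coordinate, that is \<open>(\<Prod>k<n-1. E k)^2 * E (n - 1)\<close>. Since
  \<open>G * Q^2 = (\<Prod>k<n. E k)\<close>, the quotient is \<open>E (n - 1) / (q_n * Q)\<close>,
  and \<open>E (n - 1)\<close> is the claimed numerator.\<close>

primrec szego :: "(nat \<Rightarrow> complex) \<Rightarrow> nat \<Rightarrow> complex poly \<times> complex poly" where
  "szego \<alpha> 0 = (1, 1)"
| "szego \<alpha> (Suc k) =
     (pCons 0 (fst (szego \<alpha> k)) - Polynomial.smult (cnj (\<alpha> k)) (snd (szego \<alpha> k)),
      snd (szego \<alpha> k) - Polynomial.smult (\<alpha> k) (pCons 0 (fst (szego \<alpha> k))))"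

definition Phi :: "(nat \<Rightarrow> complex) \<Rightarrow> nat \<Rightarrow> complex poly" where
  "Phi \<alpha> k = fst (szego \<alpha> k)"

text \<open>This is the reversed polynomial \<open>z ^ k * cnj (Phi (1 / cnj z))\<close>. Generating
  it by the coupled recursion avoids any explicit reversal of coefficients.\<close>

definition PhiStar :: "(nat \<Rightarrow> complex) \<Rightarrow> nat \<Rightarrow> complex poly" where
  "PhiStar \<alpha> k = snd (szego \<alpha> k)"

text \<open>The \<open>E k\<close> of the overview. That it is the squared norm of
  \<open>Phi \<alpha> k\<close> in the spectral measure is the content of
  \<open>Phi_orthogonal\<close>, for \<open>k\<close> below the size of the matrix.\<close>

definition sqnorm :: "(nat \<Rightarrow> complex) \<Rightarrow> nat \<Rightarrow> real" where
  "sqnorm \<alpha> k = (\<Prod>l<k. 1 - (cmod (\<alpha> l))\<^sup>2)"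

lemma Phi_0 [simp]: "Phi \<alpha> 0 = 1" and PhiStar_0 [simp]: "PhiStar \<alpha> 0 = 1"
  by (simp_all add: Phi_def PhiStar_def)

lemma Phi_Suc: "Phi \<alpha> (Suc k) = pCons 0 (Phi \<alpha> k) - Polynomial.smult (cnj (\<alpha> k)) (PhiStar \<alpha> k)"
  and PhiStar_Suc: "PhiStar \<alpha> (Suc k) = PhiStar \<alpha> k - Polynomial.smult (\<alpha> k) (pCons 0 (Phi \<alpha> k))"
  by (simp_all add: Phi_def PhiStar_def)

lemma poly_Phi_Suc:
  "poly (Phi \<alpha> (Suc k)) z = z * poly (Phi \<alpha> k) z - cnj (\<alpha> k) * poly (PhiStar \<alpha> k) z"
  by (simp add: Phi_Suc)

lemma poly_PhiStar_Suc:
  "poly (PhiStar \<alpha> (Suc k)) z = poly (PhiStar \<alpha> k) z - \<alpha> k * (z * poly (Phi \<alpha> k) z)"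
  by (simp add: PhiStar_Suc)

lemma sqnorm_0 [simp]: "sqnorm \<alpha> 0 = 1"
  and sqnorm_Suc: "sqnorm \<alpha> (Suc k) = sqnorm \<alpha> k * (1 - (cmod (\<alpha> k))\<^sup>2)"
  by (simp_all add: sqnorm_def mult.commute)

text \<open>This locality, inherited by \<open>Phi\<close>, \<open>sqnorm\<close> and
  \<open>moment\<close>, is the source of all triangularity below.\<close>

lemma szego_cong: "(\<And>l. l < k \<Longrightarrow> \<alpha> l = \<beta> l) \<Longrightarrow> szego \<alpha> k = szego \<beta> k"
  by (induction k) auto

lemma Phi_cong: "(\<And>l. l < k \<Longrightarrow> \<alpha> l = \<beta> l) \<Longrightarrow> Phi \<alpha> k = Phi \<beta> k"
  unfolding Phi_def using szego_cong by metis

lemma sqnorm_cong: "(\<And>l. l < k \<Longrightarrow> \<alpha> l = \<beta> l) \<Longrightarrow> sqnorm \<alpha> k = sqnorm \<beta> k"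
  unfolding sqnorm_def by (rule prod.cong) auto

lemma Phi_monic_aux:
  "degree (Phi \<alpha> k) \<le> k \<and> coeff (Phi \<alpha> k) k = 1 \<and> degree (PhiStar \<alpha> k) \<le> k"
proof (induction k)
  case 0
  show ?case by simp
next
  case (Suc k)
  have a: "degree (pCons 0 (Phi \<alpha> k)) \<le> Suc k"
    using Suc by (simp add: degree_pCons_eq_if)
  have b: "degree (Polynomial.smult c (PhiStar \<alpha> k)) \<le> Suc k" for c
    using Suc by (meson degree_smult_le le_Suc_eq le_trans)
  have c: "degree (Polynomial.smult c (pCons 0 (Phi \<alpha> k))) \<le> Suc k" for c
    using a by (meson degree_smult_le le_trans)
  have d: "coeff (PhiStar \<alpha> k) (Suc k) = 0"
    using Suc by (intro coeff_eq_0) auto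
  show ?case
    using Suc a b c d
    by (auto simp: Phi_Suc PhiStar_Suc intro!: degree_diff_le)
qed

lemma coeff_Phi_self [simp]: "coeff (Phi \<alpha> k) k = 1"
  using Phi_monic_aux by blast

lemma degree_Phi [simp]: "degree (Phi \<alpha> k) = k"
  using Phi_monic_aux[of \<alpha> k] by (intro antisym) (auto intro: le_degree)

lemma Phi_nonzero [simp]: "Phi \<alpha> k \<noteq> 0"
  by (metis coeff_0 coeff_Phi_self zero_neq_one)

lemma poly_Phi_sum: "poly (Phi \<alpha> k) z = (\<Sum>i<k. coeff (Phi \<alpha> k) i * z ^ i) + z ^ k"
  by (simp add: poly_altdef flip: lessThan_Suc_atMost)

lemma poly_PhiStar_zero [simp]: "poly (PhiStar \<alpha> k) 0 = 1"
  by (induction k) (simp_all add: poly_PhiStar_Suc)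

lemma poly_Phi_zero: "poly (Phi \<alpha> (Suc k)) 0 = - cnj (\<alpha> k)"
  by (simp add: poly_Phi_Suc)

lemma poly_Phi_real:
  assumes "\<And>l. l < k \<Longrightarrow> \<alpha> l \<in> \<real>"
  shows "poly (Phi \<alpha> k) (cnj z) = cnj (poly (Phi \<alpha> k) z) \<and>
         poly (PhiStar \<alpha> k) (cnj z) = cnj (poly (PhiStar \<alpha> k) z)"
  using assms
proof (induction k)
  case (Suc k)
  then have "cnj (\<alpha> k) = \<alpha> k" by (simp add: Reals_cnj_iff)
  with Suc show ?case by (simp add: poly_Phi_Suc poly_PhiStar_Suc)
qed simp

text \<open>For real parameters both components agree at 1, so the coupled recursion collapses to
  multiplication by \<open>1 - \<alpha> l\<close>.\<close>

lemma poly_Phi_one: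
  assumes "\<And>l. l < k \<Longrightarrow> \<alpha> l \<in> \<real>"
  shows "poly (Phi \<alpha> k) 1 = (\<Prod>l<k. 1 - \<alpha> l) \<and> poly (PhiStar \<alpha> k) 1 = (\<Prod>l<k. 1 - \<alpha> l)"
  using assms
proof (induction k)
  case (Suc k)
  then have "cnj (\<alpha> k) = \<alpha> k" by (simp add: Reals_cnj_iff)
  with Suc show ?case by (simp add: poly_Phi_Suc poly_PhiStar_Suc algebra_simps)
qed simp

text \<open>At -1 the two components agree up to the sign \<open>(- 1) ^ k\<close>; this is where
  the alternating factors in the orthogonal Jacobian originate.\<close>

lemma poly_Phi_minus_one:
  assumes "\<And>l. l < k \<Longrightarrow> \<alpha> l \<in> \<real>"
  shows "poly (PhiStar \<alpha> k) (- 1) = (\<Prod>l<k. 1 + (- 1) ^ l * \<alpha> l) \<and>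
         poly (Phi \<alpha> k) (- 1) = (- 1) ^ k * (\<Prod>l<k. 1 + (- 1) ^ l * \<alpha> l)"
  using assms
proof (induction k)
  case (Suc k)
  then have c: "cnj (\<alpha> k) = \<alpha> k" by (simp add: Reals_cnj_iff)
  show ?case using Suc c
    by (cases "even k") (simp_all add: poly_Phi_Suc poly_PhiStar_Suc algebra_simps)
qed simp

text \<open>The recursion expresses that \<open>Phi \<alpha> (Suc k)\<close> has integral zero for the spectral measure.\<close>

function moment :: "(nat \<Rightarrow> complex) \<Rightarrow> nat \<Rightarrow> complex" where
  "moment \<alpha> 0 = 1"
| "moment \<alpha> (Suc k) = cnj (\<alpha> k) * complex_of_real (sqnorm \<alpha> k)
     - (\<Sum>i<k. coeff (Phi \<alpha> k) i * moment \<alpha> (Suc i))"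
  by pat_completeness auto
termination by (relation "inv_image less_than snd") auto

declare moment.simps [simp del]

lemma moment_cong:
  assumes "\<And>l. l < k \<Longrightarrow> \<alpha> l = \<beta> l"
  shows "moment \<alpha> k = moment \<beta> k"
  using assms
proof (induction k rule: less_induct)
  case (less k)
  show ?case
  proof (cases k)
    case (Suc j)
    have "Phi \<alpha> j = Phi \<beta> j" "sqnorm \<alpha> j = sqnorm \<beta> j" "\<alpha> j = \<beta> j"
      using less.prems Suc by (auto intro!: Phi_cong sqnorm_cong)
    moreover have "moment \<alpha> (Suc i) = moment \<beta> (Suc i)" if "i < j" for i
      using less that Suc by auto
    ultimately show ?thesis by (simp add: Suc moment.simps(2)[of _ j])
  qed (simp add: moment.simps)
qed

section \<open>Eigenvectors and spectral measure of the Hessenberg matrix\<close>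

locale hessenberg_params =
  fixes m :: nat and \<alpha> :: "nat \<Rightarrow> complex"
  assumes m_pos: "m \<ge> 1"
    and param_less: "\<And>j. Suc j < m \<Longrightarrow> cmod (\<alpha> j) < 1"
    and param_last: "cmod (\<alpha> (m - 1)) = 1"
begin

abbreviation H :: "nat \<Rightarrow> nat \<Rightarrow> complex" where
  "H i j \<equiv> hessenberg m \<alpha> $$ (i, j)"

definition rprod :: "nat \<Rightarrow> complex" where
  "rprod j = complex_of_real (\<Prod>l<j. rho \<alpha> l)"

text \<open>The orthonormal polynomials: for \<open>j < m\<close>, \<open>rprod j\<close> is the
  positive square root of \<open>sqnorm \<alpha> j\<close>.\<close>

definition phi :: "nat \<Rightarrow> complex \<Rightarrow> complex" where
  "phi j z = poly (Phi \<alpha> j) z / rprod j"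

lemma rho_pos: "Suc j < m \<Longrightarrow> rho \<alpha> j > 0"
  using param_less[of j] by (simp add: rho_def abs_square_less_1)

lemma rho_sq: "Suc j < m \<Longrightarrow> (rho \<alpha> j)\<^sup>2 = 1 - (cmod (\<alpha> j))\<^sup>2"
  using param_less[of j] by (simp add: rho_def abs_square_le_1)

lemma rprod_0 [simp]: "rprod 0 = 1" by (simp add: rprod_def)

lemma rprod_Suc: "rprod (Suc j) = rprod j * complex_of_real (rho \<alpha> j)"
  by (simp add: rprod_def)

lemma rprod_sq: "j < m \<Longrightarrow> rprod j * rprod j = complex_of_real (sqnorm \<alpha> j)"
proof (induction j)
  case (Suc j)
  have "rprod (Suc j) * rprod (Suc j) = (rprod j * rprod j) * complex_of_real ((rho \<alpha> j)\<^sup>2)"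
    by (simp add: rprod_Suc power2_eq_square)
  also have "\<dots> = complex_of_real (sqnorm \<alpha> (Suc j))"
    using Suc rho_sq[of j] by (simp add: sqnorm_Suc)
  finally show ?case .
qed simp

lemma sqnorm_pos: "j < m \<Longrightarrow> sqnorm \<alpha> j > 0"
  unfolding sqnorm_def using param_less by (intro prod_pos) (auto simp: abs_square_less_1)

lemma rprod_nonzero: "j < m \<Longrightarrow> rprod j \<noteq> 0"
  using rprod_sq[of j] sqnorm_pos[of j] by auto

lemma cnj_rprod [simp]: "cnj (rprod j) = rprod j"
  by (simp add: rprod_def)

lemma phi_0 [simp]: "phi 0 z = 1" by (simp add: phi_def)

lemma H_entry:
  assumes "i < m" "j < m"
  shows "H i j = (if i \<le> j then - prev_param \<alpha> i * cnj (\<alpha> j) * complex_of_real (\<Prod>l = i..<j. rho \<alpha> l)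
                  else if i = Suc j then complex_of_real (rho \<alpha> j) else 0)"
  using assms by (auto simp: hessenberg_def)

lemma dim_H [simp]: "dim_row (hessenberg m \<alpha>) = m" "dim_col (hessenberg m \<alpha>) = m"
  by (simp_all add: hessenberg_def)

text \<open>Above the subdiagonal, column \<open>j\<close> has the common factor
  \<open>cnj (\<alpha> j)\<close>. Splitting off the subdiagonal entry for arbitrary
  \<open>f\<close> serves the left eigenvectors, the orthonormality of columns and the uniqueness of
  eigenvectors alike.\<close>

lemma H_col_sum:
  assumes j: "j < m"
  shows "(\<Sum>i<m. f i * H i j) =
    (\<Sum>i\<le>j. f i * (- prev_param \<alpha> i * complex_of_real (\<Prod>l = i..<j. rho \<alpha> l))) * cnj (\<alpha> j)
    + (if Suc j < m then f (Suc j) * complex_of_real (rho \<alpha> j) else 0)"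
proof -
  have s: "(\<Sum>i<m. f i * H i j) = (\<Sum>i\<in>{..j} \<union> ({Suc j} \<inter> {..<m}). f i * H i j)"
    using j by (intro sum.mono_neutral_right) (auto simp: H_entry)
  have "\<dots> = (\<Sum>i\<le>j. f i * H i j) + (\<Sum>i\<in>{Suc j} \<inter> {..<m}. f i * H i j)"
    by (rule sum.union_disjoint) auto
  moreover have "(\<Sum>i\<in>{Suc j} \<inter> {..<m}. f i * H i j) =
      (if Suc j < m then f (Suc j) * complex_of_real (rho \<alpha> j) else 0)"
    using j by (auto simp: H_entry)
  moreover have "(\<Sum>i\<le>j. f i * H i j) =
    (\<Sum>i\<le>j. f i * (- prev_param \<alpha> i * complex_of_real (\<Prod>l = i..<j. rho \<alpha> l))) * cnj (\<alpha> j)"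
    unfolding sum_distrib_right using j by (intro sum.cong) (auto simp: H_entry)
  ultimately show ?thesis using s by simp
qed

text \<open>Induction by the rearranged recursion \<open>PhiStar (Suc j) = (1 - \<bar>\<alpha>
  j\<bar>^2) * PhiStar j - \<alpha> j * Phi (Suc j)\<close>: passing to the next column multiplies
  the old terms by \<open>rho \<alpha> j\<close> and adds one new term.\<close>

lemma phi_star_sum:
  "j < m \<Longrightarrow> (\<Sum>i\<le>j. phi i z * (- prev_param \<alpha> i * complex_of_real (\<Prod>l = i..<j. rho \<alpha> l)))
     = poly (PhiStar \<alpha> j) z / rprod j"
proof (induction j)
  case 0
  then show ?case by (simp add: prev_param_def)
next
  case (Suc j)
  let ?r = "complex_of_real (rho \<alpha> j)"
  have r: "?r \<noteq> 0" "?r * ?r = 1 - \<alpha> j * cnj (\<alpha> j)" "rprod j \<noteq> 0"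
    using rho_pos[of j] rho_sq[of j] rprod_nonzero[of j] Suc.prems
    by (auto simp flip: of_real_mult complex_norm_square simp: power2_eq_square)
  let ?S = "\<lambda>j. \<Sum>i\<le>j. phi i z * (- prev_param \<alpha> i * complex_of_real (\<Prod>l = i..<j. rho \<alpha> l))"
  have "?S (Suc j) = (\<Sum>i\<le>j. phi i z * (- prev_param \<alpha> i * complex_of_real (\<Prod>l = i..<Suc j. rho \<alpha> l)))
      - \<alpha> j * phi (Suc j) z"
    by (simp add: prev_param_def)
  also have "(\<Sum>i\<le>j. phi i z * (- prev_param \<alpha> i * complex_of_real (\<Prod>l = i..<Suc j. rho \<alpha> l)))
      = ?S j * ?r"
    unfolding sum_distrib_right
    by (intro sum.cong) (simp_all add: prod.atLeastLessThan_Suc mult.assoc)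
  also have "?S j = poly (PhiStar \<alpha> j) z / rprod j" using Suc by simp
  also have "poly (PhiStar \<alpha> j) z / rprod j * ?r - \<alpha> j * phi (Suc j) z
     = (poly (PhiStar \<alpha> j) z * (?r * ?r) - \<alpha> j * poly (Phi \<alpha> (Suc j)) z) / rprod (Suc j)"
    using r by (simp add: phi_def rprod_Suc field_simps)
  also have "poly (PhiStar \<alpha> j) z * (?r * ?r) - \<alpha> j * poly (Phi \<alpha> (Suc j)) z = poly (PhiStar \<alpha> (Suc j)) z"
    unfolding r(2) by (simp add: poly_Phi_Suc poly_PhiStar_Suc algebra_simps)
  finally show ?case .
qed

text \<open>Column \<open>j\<close> of the matrix is the normalized Szego recursion. Only the last
  column leaves a defect, a multiple of \<open>Phi \<alpha> m\<close>, so zeros of this polynomial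
  give left eigenvectors.\<close>

lemma phi_H:
  assumes j: "j < m"
  shows "(\<Sum>i<m. phi i z * H i j) =
     z * phi j z - (if Suc j < m then 0 else poly (Phi \<alpha> m) z / rprod j)"
proof -
  have r: "rprod j \<noteq> 0" using rprod_nonzero j by simp
  have "(\<Sum>i<m. phi i z * H i j) = poly (PhiStar \<alpha> j) z / rprod j * cnj (\<alpha> j)
     + (if Suc j < m then phi (Suc j) z * complex_of_real (rho \<alpha> j) else 0)"
    unfolding H_col_sum[OF j] phi_star_sum[OF j] ..
  also have "\<dots> = z * phi j z - (if Suc j < m then 0 else poly (Phi \<alpha> m) z / rprod j)"
  proof (cases "Suc j < m")
    case True
    with rho_pos[OF True] r show ?thesis
      by (simp add: phi_def rprod_Suc poly_Phi_Suc field_simps)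
  next
    case False
    with j have "m = Suc j" by simp
    with r False show ?thesis by (simp add: phi_def poly_Phi_Suc field_simps)
  qed
  finally show ?thesis .
qed

text \<open>A telescoping sum: \<open>\<bar>\<alpha> j\<bar>^2 = 1 - rho^2\<close>, started by the
  parameter -1 with index -1.\<close>

lemma prev_param_sum:
  "j < m \<Longrightarrow> (\<Sum>i\<le>j. (cmod (prev_param \<alpha> i))\<^sup>2 * (\<Prod>l = i..<j. rho \<alpha> l)\<^sup>2) = 1"
proof (induction j)
  case 0
  then show ?case by (simp add: prev_param_def)
next
  case (Suc j)
  have "(\<Sum>i\<le>j. (cmod (prev_param \<alpha> i))\<^sup>2 * (\<Prod>l = i..<Suc j. rho \<alpha> l)\<^sup>2)
     = (\<Sum>i\<le>j. (cmod (prev_param \<alpha> i))\<^sup>2 * (\<Prod>l = i..<j. rho \<alpha> l)\<^sup>2) * (rho \<alpha> j)\<^sup>2"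
    unfolding sum_distrib_right
    by (intro sum.cong) (simp_all add: prod.atLeastLessThan_Suc power_mult_distrib mult.assoc)
  with Suc rho_sq[of j] show ?case by (simp add: prev_param_def)
qed

lemma H_cols_aux:
  assumes "j \<le> k" "k < m"
  shows "(\<Sum>i<m. cnj (H i j) * H i k) = (if j = k then 1 else 0)"
proof -
  have j: "j < m" using assms by simp
  let ?P = "complex_of_real (\<Prod>l = j..<k. rho \<alpha> l)"
  have eq: "(\<Sum>i<m. cnj (H i j) * H i k) = (\<Sum>i<m. cnj (H i j * cnj (H i k)))"
    by simp
  have "(\<Sum>i<m. H i j * cnj (H i k)) = (\<Sum>i<m. cnj (H i k) * H i j)"
    by (simp add: mult.commute)
  also have "\<dots> = (\<Sum>i\<le>j. cnj (H i k) * (- prev_param \<alpha> i * complex_of_real (\<Prod>l = i..<j. rho \<alpha> l))) * cnj (\<alpha> j)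
    + (if Suc j < m then cnj (H (Suc j) k) * complex_of_real (rho \<alpha> j) else 0)"
    by (rule H_col_sum[OF j])
  also have "(\<Sum>i\<le>j. cnj (H i k) * (- prev_param \<alpha> i * complex_of_real (\<Prod>l = i..<j. rho \<alpha> l)))
     = (\<Sum>i\<le>j. complex_of_real ((cmod (prev_param \<alpha> i))\<^sup>2 * (\<Prod>l = i..<j. rho \<alpha> l)\<^sup>2) * (\<alpha> k * ?P))"
  proof (rule sum.cong)
    fix i assume "i \<in> {..j}"
    then have i: "i \<le> j" "i < m" "i \<le> k" using assms by auto
    have "(\<Prod>l = i..<k. rho \<alpha> l) = (\<Prod>l = i..<j. rho \<alpha> l) * (\<Prod>l = j..<k. rho \<alpha> l)"
      using i assms by (simp add: prod.atLeastLessThan_concat)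
    moreover have "complex_of_real ((cmod (prev_param \<alpha> i))\<^sup>2 * (\<Prod>l = i..<j. rho \<alpha> l)\<^sup>2)
       = prev_param \<alpha> i * cnj (prev_param \<alpha> i)
         * (complex_of_real (\<Prod>l = i..<j. rho \<alpha> l) * complex_of_real (\<Prod>l = i..<j. rho \<alpha> l))"
      by (metis complex_norm_square of_real_mult power2_eq_square)
    ultimately show "cnj (H i k) * (- prev_param \<alpha> i * complex_of_real (\<Prod>l = i..<j. rho \<alpha> l))
      = complex_of_real ((cmod (prev_param \<alpha> i))\<^sup>2 * (\<Prod>l = i..<j. rho \<alpha> l)\<^sup>2) * (\<alpha> k * ?P)"
      using i assms by (simp add: H_entry)
  qed simp
  also have "\<dots> = complex_of_real (\<Sum>i\<le>j. (cmod (prev_param \<alpha> i))\<^sup>2 * (\<Prod>l = i..<j. rho \<alpha> l)\<^sup>2) * (\<alpha> k * ?P)"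
    unfolding of_real_sum sum_distrib_right ..
  also have "\<dots> = \<alpha> k * ?P" using prev_param_sum[OF j] by simp
  also have "\<alpha> k * ?P * cnj (\<alpha> j)
    + (if Suc j < m then cnj (H (Suc j) k) * complex_of_real (rho \<alpha> j) else 0) = (if j = k then 1 else 0)"
  \<comment> \<open>On the diagonal, \<open>\<bar>\<alpha> j\<bar>^2\<close> and the squared
    subdiagonal entry add up to 1; the last column has no such entry, but its parameter is
    unimodular. Off the diagonal, row \<open>Suc j\<close> contributes exactly the negative of the
    sum over the rows up to \<open>j\<close>.\<close>
  proof (cases "j = k")
    case True
    show ?thesis
    proof (cases "Suc j < m")
      case t: True
      have "\<alpha> j * cnj (\<alpha> j) + complex_of_real ((rho \<alpha> j)\<^sup>2) = 1"
        unfolding rho_sq[OF t] of_real_diff complex_norm_square by simp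
      with True t show ?thesis by (simp add: H_entry power2_eq_square)
    next
      case False
      with j have "j = m - 1" by simp
      then have "\<alpha> j * cnj (\<alpha> j) = 1"
        using param_last by (metis complex_norm_square of_real_1 one_power2)
      with True False show ?thesis by simp
    qed
  next
    case False
    with assms have t: "Suc j < m" "Suc j \<le> k" by auto
    have "(\<Prod>l = j..<k. rho \<alpha> l) = rho \<alpha> j * (\<Prod>l = Suc j..<k. rho \<alpha> l)"
      using t by (simp add: prod.atLeast_Suc_lessThan)
    with t False assms show ?thesis by (simp add: H_entry prev_param_def)
  qed
  finally have "(\<Sum>i<m. H i j * cnj (H i k)) = (if j = k then 1 else 0)" .
  then have "cnj (\<Sum>i<m. H i j * cnj (H i k)) = (if j = k then 1 else 0)" by simp
  then show ?thesis by simp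
qed

lemma H_cols:
  assumes "j < m" "k < m"
  shows "(\<Sum>i<m. cnj (H i j) * H i k) = (if j = k then 1 else 0)"
proof (cases "j \<le> k")
  case True
  then show ?thesis using H_cols_aux assms by simp
next
  case False
  then have "(\<Sum>i<m. cnj (H i k) * H i j) = 0" using H_cols_aux[of k j] assms by simp
  then have "cnj (\<Sum>i<m. cnj (H i k) * H i j) = 0" by simp
  with False show ?thesis by (simp add: mult.commute)
qed

end

lemma unitary_left_eigen:
  fixes M :: "nat \<Rightarrow> nat \<Rightarrow> complex"
  assumes un: "\<And>i l. i < m \<Longrightarrow> l < m \<Longrightarrow> (\<Sum>j<m. M i j * cnj (M l j)) = (if i = l then 1 else 0)"
    and ev: "\<And>j. j < m \<Longrightarrow> (\<Sum>i<m. u i * M i j) = k * u j"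
    and nz: "i0 < m" "u i0 \<noteq> 0"
  shows "cmod k = 1" and "\<And>i. i < m \<Longrightarrow> (\<Sum>j<m. M i j * cnj (u j)) = k * cnj (u i)"
proof -
  have K: "k * (\<Sum>j<m. u j * cnj (M l j)) = u l" if l: "l < m" for l
  proof -
    have "k * (\<Sum>j<m. u j * cnj (M l j)) = (\<Sum>j<m. (\<Sum>i<m. u i * M i j) * cnj (M l j))"
      unfolding sum_distrib_left by (intro sum.cong) (simp_all add: ev mult.assoc)
    also have "\<dots> = (\<Sum>i<m. \<Sum>j<m. u i * M i j * cnj (M l j))"
      unfolding sum_distrib_right by (rule sum.swap)
    also have "\<dots> = (\<Sum>i<m. u i * (if i = l then 1 else 0))"
      by (intro sum.cong) (simp_all add: sum_distrib_left mult.assoc flip: un[OF _ l])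
    also have "\<dots> = u l" using l by (simp add: if_distrib cong: if_cong)
    finally show ?thesis .
  qed
  let ?S = "\<Sum>j<m. u j * cnj (u j)"
  have "(k * cnj k) * ?S = (\<Sum>j<m. (k * u j) * cnj (k * u j))"
    unfolding sum_distrib_left by (intro sum.cong) (simp_all add: mult_ac)
  also have "\<dots> = (\<Sum>j<m. (k * u j) * cnj (\<Sum>l<m. u l * M l j))"
    by (intro sum.cong) (simp_all only: ev lessThan_iff)
  also have "\<dots> = (\<Sum>j<m. \<Sum>l<m. k * u j * (cnj (u l) * cnj (M l j)))"
    unfolding cnj_sum sum_distrib_left complex_cnj_mult ..
  also have "\<dots> = (\<Sum>l<m. \<Sum>j<m. k * u j * (cnj (u l) * cnj (M l j)))"
    by (rule sum.swap)
  also have "\<dots> = (\<Sum>l<m. (k * (\<Sum>j<m. u j * cnj (M l j))) * cnj (u l))"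
    unfolding sum_distrib_left sum_distrib_right by (intro sum.cong) (simp_all add: mult_ac)
  also have "\<dots> = ?S" by (intro sum.cong) (simp_all only: K lessThan_iff)
  finally have eq: "(k * cnj k) * ?S = ?S" .
  have S: "?S = complex_of_real (\<Sum>j<m. (cmod (u j))\<^sup>2)"
    unfolding of_real_sum complex_norm_square ..
  have "(\<Sum>j<m. (cmod (u j))\<^sup>2) > 0"
    using nz by (intro sum_pos2[of _ i0]) auto
  then have "?S \<noteq> 0" unfolding S by (metis less_irrefl of_real_eq_0_iff)
  with eq have kk: "k * cnj k = 1" by simp
  then have "complex_of_real ((cmod k)\<^sup>2) = 1" by (simp only: complex_norm_square)
  then have "(cmod k)\<^sup>2 = 1" by (simp only: of_real_eq_1_iff)
  then show "cmod k = 1" by (simp add: power2_eq_1_iff) (metis norm_ge_zero neg_0_le_iff_le not_one_le_zero)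
  fix i assume "i < m"
  from arg_cong[OF K[OF this], of cnj]
  have "cnj k * (\<Sum>j<m. M i j * cnj (u j)) = cnj (u i)" by (simp add: mult.commute)
  then have "(k * cnj k) * (\<Sum>j<m. M i j * cnj (u j)) = k * cnj (u i)" by (simp add: mult.assoc)
  then show "(\<Sum>j<m. M i j * cnj (u j)) = k * cnj (u i)" by (simp add: kk)
qed

context hessenberg_params
begin

lemma H_rows:
  assumes "i < m" "k < m"
  shows "(\<Sum>j<m. H i j * cnj (H k j)) = (if i = k then 1 else 0)"
proof -
  define A where "A = Matrix.mat m m (\<lambda>(i, j). cnj (H j i))"
  define B where "B = Matrix.mat m m (\<lambda>(i, j). H i j)"
  have c: "A \<in> carrier_mat m m" "B \<in> carrier_mat m m" by (simp_all add: A_def B_def)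
  have "A * B = 1\<^sub>m m"
    by (rule eq_matI) (simp_all add: A_def B_def scalar_prod_def H_cols flip: lessThan_atLeast0)
  then have "B * A = 1\<^sub>m m" using mat_mult_left_right_inverse c by blast
  from arg_cong[OF this, of "\<lambda>M. M $$ (i, k)"] assms show ?thesis
    by (simp add: A_def B_def scalar_prod_def flip: lessThan_atLeast0)
qed

lemma root_eigen:
  assumes "poly (Phi \<alpha> m) k = 0"
  shows "cmod k = 1" and "\<And>i. i < m \<Longrightarrow> (\<Sum>j<m. H i j * cnj (phi j k)) = k * cnj (phi i k)"
proof -
  have ev: "\<And>j. j < m \<Longrightarrow> (\<Sum>i<m. phi i k * H i j) = k * phi j k"
    using assms by (simp add: phi_H)
  have nz: "0 < m" "phi 0 k \<noteq> 0" using m_pos by auto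
  show "cmod k = 1" by (rule unitary_left_eigen(1)[OF H_rows ev nz])
  show "\<And>i. i < m \<Longrightarrow> (\<Sum>j<m. H i j * cnj (phi j k)) = k * cnj (phi i k)"
    by (rule unitary_left_eigen(2)[OF H_rows ev nz])
qed

lemma eigenvector_iff_sum:
  "eigenvector (hessenberg m \<alpha>) v k \<longleftrightarrow> v \<in> carrier_vec m \<and> (\<exists>i<m. vec_index v i \<noteq> 0) \<and>
     (\<forall>i<m. (\<Sum>j<m. H i j * vec_index v j) = k * vec_index v i)"
proof -
  have 1: "hessenberg m \<alpha> *\<^sub>v v = k \<cdot>\<^sub>v v \<longleftrightarrow> (\<forall>i<m. (\<Sum>j<m. H i j * vec_index v j) = k * vec_index v i)"
    if "v \<in> carrier_vec m"
    using that by (auto simp: vec_eq_iff scalar_prod_def lessThan_atLeast0)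
  have 2: "v \<noteq> 0\<^sub>v m \<longleftrightarrow> (\<exists>i<m. vec_index v i \<noteq> 0)" if "v \<in> carrier_vec m"
    using that by (auto simp: vec_eq_iff)
  show ?thesis unfolding eigenvector_def dim_H using 1 2 by blast
qed

text \<open>The conjugate \<open>u\<close> of a right eigenvector is a left one. All columns but the
  last determine \<open>u\<close> recursively from \<open>u 0\<close>, because the subdiagonal
  entries are nonzero; the last column then forces the zero of
  \<open>Phi \<alpha> m\<close>.\<close>

lemma eigenvector_imp:
  assumes "eigenvector (hessenberg m \<alpha>) v k"
  shows "poly (Phi \<alpha> m) k = 0" and "vec_index v 0 \<noteq> 0"
    and "\<And>j. j < m \<Longrightarrow> vec_index v j = vec_index v 0 * cnj (phi j k)"
proof -
  define u where "u j = cnj (vec_index v j)" for j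
  obtain i0 where nz: "i0 < m" "vec_index v i0 \<noteq> 0"
    and ev: "\<And>i. i < m \<Longrightarrow> (\<Sum>j<m. vec_index v j * H i j) = k * vec_index v i"
    using assms unfolding eigenvector_iff_sum by (auto simp: mult.commute)
  \<comment> \<open>Orthonormal columns of \<open>H\<close> are orthonormal rows of its
    transpose.\<close>
  have un: "(\<Sum>j<m. H j i * cnj (H j l)) = (if i = l then 1 else 0)" if "i < m" "l < m" for i l
    using H_cols[OF that(2,1)] by (simp add: mult.commute eq_commute)
  have "\<And>j. j < m \<Longrightarrow> (\<Sum>i<m. H i j * cnj (vec_index v i)) = k * cnj (vec_index v j)"
    by (rule unitary_left_eigen(2)[of m "\<lambda>i j. H j i", OF un ev nz])
  then have ev': "\<And>j. j < m \<Longrightarrow> (\<Sum>i<m. u i * H i j) = k * u j"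
    by (simp add: u_def mult.commute)
  define c where "c = u 0"
  have uj: "u j = c * phi j k" if "j < m" for j
    using that
  proof (induction j rule: less_induct)
    case (less j)
    show ?case
    proof (cases j)
      case (Suc l)
      \<comment> \<open>The part of column \<open>l\<close> that only sees indices up to
        \<open>l\<close>. It is linear and covered by the induction hypothesis, which isolates the
        entry with index \<open>Suc l\<close>, multiplied by a nonzero \<open>rho\<close>.\<close>
      define s where "s f = (\<Sum>i\<le>l. f i * (- prev_param \<alpha> i * complex_of_real (\<Prod>p = i..<l. rho \<alpha> p))) * cnj (\<alpha> l)" for f
      have l: "l < m" "Suc l < m" using less Suc by auto
      have 1: "s u + u (Suc l) * complex_of_real (rho \<alpha> l) = k * u l"
        using ev'[OF l(1)] H_col_sum[OF l(1), of u] l by (simp add: s_def)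
      have 2: "s (\<lambda>i. phi i k) + phi (Suc l) k * complex_of_real (rho \<alpha> l) = k * phi l k"
        using phi_H[OF l(1), of k] H_col_sum[OF l(1), of "\<lambda>i. phi i k"] l by (simp add: s_def)
      have 3: "s u = c * s (\<lambda>i. phi i k)"
      proof -
        have "u i = c * phi i k" if "i \<le> l" for i
          using that less.IH[of i] Suc less.prems by auto
        then show ?thesis unfolding s_def sum_distrib_left sum_distrib_right
          by (intro sum.cong) (auto simp: mult.assoc)
      qed
      have "u l = c * phi l k" using less.IH[of l] Suc l by auto
      with 1 have "s u + u (Suc l) * complex_of_real (rho \<alpha> l) = c * (k * phi l k)" by simp
      also have "\<dots> = s u + c * phi (Suc l) k * complex_of_real (rho \<alpha> l)"
        unfolding 2[symmetric] 3 by (simp add: algebra_simps)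
      finally have "u (Suc l) * complex_of_real (rho \<alpha> l) = c * phi (Suc l) k * complex_of_real (rho \<alpha> l)"
        by simp
      then show ?thesis using rho_pos[OF l(2)] Suc by simp
    qed (simp add: c_def)
  qed
  have u0: "c \<noteq> 0" using nz uj[of i0] by (auto simp: u_def)
  then show "vec_index v 0 \<noteq> 0" by (simp add: u_def c_def)
  show "vec_index v j = vec_index v 0 * cnj (phi j k)" if "j < m" for j
    using arg_cong[OF uj[OF that], of cnj] by (simp add: u_def c_def)
  \<comment> \<open>The last column is the one equation not yet used; its defect in
    \<open>phi_H\<close> must vanish.\<close>
  have j: "m - 1 < m" "\<not> Suc (m - 1) < m" using m_pos by auto
  have "k * u (m - 1) = (\<Sum>i<m. u i * H i (m - 1))" using ev' j by simp
  also have "\<dots> = c * (\<Sum>i<m. phi i k * H i (m - 1))"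
    unfolding sum_distrib_left by (intro sum.cong) (simp_all add: uj mult.assoc)
  also have "\<dots> = c * (k * phi (m - 1) k - poly (Phi \<alpha> m) k / rprod (m - 1))"
    using phi_H[OF j(1), of k] j by simp
  finally have "k * u (m - 1) = c * (k * phi (m - 1) k - poly (Phi \<alpha> m) k / rprod (m - 1))" .
  then show "poly (Phi \<alpha> m) k = 0"
    using uj[OF j(1)] u0 rprod_nonzero[OF j(1)] by (simp add: algebra_simps)
qed

definition wt :: "complex \<Rightarrow> real" where
  "wt k = 1 / (\<Sum>j<m. (cmod (phi j k))\<^sup>2)"

lemma phi_norm_pos: "(\<Sum>j<m. (cmod (phi j k))\<^sup>2) > 0"
  using m_pos by (intro sum_pos2[of _ 0]) auto

lemma wt_pos: "wt k > 0"
  using phi_norm_pos by (simp add: wt_def)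

definition roots :: "complex set" where
  "roots = {z. poly (Phi \<alpha> m) z = 0}"

lemma root_eigenvector:
  assumes "k \<in> roots" "c \<noteq> 0"
  shows "eigenvector (hessenberg m \<alpha>) (Matrix.vec m (\<lambda>j. c * cnj (phi j k))) k"
proof -
  have "(\<Sum>j<m. H i j * (c * cnj (phi j k))) = k * (c * cnj (phi i k))" if "i < m" for i
    using root_eigen(2)[of k i] that assms
    by (simp add: roots_def mult.left_commute flip: sum_distrib_left)
  then show ?thesis unfolding eigenvector_iff_sum using assms m_pos by (auto intro!: exI[of _ 0])
qed

lemma eigenvalue_roots: "{k. eigenvalue (hessenberg m \<alpha>) k} = roots"
  using eigenvector_imp(1) root_eigenvector[of _ 1] by (auto simp: eigenvalue_def roots_def)

text \<open>Eigenvectors are multiples of the conjugates of the \<open>phi j k\<close>, and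
  \<open>phi 0 k = 1\<close>; so unit length fixes the modulus of the first component.\<close>

lemma eigen_weight_iff:
  "eigen_weight (hessenberg m \<alpha>) k w \<longleftrightarrow> k \<in> roots \<and> w = wt k"
proof
  assume "eigen_weight (hessenberg m \<alpha>) k w"
  then obtain v where ev: "eigenvector (hessenberg m \<alpha>) v k" and v: "v \<bullet>c v = 1"
    and w: "(cmod (vec_index v 0))\<^sup>2 = w" by (auto simp: eigen_weight_def)
  have c: "v \<in> carrier_vec m" using ev by (simp add: eigenvector_def)
  have "v \<bullet>c v = (\<Sum>j<m. vec_index v j * cnj (vec_index v j))"
    using c by (simp add: scalar_prod_def lessThan_atLeast0)
  also have "\<dots> = complex_of_real (\<Sum>j<m. (cmod (vec_index v j))\<^sup>2)"
    unfolding of_real_sum complex_norm_square ..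
  also have "(\<Sum>j<m. (cmod (vec_index v j))\<^sup>2) = w * (\<Sum>j<m. (cmod (phi j k))\<^sup>2)"
    unfolding sum_distrib_left w[symmetric]
  proof (rule sum.cong)
    fix j assume "j \<in> {..<m}"
    then show "(cmod (vec_index v j))\<^sup>2 = (cmod (vec_index v 0))\<^sup>2 * (cmod (phi j k))\<^sup>2"
      by (subst eigenvector_imp(3)[OF ev]) (simp_all add: norm_mult power_mult_distrib)
  qed simp
  finally have "complex_of_real (w * (\<Sum>j<m. (cmod (phi j k))\<^sup>2)) = 1" using v by simp
  then have "w * (\<Sum>j<m. (cmod (phi j k))\<^sup>2) = 1" by (simp only: of_real_eq_1_iff)
  then show "k \<in> roots \<and> w = wt k"
    using eigenvector_imp(1)[OF ev] phi_norm_pos[of k] by (simp add: roots_def wt_def field_simps)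
next
  assume a: "k \<in> roots \<and> w = wt k"
  define c where "c = complex_of_real (sqrt (wt k))"
  have c: "c \<noteq> 0" "(cmod c)\<^sup>2 = wt k" using wt_pos[of k] by (simp_all add: c_def)
  let ?v = "Matrix.vec m (\<lambda>j. c * cnj (phi j k))"
  have "?v \<bullet>c ?v = (\<Sum>j<m. (c * cnj (phi j k)) * cnj (c * cnj (phi j k)))"
    by (simp add: scalar_prod_def lessThan_atLeast0)
  also have "\<dots> = complex_of_real (\<Sum>j<m. (cmod (c * cnj (phi j k)))\<^sup>2)"
    unfolding of_real_sum complex_norm_square ..
  also have "(\<Sum>j<m. (cmod (c * cnj (phi j k)))\<^sup>2) = wt k * (\<Sum>j<m. (cmod (phi j k))\<^sup>2)"
    by (simp add: norm_mult power_mult_distrib c sum_distrib_left)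
  also have "\<dots> = 1" using phi_norm_pos[of k] by (simp add: wt_def)
  finally have "?v \<bullet>c ?v = 1" by simp
  moreover have "(cmod (vec_index ?v 0))\<^sup>2 = w" using m_pos a c by simp
  ultimately show "eigen_weight (hessenberg m \<alpha>) k w"
    unfolding eigen_weight_def using root_eigenvector a c by blast
qed

text \<open>If \<open>k\<close> were a double zero, differentiating the left eigenvector equation \<open>phi_H\<close> at \<open>k\<close> and
  pairing it with the right eigenvector would give that eigenvector norm zero.\<close>

lemma rsquarefree_Phi: "rsquarefree (Phi \<alpha> m)"
  unfolding rsquarefree_roots
proof (intro allI notI)
  fix k assume k: "poly (Phi \<alpha> m) k = 0 \<and> poly (pderiv (Phi \<alpha> m)) k = 0"
  define d where "d i = poly (pderiv (Phi \<alpha> i)) k / rprod i" for i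
  have der: "((\<lambda>z. phi i z) has_field_derivative d i) (at k)" for i
    unfolding phi_def d_def by (intro DERIV_cdivide poly_DERIV)
  have eq: "(\<Sum>i<m. d i * H i j) = phi j k + k * d j" if j: "j < m" for j
  proof -
    have "((\<lambda>z. \<Sum>i<m. phi i z * H i j) has_field_derivative (\<Sum>i<m. d i * H i j)) (at k)"
      by (intro DERIV_sum DERIV_cmult_right der)
    moreover have "((\<lambda>z. z * phi j z - (if Suc j < m then 0 else poly (Phi \<alpha> m) z / rprod j))
       has_field_derivative (phi j k + k * d j)) (at k)"
    proof (cases "Suc j < m")
      case True
      then show ?thesis by (auto intro!: derivative_eq_intros der)
    next
      case False
      then show ?thesis using k rprod_nonzero[OF j]
        by (auto intro!: derivative_eq_intros der poly_DERIV)
    qed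
    ultimately show ?thesis using phi_H[OF j] by (metis (no_types, lifting) DERIV_unique ext)
  qed
  have "(\<Sum>j<m. (\<Sum>i<m. d i * H i j) * cnj (phi j k)) = (\<Sum>i<m. \<Sum>j<m. d i * H i j * cnj (phi j k))"
    unfolding sum_distrib_right by (rule sum.swap)
  also have "\<dots> = (\<Sum>i<m. d i * (k * cnj (phi i k)))"
    by (intro sum.cong) (simp_all add: mult.assoc k root_eigen(2) flip: sum_distrib_left)
  finally have "(\<Sum>j<m. (phi j k + k * d j) * cnj (phi j k)) = (\<Sum>i<m. d i * (k * cnj (phi i k)))"
    by (simp add: eq)
  then have "(\<Sum>j<m. phi j k * cnj (phi j k)) = 0"
    by (simp add: algebra_simps sum.distrib)
  then have "complex_of_real (\<Sum>j<m. (cmod (phi j k))\<^sup>2) = 0"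
    unfolding of_real_sum complex_norm_square .
  then show False using phi_norm_pos[of k] by (metis less_irrefl of_real_eq_0_iff)
qed

lemma card_roots: "card roots = m"
  using rsquarefree_Phi rsquarefree_card_degree[of "Phi \<alpha> m"] by (simp add: roots_def)

lemma finite_roots [simp]: "finite roots"
  using poly_roots_finite[of "Phi \<alpha> m"] by (simp add: roots_def)

lemma roots_unimodular: "k \<in> roots \<Longrightarrow> cmod k = 1"
  using root_eigen by (simp add: roots_def)

lemma Phi_eq_prod: "Phi \<alpha> m = (\<Prod>z\<in>roots. [:- z, 1:])"
  using complex_poly_decompose_rsquarefree[OF rsquarefree_Phi] by (simp add: roots_def)

text \<open>Evaluating the matrix between a left eigenvector for \<open>k\<close> and a right
  eigenvector for \<open>l\<close> in both orders gives \<open>k\<close> and \<open>l\<close> times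
  the same sum.\<close>

lemma phi_orth:
  assumes "k \<in> roots" "l \<in> roots" "k \<noteq> l"
  shows "(\<Sum>j<m. phi j k * cnj (phi j l)) = 0"
proof -
  have "(\<Sum>j<m. (\<Sum>i<m. phi i k * H i j) * cnj (phi j l)) = (\<Sum>i<m. \<Sum>j<m. phi i k * H i j * cnj (phi j l))"
    unfolding sum_distrib_right by (rule sum.swap)
  also have "\<dots> = (\<Sum>i<m. phi i k * (l * cnj (phi i l)))"
    using assms by (intro sum.cong) (simp_all add: mult.assoc root_eigen(2) roots_def flip: sum_distrib_left)
  also have "\<dots> = l * (\<Sum>j<m. phi j k * cnj (phi j l))"
    by (simp add: sum_distrib_left mult_ac)
  also have "(\<Sum>j<m. (\<Sum>i<m. phi i k * H i j) * cnj (phi j l)) = k * (\<Sum>j<m. phi j k * cnj (phi j l))"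
    unfolding sum_distrib_left using assms
    by (intro sum.cong) (simp_all add: phi_H roots_def mult.assoc cong: if_cong)
  finally show ?thesis using assms by simp
qed

text \<open>Dual orthogonality: the matrix with entries \<open>sqrt (wt z) * phi j z\<close>, rows
  indexed by the zeros, has orthonormal rows by \<open>phi_orth\<close> and the choice of
  \<open>wt\<close>. It is square because there are \<open>m\<close> zeros, hence its columns are
  orthonormal as well.\<close>

lemma phi_orthonormal:
  assumes "j < m" "l < m"
  shows "(\<Sum>z\<in>roots. complex_of_real (wt z) * (phi j z * cnj (phi l z))) = (if j = l then 1 else 0)"
proof -
  obtain f where f: "bij_betw f {0..<m} roots"
    using ex_bij_betw_nat_finite[OF finite_roots] card_roots by auto
  have fr: "f i \<in> roots" if "i < m" for i using f that by (auto simp: bij_betw_def)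
  have fi: "f i = f i' \<longleftrightarrow> i = i'" if "i < m" "i' < m" for i i'
    using f that by (auto simp: bij_betw_def inj_on_def)
  define s where "s i = complex_of_real (sqrt (wt (f i)))" for i
  have ss: "s i * s i = complex_of_real (wt (f i))" for i
    using wt_pos[of "f i"] by (simp add: s_def flip: of_real_mult)
  define A where "A = Matrix.mat m m (\<lambda>(i, j). s i * phi j (f i))"
  define B where "B = Matrix.mat m m (\<lambda>(j, i). s i * cnj (phi j (f i)))"
  have c: "A \<in> carrier_mat m m" "B \<in> carrier_mat m m" by (simp_all add: A_def B_def)
  have "A * B = 1\<^sub>m m"
  proof (rule eq_matI)
    fix i i' assume "i < dim_row (1\<^sub>m m :: complex mat)" "i' < dim_col (1\<^sub>m m :: complex mat)"
    then have i: "i < m" "i' < m" by auto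
    have "(A * B) $$ (i, i') = (\<Sum>j<m. s i * s i' * (phi j (f i) * cnj (phi j (f i'))))"
      using i by (simp add: A_def B_def scalar_prod_def lessThan_atLeast0 mult_ac)
    also have "\<dots> = s i * s i' * (\<Sum>j<m. phi j (f i) * cnj (phi j (f i')))"
      by (simp add: sum_distrib_left)
    also have "\<dots> = 1\<^sub>m m $$ (i, i')"
    proof (cases "i = i'")
      case True
      have "(\<Sum>j<m. phi j (f i) * cnj (phi j (f i))) = complex_of_real (\<Sum>j<m. (cmod (phi j (f i)))\<^sup>2)"
        unfolding of_real_sum complex_norm_square ..
      then have "s i * s i * (\<Sum>j<m. phi j (f i) * cnj (phi j (f i)))
         = complex_of_real (wt (f i) * (\<Sum>j<m. (cmod (phi j (f i)))\<^sup>2))"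
        unfolding ss by (simp only: of_real_mult)
      also have "\<dots> = 1" using phi_norm_pos[of "f i"] by (simp add: wt_def)
      finally show ?thesis using True i by simp
    next
      case False
      then show ?thesis using phi_orth[OF fr fr] i fi by simp
    qed
    finally show "(A * B) $$ (i, i') = 1\<^sub>m m $$ (i, i')" .
  qed (simp_all add: A_def B_def)
  then have "B * A = 1\<^sub>m m" using mat_mult_left_right_inverse c by blast
  from arg_cong[OF this, of "\<lambda>M. M $$ (l, j)"] assms
  have "(\<Sum>i = 0..<m. (s i * s i) * (phi j (f i) * cnj (phi l (f i)))) = (if l = j then 1 else 0)"
    by (simp add: A_def B_def scalar_prod_def mult_ac)
  then show ?thesis
    unfolding ss sum.reindex_bij_betw[OF f, of "\<lambda>z. complex_of_real (wt z) * (phi j z * cnj (phi l z))"]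
    by auto
qed

lemma Phi_orthogonal:
  assumes "j < m" "l < m"
  shows "(\<Sum>z\<in>roots. complex_of_real (wt z) * (poly (Phi \<alpha> j) z * cnj (poly (Phi \<alpha> l) z)))
     = (if j = l then complex_of_real (sqnorm \<alpha> j) else 0)"
proof -
  have "(\<Sum>z\<in>roots. complex_of_real (wt z) * (poly (Phi \<alpha> j) z * cnj (poly (Phi \<alpha> l) z)))
     = (\<Sum>z\<in>roots. rprod j * rprod l * (complex_of_real (wt z) * (phi j z * cnj (phi l z))))"
    using assms rprod_nonzero by (intro sum.cong) (simp_all add: phi_def)
  also have "\<dots> = rprod j * rprod l * (if j = l then 1 else 0)"
    unfolding sum_distrib_left[symmetric] phi_orthonormal[OF assms] ..
  finally show ?thesis using assms rprod_sq by auto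
qed

definition lin :: "complex poly \<Rightarrow> complex" where
  "lin p = (\<Sum>z\<in>roots. complex_of_real (wt z) * poly p z)"

lemma lin_Phi: assumes "0 < k" "k \<le> m" shows "lin (Phi \<alpha> k) = 0"
proof (cases "k = m")
  case True
  then show ?thesis by (simp add: lin_def roots_def)
next
  case False
  then show ?thesis using Phi_orthogonal[of k 0] assms by (simp add: lin_def)
qed

text \<open>The recursion writes \<open>PhiStar (Suc k)\<close> as
  \<open>1 - \<bar>\<alpha> k\<bar>^2\<close> times \<open>PhiStar k\<close> plus a multiple of
  \<open>Phi (Suc k)\<close>, and the latter integrates to zero.\<close>

lemma lin_PhiStar: "k < m \<Longrightarrow> lin (PhiStar \<alpha> k) = complex_of_real (sqnorm \<alpha> k)"
proof (induction k)
  case 0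
  then show ?case using Phi_orthogonal[of 0 0] by (simp add: lin_def)
next
  case (Suc k)
  have eq: "poly (PhiStar \<alpha> (Suc k)) z =
      complex_of_real (1 - (cmod (\<alpha> k))\<^sup>2) * poly (PhiStar \<alpha> k) z - \<alpha> k * poly (Phi \<alpha> (Suc k)) z" for z
    unfolding of_real_diff complex_norm_square
    by (simp add: poly_PhiStar_Suc poly_Phi_Suc algebra_simps)
  have "lin (PhiStar \<alpha> (Suc k)) =
      complex_of_real (1 - (cmod (\<alpha> k))\<^sup>2) * lin (PhiStar \<alpha> k) - \<alpha> k * lin (Phi \<alpha> (Suc k))"
    unfolding lin_def sum_distrib_left sum_subtractf[symmetric]
    by (intro sum.cong refl) (subst eq, simp only: algebra_simps)
  with Suc lin_Phi[of "Suc k"] show ?case by (simp add: sqnorm_Suc mult.commute)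
qed

text \<open>Integrate \<open>z * Phi j = Phi (Suc j) + cnj (\<alpha> j) * PhiStar j\<close>. The
  case \<open>k = m\<close> is included because \<open>Phi \<alpha> m\<close> vanishes on the
  support, although it has no place among the orthonormal polynomials.\<close>

lemma moments: "k \<le> m \<Longrightarrow> (\<Sum>z\<in>roots. complex_of_real (wt z) * z ^ k) = moment \<alpha> k"
proof (induction k rule: less_induct)
  case (less k)
  show ?case
  proof (cases k)
    case 0
    then show ?thesis using lin_PhiStar[of 0] m_pos by (simp add: lin_def moment.simps(1))
  next
    case (Suc j)
    then have j: "j < m" using less by simp
    define L where "L i = (\<Sum>z\<in>roots. complex_of_real (wt z) * z ^ i)" for i
    have "lin (pCons 0 (Phi \<alpha> j)) = lin (Phi \<alpha> (Suc j)) + cnj (\<alpha> j) * lin (PhiStar \<alpha> j)"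
      unfolding lin_def by (simp add: poly_Phi_Suc algebra_simps sum_subtractf sum_distrib_left)
    then have 1: "lin (pCons 0 (Phi \<alpha> j)) = cnj (\<alpha> j) * complex_of_real (sqnorm \<alpha> j)"
      using lin_Phi[of "Suc j"] lin_PhiStar[OF j] j by simp
    have "lin (pCons 0 (Phi \<alpha> j)) =
       (\<Sum>z\<in>roots. (\<Sum>i<j. coeff (Phi \<alpha> j) i * (complex_of_real (wt z) * z ^ Suc i))
          + complex_of_real (wt z) * z ^ Suc j)"
      unfolding lin_def
      by (intro sum.cong) (simp_all add: poly_Phi_sum algebra_simps sum_distrib_left)
    also have "\<dots> = (\<Sum>i<j. coeff (Phi \<alpha> j) i * L (Suc i)) + L (Suc j)"
      unfolding sum.distrib L_def sum_distrib_left by (subst sum.swap) simp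
    also have "(\<Sum>i<j. coeff (Phi \<alpha> j) i * L (Suc i)) = (\<Sum>i<j. coeff (Phi \<alpha> j) i * moment \<alpha> (Suc i))"
    proof (rule sum.cong)
      fix i assume "i \<in> {..<j}"
      then show "coeff (Phi \<alpha> j) i * L (Suc i) = coeff (Phi \<alpha> j) i * moment \<alpha> (Suc i)"
        using less.IH[of "Suc i"] less.prems Suc by (simp add: L_def del: power_Suc)
    qed simp
    finally have "L (Suc j) = moment \<alpha> (Suc j)"
      unfolding 1 by (simp add: moment.simps(2)[of _ j])
    then show ?thesis by (simp add: L_def Suc)
  qed
qed

text \<open>Both sides are the constant term of \<open>Phi \<alpha> m\<close>. In this way the
  unimodular parameter is read off from the eigenvalues alone.\<close>

lemma prod_neg_roots: "(\<Prod>z\<in>roots. - z) = - cnj (\<alpha> (m - 1))"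
proof -
  have "poly (Phi \<alpha> m) 0 = (\<Prod>z\<in>roots. - z)"
    unfolding Phi_eq_prod poly_prod by simp
  moreover have "poly (Phi \<alpha> m) 0 = - cnj (\<alpha> (m - 1))"
    using poly_Phi_zero[of \<alpha> "m - 1"] m_pos by simp
  ultimately show ?thesis by simp
qed

end

section \<open>Vandermonde determinants\<close>

text \<open>Frechet derivatives live on an abstract finite index type, whereas triangular and block
  arguments need numerical indices. The sum over permutations is transported along the enumeration
  \<open>e\<close>.\<close>

lemma det_reindex:
  fixes A :: "'a::comm_ring_1 ^ 'd::finite ^ 'd"
  assumes e: "bij_betw e {..<N} (UNIV :: 'd set)"
  shows "Determinants.det A =
    Determinant.det (Matrix.mat N N (\<lambda>(i, j). vec_nth (vec_nth A (e i)) (e j)))"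
proof -
  let ?S = "{0..<N}"
  have e': "bij_betw e ?S UNIV" using e by (simp add: lessThan_atLeast0)
  let ?g = "inv_into ?S e"
  have g: "bij_betw ?g UNIV ?S" using e' by (rule bij_betw_inv_into)
  have inj: "inj_on e ?S" using e' by (simp add: bij_betw_def)
  have eg: "e (?g x) = x" for x using e' by (metis UNIV_I bij_betw_inv_into_right)
  have ge: "?g (e x) = x" if "x \<in> ?S" for x using e' that by (metis bij_betw_inv_into_left)
  let ?F = "map_permutation ?S e" and ?G = "map_permutation UNIV ?g"
  have "Determinant.det (Matrix.mat N N (\<lambda>(i, j). vec_nth (vec_nth A (e i)) (e j)))
    = (\<Sum>p | p permutes ?S. of_int (sign p) * (\<Prod>i = 0..<N. vec_nth (vec_nth A (e i)) (e (p i))))"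
  proof (subst det_def'[of _ N], simp, rule sum.cong)
    fix p assume "p \<in> {p. p permutes ?S}"
    then have p: "p i < N" if "i < N" for i
      using that permutes_in_image[of p ?S i] by auto
    show "of_int (sign p) * (\<Prod>i = 0..<N. Matrix.mat N N (\<lambda>(i, j). vec_nth (vec_nth A (e i)) (e j)) $$ (i, p i))
       = of_int (sign p) * (\<Prod>i = 0..<N. vec_nth (vec_nth A (e i)) (e (p i)))"
      using p by simp
  qed simp
  also have "\<dots> = (\<Sum>q | q permutes (UNIV :: 'd set). of_int (sign q) * (\<Prod>i\<in>UNIV. vec_nth (vec_nth A i) (q i)))"
  proof (rule sum.reindex_bij_witness[of _ ?G ?F])
    fix p assume "p \<in> {p. p permutes ?S}"
    then have p: "p permutes ?S" by simp
    show "?F p \<in> {q. q permutes UNIV}" using map_permutation_permutes[OF e' p] by simp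
    show "?G (?F p) = p" by (rule map_permutation_compose_inv[OF e' p]) (use ge in auto)
    have "(\<Prod>i\<in>UNIV. vec_nth (vec_nth A i) (?F p i)) = (\<Prod>i\<in>?S. vec_nth (vec_nth A (e i)) (?F p (e i)))"
      by (rule prod.reindex_bij_betw[OF e', symmetric])
    also have "\<dots> = (\<Prod>i\<in>?S. vec_nth (vec_nth A (e i)) (e (p i)))"
      by (intro prod.cong) (simp_all add: map_permutation_apply[OF inj])
    finally show "of_int (sign (?F p)) * (\<Prod>i\<in>UNIV. vec_nth (vec_nth A i) (?F p i))
      = of_int (sign p) * (\<Prod>i = 0..<N. vec_nth (vec_nth A (e i)) (e (p i)))"
      using sign_map_permutation[OF inj p] by simp
  next
    fix q assume "q \<in> {q. q permutes (UNIV :: 'd set)}"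
    then have q: "q permutes UNIV" by simp
    show "?G q \<in> {p. p permutes ?S}" using map_permutation_permutes[OF g q] by simp
    show "?F (?G q) = q" by (rule map_permutation_compose_inv[OF g q]) (use eg in auto)
  qed
  finally show ?thesis by (simp add: Determinants.det_def)
qed

lemma poly_eq_sum_lessThan:
  fixes p :: "'a::comm_ring_1 poly"
  assumes "degree p < N"
  shows "poly p x = (\<Sum>t<N. coeff p t * x ^ t)"
proof -
  have "poly p x = (\<Sum>t\<le>degree p. coeff p t * x ^ t)" by (rule poly_altdef)
  also have "\<dots> = (\<Sum>t<N. coeff p t * x ^ t)"
    using assms by (intro sum.mono_neutral_left) (auto simp: coeff_eq_0)
  finally show ?thesis .
qed

lemma poly_pderiv_eq_sum_lessThan:
  fixes p :: "'a::{comm_ring_1,idom} poly"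
  assumes "degree p < N"
  shows "poly (pderiv p) x = (\<Sum>t<N. coeff p t * (of_nat t * x ^ (t - 1)))"
proof -
  have "poly (pderiv p) x = (\<Sum>t<N. coeff (pderiv p) t * x ^ t)"
    using assms degree_pderiv_le[of p] by (intro poly_eq_sum_lessThan) linarith
  also have "\<dots> = (\<Sum>t<N. coeff p (Suc t) * (of_nat (Suc t) * x ^ t))"
    by (intro sum.cong) (simp_all add: coeff_pderiv mult_ac del: of_nat_Suc)
  also have "\<dots> = (\<Sum>t<Suc N. coeff p t * (of_nat t * x ^ (t - 1)))"
    by (subst sum.lessThan_Suc_shift) simp
  also have "\<dots> = (\<Sum>t<N. coeff p t * (of_nat t * x ^ (t - 1)))"
    using assms by (simp add: coeff_eq_0)
  finally show ?thesis .
qed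

lemma det_coeff_mult:
  fixes f :: "nat \<Rightarrow> 'a::comm_ring_1 poly" and M :: "nat \<Rightarrow> nat \<Rightarrow> 'a"
  shows "Determinant.det (Matrix.mat N N (\<lambda>(r, s). \<Sum>t<N. coeff (f r) t * M t s))
    = Determinant.det (Matrix.mat N N (\<lambda>(r, t). coeff (f r) t)) * Determinant.det (Matrix.mat N N (\<lambda>(t, s). M t s))"
proof -
  have "Matrix.mat N N (\<lambda>(r, s). \<Sum>t<N. coeff (f r) t * M t s)
     = Matrix.mat N N (\<lambda>(r, t). coeff (f r) t) * Matrix.mat N N (\<lambda>(t, s). M t s)"
    by (rule eq_matI) (simp_all add: scalar_prod_def lessThan_atLeast0)
  then show ?thesis by (simp add: det_mult[of _ N])
qed

lemma det_mat_lower_triangular: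
  fixes M :: "nat \<Rightarrow> nat \<Rightarrow> 'a::comm_ring_1"
  assumes "\<And>i j. i < j \<Longrightarrow> j < N \<Longrightarrow> M i j = 0"
  shows "Determinant.det (Matrix.mat N N (\<lambda>(i, j). M i j)) = (\<Prod>i<N. M i i)"
proof -
  have "Determinant.det (Matrix.mat N N (\<lambda>(i, j). M i j)) = prod_list (diag_mat (Matrix.mat N N (\<lambda>(i, j). M i j)))"
    by (rule det_lower_triangular[of N]) (use assms in auto)
  also have "\<dots> = (\<Prod>i<N. M i i)"
    by (simp add: diag_mat_def prod.list_conv_set_nth lessThan_atLeast0)
  finally show ?thesis .
qed

text \<open>Replacing the monomials that index the rows by monic polynomials is multiplication by a
  unitriangular matrix.\<close>

lemma det_monic_mult:
  fixes f :: "nat \<Rightarrow> 'a::comm_ring_1 poly"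
  assumes "\<And>r. r < N \<Longrightarrow> degree (f r) \<le> r" "\<And>r. r < N \<Longrightarrow> coeff (f r) r = 1"
  shows "Determinant.det (Matrix.mat N N (\<lambda>(r, s). \<Sum>t<N. coeff (f r) t * M t s))
    = Determinant.det (Matrix.mat N N (\<lambda>(t, s). M t s))"
proof -
  have "Determinant.det (Matrix.mat N N (\<lambda>(r, t). coeff (f r) t)) = (\<Prod>r<N. coeff (f r) r)"
  proof (rule det_mat_lower_triangular)
    fix i j assume "i < j" "j < N"
    then show "coeff (f i) j = 0" using assms(1)[of i] by (intro coeff_eq_0) auto
  qed
  then show ?thesis unfolding det_coeff_mult using assms(2) by simp
qed

text \<open>Serves the Vandermonde induction and, later, the passage between sizes
  \<open>2 * n - 1\<close> and \<open>2 * n\<close>.\<close>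

lemma det_bordered:
  fixes g :: "nat \<Rightarrow> nat \<Rightarrow> 'a::idom"
  assumes "\<And>s. s < N \<Longrightarrow> g N s = 0"
  shows "Determinant.det (Matrix.mat (Suc N) (Suc N) (\<lambda>(r, s). g r s))
     = Determinant.det (Matrix.mat N N (\<lambda>(r, s). g r s)) * g N N"
proof -
  let ?A = "Matrix.mat N N (\<lambda>(r, s). g r s)"
  let ?B = "Matrix.mat N 1 (\<lambda>(r, s). g r N)"
  let ?D = "Matrix.mat 1 1 (\<lambda>(r, s). g N N)"
  have "Matrix.mat (Suc N) (Suc N) (\<lambda>(r, s). g r s) = four_block_mat ?A ?B (0\<^sub>m 1 N) ?D"
    by (rule eq_matI) (use assms in \<open>auto simp: four_block_mat_def Let_def less_Suc_eq\<close>)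
  also have "Determinant.det \<dots> = Determinant.det ?A * Determinant.det ?D"
    by (rule det_four_block_mat_lower_left_zero) auto
  also have "Determinant.det ?D = g N N" by (simp add: det_single)
  finally show ?thesis .
qed

definition nodal :: "nat \<Rightarrow> (nat \<Rightarrow> complex) \<Rightarrow> complex poly" where
  "nodal n y = (\<Prod>i<n. [:- y i, 1:])"

lemma nodal_monic: "degree (nodal n y) = n \<and> coeff (nodal n y) n = 1"
proof (induction n)
  case (Suc n)
  have s: "nodal (Suc n) y = pCons 0 (nodal n y) - Polynomial.smult (y n) (nodal n y)"
    by (simp add: nodal_def algebra_simps)
  have nz: "nodal n y \<noteq> 0" using Suc by (metis coeff_0 zero_neq_one)
  have "coeff (nodal (Suc n) y) (Suc n) = 1" unfolding s using Suc by (simp add: coeff_eq_0)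
  moreover have "degree (nodal (Suc n) y) \<le> Suc n"
    unfolding s using Suc nz by (intro degree_diff_le) auto
  ultimately show ?case by (metis antisym le_degree zero_neq_one)
qed (simp add: nodal_def)

lemma poly_nodal: "poly (nodal n y) z = (\<Prod>i<n. z - y i)"
  by (simp add: nodal_def poly_prod)

lemma poly_pderiv_nodal:
  assumes "j < n"
  shows "poly (pderiv (nodal n y)) (y j) = (\<Prod>i\<in>{..<n} - {j}. y j - y i)"
proof -
  have "nodal n y = [:- y j, 1:] * (\<Prod>i\<in>{..<n} - {j}. [:- y i, 1:])"
    unfolding nodal_def using assms by (intro prod.remove) auto
  moreover have "poly (pderiv ([:- y j, 1:] * q)) (y j) = poly q (y j)" for q
    by (simp add: pderiv_mult pderiv_pCons del: mult_pCons_left)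
  ultimately show ?thesis by (simp add: poly_prod del: mult_pCons_left)
qed

definition vandermonde :: "nat \<Rightarrow> (nat \<Rightarrow> complex) \<Rightarrow> complex mat" where
  "vandermonde n y = Matrix.mat n n (\<lambda>(r, j). y j ^ r)"

lemma vandermonde_carrier [simp]: "vandermonde n y \<in> carrier_mat n n"
  by (simp add: vandermonde_def)

lemma det_vandermonde: "Determinant.det (vandermonde n y) = (\<Prod>k<n. \<Prod>i<k. y k - y i)"
proof (induction n)
  case (Suc n)
  \<comment> \<open>The last row becomes the nodal polynomial of the first \<open>n\<close> nodes,
    which vanishes in every column but the last.\<close>
  define f where "f r = (if r < n then monom 1 r else nodal n y)" for r
  have f: "degree (f r) \<le> r" "coeff (f r) r = 1" "degree (f r) < Suc n" if "r < Suc n" for r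
    using that nodal_monic[of n y] degree_monom_le[of "1 :: complex" r]
    by (auto simp: f_def less_Suc_eq intro: le_less_trans)
  have "Determinant.det (vandermonde (Suc n) y)
     = Determinant.det (Matrix.mat (Suc n) (Suc n) (\<lambda>(r, s). \<Sum>t<Suc n. coeff (f r) t * y s ^ t))"
    unfolding vandermonde_def by (rule det_monic_mult[symmetric]) (use f in auto)
  also have "Matrix.mat (Suc n) (Suc n) (\<lambda>(r, s). \<Sum>t<Suc n. coeff (f r) t * y s ^ t)
     = Matrix.mat (Suc n) (Suc n) (\<lambda>(r, s). poly (f r) (y s))"
    by (rule eq_matI) (simp_all add: poly_eq_sum_lessThan[OF f(3)] del: sum.lessThan_Suc)
  also have "Determinant.det \<dots> = Determinant.det (Matrix.mat n n (\<lambda>(r, s). poly (f r) (y s))) * poly (f n) (y n)"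
    by (rule det_bordered) (auto simp: f_def poly_nodal)
  also have "Matrix.mat n n (\<lambda>(r, s). poly (f r) (y s)) = vandermonde n y"
    by (rule eq_matI) (simp_all add: f_def vandermonde_def poly_monom)
  finally show ?case using Suc by (simp add: f_def poly_nodal)
qed (simp add: vandermonde_def)

text \<open>The product runs over ordered pairs, so each distance occurs twice: \<open>gaps\<close>
  is the squared modulus of the Vandermonde determinant, and \<open>gaps^2\<close> is the fourth
  power in the overview.\<close>

definition gaps :: "nat \<Rightarrow> (nat \<Rightarrow> complex) \<Rightarrow> real" where
  "gaps n y = (\<Prod>j<n. \<Prod>i\<in>{..<n} - {j}. cmod (y j - y i))"

lemma det_vandermonde_sq: "(cmod (Determinant.det (vandermonde n y)))\<^sup>2 = gaps n y"
proof (induction n)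
  case (Suc n)
  have "gaps (Suc n) y = (\<Prod>j<n. (\<Prod>i\<in>{..<n} - {j}. cmod (y j - y i)) * cmod (y n - y j))
     * (\<Prod>i<n. cmod (y n - y i))"
  proof -
    have "{..<Suc n} - {j} = insert n ({..<n} - {j})" if "j < n" for j using that by auto
    moreover have "{..<Suc n} - {n} = {..<n}" by auto
    ultimately show ?thesis unfolding gaps_def
      by (simp add: norm_minus_commute mult.commute)
  qed
  also have "\<dots> = gaps n y * (\<Prod>i<n. cmod (y n - y i))\<^sup>2"
    by (simp add: gaps_def prod.distrib power2_eq_square)
  finally show ?case
    using Suc by (simp add: det_vandermonde norm_mult power_mult_distrib prod_norm)
qed (simp add: vandermonde_def gaps_def)

text \<open>Columns below \<open>n\<close> hold derivatives of monomials, the others values. In row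
  0 the truncated exponent \<open>t - 1\<close> is harmless, since its factor
  \<open>of_nat t\<close> is zero.\<close>

definition confluent :: "nat \<Rightarrow> (nat \<Rightarrow> complex) \<Rightarrow> nat \<Rightarrow> nat \<Rightarrow> complex" where
  "confluent n y t s = (if s < n then of_nat t * y s ^ (t - 1) else y (s - n) ^ t)"

text \<open>In the basis \<open>1, \<dots>, z ^ (n - 1), p, \<dots>, z ^ (n - 1) * p\<close>, where \<open>p\<close> is the nodal polynomial,
  the matrix becomes block triangular.\<close>

lemma det_confluent:
  "cmod (Determinant.det (Matrix.mat (2 * n) (2 * n) (\<lambda>(t, s). confluent n y t s))) = (gaps n y)\<^sup>2"
proof -
  let ?P = "nodal n y"
  define f where "f r = (if r < n then monom 1 r else monom 1 (r - n) * ?P)" for r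
  have nz: "?P \<noteq> 0" using nodal_monic[of n y] by (metis coeff_0 zero_neq_one)
  have f1: "degree (f r) \<le> r" if "r < 2 * n" for r
  proof (cases "r < n")
    case True
    then show ?thesis using degree_monom_le[of "1 :: complex" r] by (simp add: f_def)
  next
    case False
    have "degree (monom (1 :: complex) (r - n) * ?P) \<le> degree (monom (1 :: complex) (r - n)) + degree ?P"
      by (rule degree_mult_le)
    then show ?thesis using False nodal_monic[of n y] by (simp add: f_def degree_monom_eq)
  qed
  have f2: "coeff (f r) r = 1" for r
    using nodal_monic[of n y] by (simp add: f_def coeff_monom_mult)
  have f3: "degree (f r) < 2 * n" if "r < 2 * n" for r using f1[OF that] that by simp
  have "Determinant.det (Matrix.mat (2 * n) (2 * n) (\<lambda>(t, s). confluent n y t s))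
    = Determinant.det (Matrix.mat (2 * n) (2 * n) (\<lambda>(r, s). \<Sum>t<2 * n. coeff (f r) t * confluent n y t s))"
    by (rule det_monic_mult[symmetric]) (use f1 f2 in auto)
  also have "Matrix.mat (2 * n) (2 * n) (\<lambda>(r, s). \<Sum>t<2 * n. coeff (f r) t * confluent n y t s)
    = Matrix.mat (2 * n) (2 * n) (\<lambda>(r, s). if s < n then poly (pderiv (f r)) (y s) else poly (f r) (y (s - n)))"
    by (rule eq_matI)
       (simp_all add: confluent_def poly_eq_sum_lessThan[OF f3] poly_pderiv_eq_sum_lessThan[OF f3])
  \<comment> \<open>A multiple \<open>z ^ k * ?P\<close> of the nodal polynomial has value 0 at each
    node and derivative \<open>z ^ k\<close> times that of \<open>?P\<close>, hence the zero block
    and the diagonal factor \<open>?D\<close>.\<close>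
  also have "\<dots> = four_block_mat (Matrix.mat n n (\<lambda>(r, s). poly (pderiv (f r)) (y s))) (vandermonde n y)
     (vandermonde n y * Matrix.mat n n (\<lambda>(i, j). if i = j then poly (pderiv ?P) (y j) else 0)) (0\<^sub>m n n)"
    (is "_ = four_block_mat ?A ?B (?V * ?D) ?Z")
  proof (rule eq_matI)
    fix r s assume "r < dim_row (four_block_mat ?A ?B (?V * ?D) ?Z)" "s < dim_col (four_block_mat ?A ?B (?V * ?D) ?Z)"
    then have rs: "r < 2 * n" "s < 2 * n" by (auto simp: vandermonde_def)
    have van: "poly ?P (y j) = 0" if "j < n" for j using that by (auto simp: poly_nodal)
    have VD: "(?V * ?D) $$ (i, j) = y j ^ i * poly (pderiv ?P) (y j)" if "i < n" "j < n" for i j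
      using that by (simp add: vandermonde_def scalar_prod_def if_distrib cong: if_cong)
    show "Matrix.mat (2 * n) (2 * n) (\<lambda>(r, s). if s < n then poly (pderiv (f r)) (y s) else poly (f r) (y (s - n))) $$ (r, s)
       = four_block_mat ?A ?B (?V * ?D) ?Z $$ (r, s)"
    proof (cases "r < n")
      case True
      then show ?thesis using rs
        by (auto simp: four_block_mat_def Let_def vandermonde_def f_def poly_monom)
    next
      case False
      then have "r - n < n" using rs by simp
      then show ?thesis using rs False van VD[of "r - n" s]
        by (auto simp: four_block_mat_def Let_def f_def poly_monom pderiv_mult vandermonde_def
              simp del: index_mult_mat(1))
    qed
  qed (simp_all add: vandermonde_def)
  \<comment> \<open>The block formula applies because the zero block commutes with its left
    neighbour. The resulting sign \<open>(- 1) ^ n\<close> disappears in the modulus.\<close>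
  also have "Determinant.det \<dots> = Determinant.det (?A * ?Z - ?B * (?V * ?D))"
    by (rule det_four_block_mat[of _ n]) (auto simp: vandermonde_def)
  also have "?A * ?Z - ?B * (?V * ?D) = (- 1) \<cdot>\<^sub>m (?B * (?V * ?D))"
    by (rule eq_matI) (auto simp: vandermonde_def)
  also have "Determinant.det \<dots> = (- 1) ^ n * (Determinant.det ?B * (Determinant.det ?V * Determinant.det ?D))"
  proof -
    have D: "?D \<in> carrier_mat n n" "?V * ?D \<in> carrier_mat n n"
      by (auto intro!: mult_carrier_mat[of _ n n])
    have "dim_col (?B * (?V * ?D)) = n" by (simp add: vandermonde_def)
    then show ?thesis
      by (simp only: det_smult det_mult[OF vandermonde_carrier D(2)] det_mult[OF vandermonde_carrier D(1)])
  qed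
  also have "Determinant.det ?D = (\<Prod>i<n. poly (pderiv ?P) (y i))"
    by (subst det_mat_lower_triangular) auto
  also have "cmod ((- 1) ^ n * (Determinant.det ?B * (Determinant.det ?V * (\<Prod>i<n. poly (pderiv ?P) (y i)))))
     = (cmod (Determinant.det ?V))\<^sup>2 * gaps n y"
    by (simp add: norm_mult norm_power power2_eq_square gaps_def poly_pderiv_nodal flip: prod_norm)
  finally show ?thesis by (simp only: det_vandermonde_sq power2_eq_square[of "gaps n y"])
qed

lemma prod_lessThan_add:
  fixes f :: "nat \<Rightarrow> 'a::comm_monoid_mult"
  shows "prod f {..<a + b} = prod f {..<a} * (\<Prod>i<b. f (a + i))"
  by (induction b) (simp_all add: mult.assoc)

lemma sum_if_two:
  fixes F :: "nat \<Rightarrow> 'a::comm_ring_1"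
  assumes "s < N" "s' < N" "s \<noteq> s'"
  shows "(\<Sum>u<N. F u * (if u = s then c else if u = s' then d else 0)) = F s * c + F s' * d"
proof -
  have "(\<Sum>u<N. F u * (if u = s then c else if u = s' then d else 0))
     = (\<Sum>u<N. (if u = s then F s * c else 0) + (if u = s' then F s' * d else 0))"
    using assms by (intro sum.cong) auto
  with assms show ?thesis by (simp add: sum.distrib)
qed

text \<open>\<open>g\<close> factors as values and derivatives of \<open>f\<close> times a matrix
  \<open>K\<close> of column operations. With derivative columns first and the last node at the very
  end, every operation refers only to later columns, so \<open>K\<close> is lower triangular: an
  angle column \<open>s\<close> uses columns \<open>s\<close> and \<open>s + n\<close>, a weight
  column uses itself and the last one.\<close>

lemma det_confluent_system:
  fixes f :: "nat \<Rightarrow> complex poly" and a a' b v y :: "nat \<Rightarrow> complex"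
  assumes n: "n \<ge> 1" and f: "\<And>r. r < 2 * n \<Longrightarrow> degree (f r) < 2 * n"
  defines "g \<equiv> \<lambda>r s. if s < n then a s * poly (pderiv (f r)) (y s) + a' s * poly (f r) (y s)
     else if s < 2 * n - 1 then b (s - n) * (v (s - n) * poly (f r) (y (s - n)) - v (n - 1) * poly (f r) (y (n - 1)))
     else v (n - 1) * poly (f r) (y (n - 1))"
  shows "cmod (Determinant.det (Matrix.mat (2 * n) (2 * n) (\<lambda>(r, s). g r s)))
    = cmod (Determinant.det (Matrix.mat (2 * n) (2 * n) (\<lambda>(r, t). coeff (f r) t))) * (gaps n y)\<^sup>2
      * ((\<Prod>j<n. cmod (a j)) * (\<Prod>j<n - 1. cmod (b j) * cmod (v j)) * cmod (v (n - 1)))"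
proof -
  define F where "F r u = (if u < n then poly (pderiv (f r)) (y u) else poly (f r) (y (u - n)))" for r u
  define K where "K u s = (if u = s then (if s < n then a s else if s < 2 * n - 1 then b (s - n) * v (s - n) else v (n - 1))
     else if s < n \<and> u = s + n then a' s
     else if n \<le> s \<and> s < 2 * n - 1 \<and> u = 2 * n - 1 then - b (s - n) * v (n - 1) else 0)" for u s
  let ?F = "Matrix.mat (2 * n) (2 * n) (\<lambda>(r, u). F r u)" and ?K = "Matrix.mat (2 * n) (2 * n) (\<lambda>(u, s). K u s)"
  have gs: "(\<Sum>u<2 * n. F r u * K u s) = g r s" if r: "r < 2 * n" and s: "s < 2 * n" for r s
  proof -
    have e: "2 * n - 1 - n = n - 1" "\<not> 2 * n - 1 < n" using n by auto
    consider (a) "s < n" | (b) "n \<le> s" "s < 2 * n - 1" | (c) "s = 2 * n - 1" using s by linarith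
    then show ?thesis
    proof cases
      case a
      have "(\<Sum>u<2 * n. F r u * K u s) = (\<Sum>u<2 * n. F r u * (if u = s then a s else if u = s + n then a' s else 0))"
        using a by (intro sum.cong) (auto simp: K_def)
      also have "\<dots> = F r s * a s + F r (s + n) * a' s"
        using a n by (intro sum_if_two) auto
      finally show ?thesis using a by (simp add: F_def g_def mult.commute)
    next
      case b
      have "(\<Sum>u<2 * n. F r u * K u s) = (\<Sum>u<2 * n. F r u * (if u = s then b (s - n) * v (s - n)
          else if u = 2 * n - 1 then - b (s - n) * v (n - 1) else 0))"
        using b by (intro sum.cong) (auto simp: K_def)
      also have "\<dots> = F r s * (b (s - n) * v (s - n)) + F r (2 * n - 1) * (- b (s - n) * v (n - 1))"
        using b n by (intro sum_if_two) auto
      also have "F r (2 * n - 1) = poly (f r) (y (n - 1))"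
        using e by (simp add: F_def)
      also have "F r s = poly (f r) (y (s - n))" using b by (simp add: F_def)
      finally show ?thesis using b by (simp add: g_def algebra_simps)
    next
      case c
      have "(\<Sum>u<2 * n. F r u * K u s) = (\<Sum>u<2 * n. if u = 2 * n - 1 then F r u * v (n - 1) else 0)"
        using c n e by (intro sum.cong) (auto simp: K_def)
      also have "\<dots> = F r (2 * n - 1) * v (n - 1)" using n by simp
      finally show ?thesis using c n e by (simp add: F_def g_def)
    qed
  qed
  have "Matrix.mat (2 * n) (2 * n) (\<lambda>(r, s). g r s) = ?F * ?K"
    by (rule eq_matI) (simp_all add: scalar_prod_def gs flip: lessThan_atLeast0)
  then have 1: "Determinant.det (Matrix.mat (2 * n) (2 * n) (\<lambda>(r, s). g r s)) = Determinant.det ?F * Determinant.det ?K"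
    by (simp add: det_mult[of _ "2 * n"])
  have "?F = Matrix.mat (2 * n) (2 * n) (\<lambda>(r, s). \<Sum>t<2 * n. coeff (f r) t * confluent n y t s)"
    by (rule eq_matI) (simp_all add: F_def confluent_def poly_eq_sum_lessThan[OF f] poly_pderiv_eq_sum_lessThan[OF f])
  then have 2: "Determinant.det ?F = Determinant.det (Matrix.mat (2 * n) (2 * n) (\<lambda>(r, t). coeff (f r) t))
      * Determinant.det (Matrix.mat (2 * n) (2 * n) (\<lambda>(t, s). confluent n y t s))"
    by (simp only: det_coeff_mult)
  have "Determinant.det ?K = (\<Prod>i<2 * n. K i i)"
    by (rule det_mat_lower_triangular) (auto simp: K_def)
  also have "\<dots> = (\<Prod>i<n + (n - 1 + 1). K i i)"
    using n by (intro prod.cong arg_cong[of _ _ lessThan]) auto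
  also have "(\<Prod>i<n + (n - 1 + 1). K i i) = (\<Prod>i<n. K i i) * ((\<Prod>i<n - 1. K (n + i) (n + i)) * K (n + (n - 1)) (n + (n - 1)))"
    unfolding prod_lessThan_add by simp
  also have "(\<Prod>i<n. K i i) = (\<Prod>i<n. a i)" by (simp add: K_def)
  also have "(\<Prod>i<n - 1. K (n + i) (n + i)) = (\<Prod>i<n - 1. b i * v i)"
    by (intro prod.cong) (auto simp: K_def)
  also have "K (n + (n - 1)) (n + (n - 1)) = v (n - 1)"
  proof -
    have e: "n + (n - 1) = 2 * n - 1" "\<not> 2 * n - 1 < n" using n by auto
    show ?thesis unfolding e(1) using e(2) by (simp add: K_def)
  qed
  finally have 3: "cmod (Determinant.det ?K) = (\<Prod>j<n. cmod (a j)) * ((\<Prod>j<n - 1. cmod (b j) * cmod (v j)) * cmod (v (n - 1)))"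
    by (simp add: norm_mult flip: prod_norm)
  show ?thesis unfolding 1 2 norm_mult 3 det_confluent by (simp add: mult_ac)
qed

lemma cnj_det:
  assumes A: "A \<in> carrier_mat N N"
  shows "Determinant.det (Matrix.mat N N (\<lambda>(i, j). cnj (A $$ (j, i)))) = cnj (Determinant.det A)"
proof -
  have "Matrix.mat N N (\<lambda>(i, j). cnj (A $$ (j, i))) = transpose_mat (map_mat cnj A)"
    by (rule eq_matI) (use A in auto)
  also have "Determinant.det \<dots> = Determinant.det (map_mat cnj A)"
    by (rule det_transpose[of _ N]) (use A in auto)
  also have "\<dots> = cnj (Determinant.det A)"
  proof -
    have "Determinant.det (map_mat cnj A) =
       (\<Sum>p | p permutes {0..<N}. of_int (sign p) * (\<Prod>i = 0..<N. map_mat cnj A $$ (i, p i)))"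
      by (rule det_def') (use A in auto)
    also have "\<dots> = (\<Sum>p | p permutes {0..<N}. cnj (of_int (sign p) * (\<Prod>i = 0..<N. A $$ (i, p i))))"
    proof (rule sum.cong)
      fix p assume "p \<in> {p. p permutes {0..<N}}"
      then have p: "p i < N" if "i < N" for i
        using that permutes_in_image[of p "{0..<N}" i] by auto
      show "of_int (sign p) * (\<Prod>i = 0..<N. map_mat cnj A $$ (i, p i))
        = cnj (of_int (sign p) * (\<Prod>i = 0..<N. A $$ (i, p i)))"
        using p A by (auto simp: cnj_prod intro!: prod.cong)
    qed simp
    also have "\<dots> = cnj (Determinant.det A)"
      by (simp only: cnj_sum det_def'[OF A])
    finally show ?thesis .
  qed
  finally show ?thesis .
qed

text \<open>The product with the adjoint is diagonal. Used both for the Gram determinant of the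
  Szego polynomials and for the coefficients of \<open>trig_poly\<close>.\<close>

lemma det_orthogonal_rows:
  fixes S :: "nat \<Rightarrow> nat \<Rightarrow> complex"
  assumes "\<And>r s. r < N \<Longrightarrow> s < N \<Longrightarrow> (\<Sum>t<N. S r t * cnj (S s t)) = (if r = s then complex_of_real (d r) else 0)"
  shows "(cmod (Determinant.det (Matrix.mat N N (\<lambda>(r, t). S r t))))\<^sup>2 = (\<Prod>r<N. d r)"
proof -
  let ?S = "Matrix.mat N N (\<lambda>(r, t). S r t)"
  let ?T = "Matrix.mat N N (\<lambda>(i, j). cnj (?S $$ (j, i)))"
  have "?S * ?T = Matrix.mat N N (\<lambda>(r, s). if r = s then complex_of_real (d r) else 0)"
    by (rule eq_matI) (simp_all add: scalar_prod_def assms flip: lessThan_atLeast0)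
  then have "Determinant.det (?S * ?T) = (\<Prod>r<N. complex_of_real (d r))"
    by (simp add: det_mat_lower_triangular)
  moreover have "Determinant.det (?S * ?T) = Determinant.det ?S * Determinant.det ?T"
    by (rule det_mult[of _ N]) auto
  moreover have "Determinant.det ?T = cnj (Determinant.det ?S)"
    by (rule cnj_det) simp
  ultimately have "complex_of_real ((cmod (Determinant.det ?S))\<^sup>2) = complex_of_real (\<Prod>r<N. d r)"
    by (simp only: complex_norm_square of_real_prod)
  then show ?thesis by (simp only: of_real_eq_iff)
qed

text \<open>On the unit circle \<open>z ^ (1 - n)\<close> times these polynomials runs through the real and imaginary
  parts of \<open>z, \<dots>, z ^ (n - 1)\<close>, followed by \<open>z ^ n\<close> and \<open>1\<close>.\<close>

definition trig_poly :: "nat \<Rightarrow> nat \<Rightarrow> complex poly" where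
  "trig_poly n r =
     (if r < 2 * n - 2 then
        if even r then monom (1 / 2) (n + r div 2) + monom (1 / 2) (n - 2 - r div 2)
        else monom (- \<i> / 2) (n + r div 2) + monom (\<i> / 2) (n - 2 - r div 2)
      else if r = 2 * n - 2 then monom 1 (2 * n - 1) else monom 1 (n - 1))"

lemma degree_trig_poly: "n \<ge> 1 \<Longrightarrow> r < 2 * n \<Longrightarrow> degree (trig_poly n r) < 2 * n"
proof -
  assume a: "n \<ge> 1" "r < 2 * n"
  have "degree (trig_poly n r) \<le> 2 * n - 1"
    unfolding trig_poly_def using a by (auto intro!: degree_add_le order.trans[OF degree_monom_le])
  then show ?thesis using a by linarith
qed

lemma trig_poly_gram:
  assumes "n \<ge> 1" "r < 2 * n" "s < 2 * n"
  shows "(\<Sum>t<2 * n. coeff (trig_poly n r) t * cnj (coeff (trig_poly n s) t))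
     = (if r = s then complex_of_real (if r < 2 * n - 2 then 1 / 2 else 1) else 0)"
proof -
  \<comment> \<open>Each row has at most two monomials, with exponents \<open>A r\<close>,
    \<open>B r\<close> and coefficients \<open>p r\<close>, \<open>q r\<close>; the last two rows
    have a single one, so there \<open>q r = 0\<close> and the value of \<open>B r\<close> is a
    dummy. Rows share exponents only within a pair \<open>2 k\<close>, \<open>2 k + 1\<close>, where
    the coefficients are orthogonal.\<close>
  define A where "A r = (if r = 2 * n - 1 then n - 1 else n + r div 2)" for r
  define B where "B r = (if r < 2 * n - 2 then n - 2 - r div 2 else 0)" for r
  define p where "p r = (if r < 2 * n - 2 then if even r then 1 / 2 else - \<i> / 2 else 1 :: complex)" for r
  define q where "q r = (if r < 2 * n - 2 then if even r then 1 / 2 else \<i> / 2 else 0 :: complex)" for r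
  have c: "coeff (trig_poly n r) t = (if t = A r then p r else 0) + (if t = B r then q r else 0)"
    if "r < 2 * n" for r t
    using that assms(1) by (auto simp: trig_poly_def A_def B_def p_def q_def)
  have AB: "A r < 2 * n" "B r < 2 * n" if "r < 2 * n" for r
    using that assms(1) by (auto simp: A_def B_def)
  have "(\<Sum>t<2 * n. coeff (trig_poly n r) t * cnj (coeff (trig_poly n s) t)) =
     (\<Sum>t<2 * n. (if t = A r then p r * (if A r = A s then cnj (p s) else 0) else 0)
       + (if t = A r then p r * (if A r = B s then cnj (q s) else 0) else 0)
       + (if t = B r then q r * (if B r = A s then cnj (p s) else 0) else 0)
       + (if t = B r then q r * (if B r = B s then cnj (q s) else 0) else 0))"
    using assms by (intro sum.cong) (auto simp: c algebra_simps)
  also have "\<dots> = p r * (if A r = A s then cnj (p s) else 0) + p r * (if A r = B s then cnj (q s) else 0)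
       + q r * (if B r = A s then cnj (p s) else 0) + q r * (if B r = B s then cnj (q s) else 0)"
    using AB[OF assms(2)] by (simp add: sum.distrib)
  also have "\<dots> = (if r = s then complex_of_real (if r < 2 * n - 2 then 1 / 2 else 1) else 0)"
  proof -
    have half: "x = 2 * (x div 2) \<or> x = 2 * (x div 2) + 1" for x :: nat by presburger
    have Age: "n - 1 \<le> A r" for r by (auto simp: A_def intro!: trans_le_add1)
    have Blt: "B r < n - 1" if "q r \<noteq> 0" for r
    proof -
      have "r < 2 * n - 2" using that by (simp add: q_def split: if_splits)
      then show ?thesis by (simp add: B_def)
    qed
    have 1: "\<not> (A r = B s \<and> q s \<noteq> 0)" "\<not> (B r = A s \<and> q r \<noteq> 0)"
      using Age[of r] Age[of s] Blt[of r] Blt[of s] by linarith+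
    have 2: "A r = A s \<longleftrightarrow> r = s \<or> (r < 2 * n - 2 \<and> s < 2 * n - 2 \<and> r div 2 = s div 2)"
    proof (cases "r = 2 * n - 1 \<or> s = 2 * n - 1")
      case True
      then show ?thesis using assms by (auto simp: A_def)
    next
      case False
      then have "A r = A s \<longleftrightarrow> r div 2 = s div 2" by (simp add: A_def)
      moreover have "r div 2 = s div 2 \<longleftrightarrow> r = s \<or> (r < 2 * n - 2 \<and> s < 2 * n - 2 \<and> r div 2 = s div 2)"
      proof
        assume "r div 2 = s div 2"
        then obtain k where k: "r = 2 * k \<or> r = 2 * k + 1" "s = 2 * k \<or> s = 2 * k + 1" "k = r div 2" "k = s div 2"
          using half[of r] half[of s] by metis
        have "r < 2 * n - 2 \<and> s < 2 * n - 2" if "r \<noteq> s"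
        proof -
          have rs: "r = 2 * k \<and> s = 2 * k + 1 \<or> r = 2 * k + 1 \<and> s = 2 * k" using that k(1,2) by auto
          then have "2 * k + 1 < 2 * n" "2 * k + 1 \<noteq> 2 * n - 1" using False assms by auto
          then have "k \<noteq> n - 1" "k < n" using assms(1) by auto
          then have "2 * k + 1 < 2 * n - 2" by linarith
          with rs show ?thesis by auto
        qed
        with k show "r = s \<or> (r < 2 * n - 2 \<and> s < 2 * n - 2 \<and> r div 2 = s div 2)" by metis
      qed auto
      ultimately show ?thesis by blast
    qed
    have 3: "B r = B s \<longleftrightarrow> r div 2 = s div 2" if "r < 2 * n - 2" "s < 2 * n - 2"
    proof -
      have "r div 2 \<le> n - 2" "s div 2 \<le> n - 2" using that by linarith+
      then show ?thesis using that by (simp add: B_def) linarith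
    qed
    have 4: "r div 2 = s div 2 \<Longrightarrow> even r = even s \<Longrightarrow> r = s" by presburger
    show ?thesis
    proof (cases "r < 2 * n - 2 \<and> s < 2 * n - 2")
      case True
      have q0: "q r \<noteq> 0" "q s \<noteq> 0" using True by (auto simp: q_def)
      then have AB': "A r \<noteq> B s" "B r \<noteq> A s" using 1 by auto
      have "A r = A s \<longleftrightarrow> r div 2 = s div 2" using 2 True by blast
      moreover have "B r = B s \<longleftrightarrow> r div 2 = s div 2" using 3 True by blast
      ultimately show ?thesis
        using True 4 AB' by (cases "even r"; cases "even s"; cases "r div 2 = s div 2") (auto simp: p_def q_def)
    next
      case False
      then have "A r = A s \<longleftrightarrow> r = s" using 2 by blast
      moreover have "B r \<noteq> B s \<or> q r = 0 \<or> q s = 0" using False by (auto simp: q_def)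
      ultimately show ?thesis using 1 False by (auto simp: p_def q_def split: if_splits)
    qed
  qed
  finally show ?thesis .
qed

text \<open>All but two of the rows have squared length \<open>1 / 2\<close>. The result will cancel
  against the factors 2 from differentiating the squares of the \<open>q j\<close>.\<close>

lemma det_trig_poly:
  assumes "n \<ge> 1"
  shows "cmod (Determinant.det (Matrix.mat (2 * n) (2 * n) (\<lambda>(r, t). coeff (trig_poly n r) t))) = (1 / 2) ^ (n - 1)"
proof -
  have "(cmod (Determinant.det (Matrix.mat (2 * n) (2 * n) (\<lambda>(r, t). coeff (trig_poly n r) t))))\<^sup>2
    = (\<Prod>r<2 * n. if r < 2 * n - 2 then 1 / 2 else 1)"
    by (rule det_orthogonal_rows) (use trig_poly_gram assms in auto)
  also have "\<dots> = (1 / 2) ^ (2 * n - 2)"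
  proof -
    obtain k where "n = Suc k" using assms by (metis Suc_le_D One_nat_def)
    then show ?thesis by simp
  qed
  also have "\<dots> = ((1 / 2) ^ (n - 1))\<^sup>2"
  proof -
    have "2 * n - 2 = (n - 1) * 2" by simp
    then show ?thesis by (simp only: power_mult)
  qed
  finally show ?thesis by (simp add: power2_eq_iff_nonneg)
qed

fun cheb :: "nat \<Rightarrow> complex poly" where
  "cheb 0 = 1"
| "cheb (Suc 0) = [:0, 1:]"
| "cheb (Suc (Suc k)) = pCons 0 (Polynomial.smult 2 (cheb (Suc k))) - cheb k"

lemma cheb_degree: "degree (cheb k) \<le> k \<and> coeff (cheb (Suc k)) (Suc k) = 2 ^ k"
proof (induction k rule: cheb.induct)
  case (3 k)
  have "degree (pCons 0 (Polynomial.smult 2 (cheb (Suc k)))) \<le> Suc (Suc k)"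
    using 3 by (simp add: degree_pCons_eq_if)
  then have a: "degree (cheb (Suc (Suc k))) \<le> Suc (Suc k)"
    using 3 by (auto intro!: degree_diff_le)
  have "coeff (cheb (Suc k)) (Suc (Suc (Suc k))) = 0" "coeff (cheb (Suc k)) (Suc (Suc k)) = 0"
    using 3 by (auto intro!: coeff_eq_0)
  with a 3 show ?case by (simp add: numeral_eq_Suc) 
qed (auto simp: degree_pCons_eq_if)

lemma poly_cheb: "poly (cheb k) (complex_of_real (cos t)) = complex_of_real (cos (real k * t))"
proof (induction k rule: cheb.induct)
  case (3 k)
  have "cos (real (Suc (Suc k)) * t) = 2 * cos t * cos (real (Suc k) * t) - cos (real k * t)"
    using cos_add[of "real (Suc k) * t" t] cos_diff[of "real (Suc k) * t" t]
    by (simp add: algebra_simps)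
  with 3 show ?case by (simp add: mult_ac)
qed auto

text \<open>The constant polynomial is moved to the end because \<open>det_spectral_sum\<close>
  expects the bordering row 1 there.\<close>

definition cheb_row :: "nat \<Rightarrow> nat \<Rightarrow> complex poly" where
  "cheb_row n r = (if r < 2 * n - 1 then cheb (Suc r) else 1)"

lemma degree_cheb_row: "n \<ge> 1 \<Longrightarrow> r < 2 * n \<Longrightarrow> degree (cheb_row n r) < 2 * n"
  using cheb_degree[of "Suc r"] by (auto simp: cheb_row_def)

lemma det_cheb_row:
  assumes n: "n \<ge> 1"
  shows "cmod (Determinant.det (Matrix.mat (2 * n) (2 * n) (\<lambda>(r, t). coeff (cheb_row n r) t)))
     = 2 ^ ((2 * n - 1) * (n - 1))"
proof -
  \<comment> \<open>A cyclic shift puts the constant row first and makes the coefficient matrix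
    triangular; its sign is irrelevant. The diagonal consists of the leading coefficients 1 and
    \<open>2 ^ 0, ..., 2 ^ (2 * n - 2)\<close>.\<close>
  define p where "p r = (if r < 2 * n then if r = 2 * n - 1 then 0 else Suc r else r)" for r
  have "inj_on p {0..<2 * n}" by (auto simp: inj_on_def p_def split: if_splits)
  moreover have "p ` {0..<2 * n} \<subseteq> {0..<2 * n}" using n by (auto simp: p_def)
  ultimately have "bij_betw p {0..<2 * n} {0..<2 * n}"
    by (auto simp: bij_betw_def card_image card_subset_eq)
  then have p: "p permutes {0..<2 * n}" by (rule bij_imp_permutes) (auto simp: p_def)
  let ?A = "Matrix.mat (2 * n) (2 * n) (\<lambda>(r, t). coeff (cheb r) t)"
  have "Matrix.mat (2 * n) (2 * n) (\<lambda>(r, t). coeff (cheb_row n r) t)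
     = Matrix.mat (2 * n) (2 * n) (\<lambda>(r, t). ?A $$ (p r, t))"
    by (rule eq_matI) (use n in \<open>auto simp: p_def cheb_row_def\<close>)
  also have "Determinant.det \<dots> = of_int (sign p) * Determinant.det ?A"
    by (rule det_permute_rows[OF _ p]) simp
  also have "Determinant.det ?A = (\<Prod>r<2 * n. coeff (cheb r) r)"
    by (rule det_mat_lower_triangular) (use cheb_degree in \<open>auto intro!: coeff_eq_0 intro: le_less_trans\<close>)
  also have "\<dots> = (\<Prod>r<Suc (2 * n - 1). coeff (cheb r) r)" using n by simp
  also have "\<dots> = (\<Prod>r<2 * n - 1. 2 ^ r)"
    unfolding prod.lessThan_Suc_shift using cheb_degree by simp
  also have "\<dots> = 2 ^ (\<Sum>r<2 * n - 1. r)" by (simp add: power_sum)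
  also have "(\<Sum>r<2 * n - 1. r) = (2 * n - 1) * (n - 1)"
  proof -
    have "(\<Sum>r<Suc k. r) * 2 = Suc k * k" for k by (induction k) auto
    from this[of "2 * n - 2"] have "(\<Sum>r<2 * n - 1. r) * 2 = (2 * n - 1) * (n - 1) * 2"
      using n by (simp add: Suc_diff_Suc numeral_2_eq_2 algebra_simps)
    then show ?thesis by simp
  qed
  also have "cmod (of_int (sign p) * 2 ^ ((2 * n - 1) * (n - 1))) = 2 ^ ((2 * n - 1) * (n - 1))"
    by (simp add: norm_mult norm_power sign_def)
  finally show ?thesis .
qed

section \<open>The measure is determined by its moments\<close>

text \<open>The matrix of \<open>sqrt w * Phi r\<close> at the nodes has orthogonal rows with
  squared lengths \<open>sqnorm \<alpha> r\<close>; as the \<open>Phi r\<close> are monic, its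
  determinant is also the Vandermonde determinant times the product of the
  \<open>sqrt w\<close>.\<close>

lemma (in hessenberg_params) gaps_prod_wt:
  assumes lam: "bij_betw lam {..<m} roots"
  shows "gaps m lam * (\<Prod>j<m. wt (lam j)) = (\<Prod>k<m. sqnorm \<alpha> k)"
proof -
  define s where "s j = complex_of_real (sqrt (wt (lam j)))" for j
  have ss: "s j * s j = complex_of_real (wt (lam j))" "cnj (s j) = s j" for j
    using wt_pos[of "lam j"] by (simp_all add: s_def flip: of_real_mult)
  have "(\<Sum>t<m. s t * poly (Phi \<alpha> r) (lam t) * cnj (s t * poly (Phi \<alpha> r') (lam t)))
     = (if r = r' then complex_of_real (sqnorm \<alpha> r) else 0)" if "r < m" "r' < m" for r r'
  proof -
    have "(\<Sum>t<m. s t * poly (Phi \<alpha> r) (lam t) * cnj (s t * poly (Phi \<alpha> r') (lam t)))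
       = (\<Sum>t<m. complex_of_real (wt (lam t)) * (poly (Phi \<alpha> r) (lam t) * cnj (poly (Phi \<alpha> r') (lam t))))"
      by (intro sum.cong) (simp_all add: ss(2) ss(1)[symmetric] mult_ac)
    also have "\<dots> = (\<Sum>z\<in>roots. complex_of_real (wt z) * (poly (Phi \<alpha> r) z * cnj (poly (Phi \<alpha> r') z)))"
      by (rule sum.reindex_bij_betw[OF lam])
    finally show ?thesis using Phi_orthogonal[OF that] by simp
  qed
  then have 1: "(cmod (Determinant.det (Matrix.mat m m (\<lambda>(r, t). s t * poly (Phi \<alpha> r) (lam t)))))\<^sup>2
      = (\<Prod>k<m. sqnorm \<alpha> k)"
    by (rule det_orthogonal_rows)
  have "Matrix.mat m m (\<lambda>(r, t). s t * poly (Phi \<alpha> r) (lam t))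
     = Matrix.mat m m (\<lambda>(r, t). \<Sum>i<m. coeff (Phi \<alpha> r) i * (lam t ^ i * s t))"
    by (rule eq_matI) (simp_all add: poly_eq_sum_lessThan[of _ m] sum_distrib_left mult_ac)
  also have "Determinant.det \<dots> = Determinant.det (Matrix.mat m m (\<lambda>(i, t). lam t ^ i * s t))"
    by (rule det_monic_mult) auto
  also have "Matrix.mat m m (\<lambda>(i, t). lam t ^ i * s t)
     = vandermonde m lam * Matrix.mat m m (\<lambda>(i, j). if i = j then s j else 0)"
    by (rule eq_matI) (simp_all add: vandermonde_def scalar_prod_def if_distrib cong: if_cong)
  also have "Determinant.det \<dots> = Determinant.det (vandermonde m lam) * (\<Prod>j<m. s j)"
    by (subst det_mult[of _ m]) (auto simp: det_mat_lower_triangular)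
  finally have "(cmod (Determinant.det (vandermonde m lam)))\<^sup>2 * (cmod (\<Prod>j<m. s j))\<^sup>2 = (\<Prod>k<m. sqnorm \<alpha> k)"
    using 1 by (simp add: norm_mult power_mult_distrib)
  moreover have "(cmod (\<Prod>j<m. s j))\<^sup>2 = (\<Prod>j<m. wt (lam j))"
    using wt_pos by (simp add: s_def less_imp_le prod_power_distrib flip: prod_norm)
  ultimately show ?thesis by (simp add: det_vandermonde_sq)
qed

text \<open>On the unit circle \<open>z ^ a * cnj (z ^ c)\<close> depends only on
  \<open>a - c\<close>. The vanishing constant coefficient of \<open>T\<close> restricts to
  \<open>c \<ge> 1\<close>, so the moment of order \<open>m\<close> does not occur even if
  \<open>R\<close> has degree \<open>m\<close>.\<close>

lemma moments_determine_pairing: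
  fixes A B :: "complex set" and u v :: "complex \<Rightarrow> real"
  assumes A: "finite A" "\<And>z. z \<in> A \<Longrightarrow> cmod z = 1" and B: "finite B" "\<And>z. z \<in> B \<Longrightarrow> cmod z = 1"
    and mo: "\<And>k. k < m \<Longrightarrow> (\<Sum>z\<in>A. complex_of_real (u z) * z ^ k) = (\<Sum>z\<in>B. complex_of_real (v z) * z ^ k)"
    and R: "degree R \<le> m" and T: "degree T < m" "coeff T 0 = 0"
  shows "(\<Sum>z\<in>A. complex_of_real (u z) * (poly R z * cnj (poly T z)))
       = (\<Sum>z\<in>B. complex_of_real (v z) * (poly R z * cnj (poly T z)))"
proof -
  define M where "M S w a c = (\<Sum>z\<in>S. complex_of_real (w z) * (z ^ a * cnj (z ^ c)))" for S :: "complex set" and w :: "complex \<Rightarrow> real" and a c :: nat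
  have expand: "(\<Sum>z\<in>S. complex_of_real (w z) * (poly R z * cnj (poly T z)))
     = (\<Sum>a<Suc m. \<Sum>c<m. coeff R a * cnj (coeff T c) * M S w a c)" for S w
  proof -
    have "(\<Sum>z\<in>S. complex_of_real (w z) * (poly R z * cnj (poly T z)))
      = (\<Sum>z\<in>S. \<Sum>a<Suc m. \<Sum>c<m. coeff R a * cnj (coeff T c) * (complex_of_real (w z) * (z ^ a * cnj (z ^ c))))"
    proof (rule sum.cong)
      fix z assume "z \<in> S"
      have "poly R z * cnj (poly T z) = (\<Sum>a<Suc m. \<Sum>c<m. (coeff R a * z ^ a) * cnj (coeff T c * z ^ c))"
        using R T unfolding sum_product[symmetric] cnj_sum[symmetric]
        by (simp only: poly_eq_sum_lessThan[of R "Suc m"] poly_eq_sum_lessThan[of T m] less_Suc_eq_le)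
      then show "complex_of_real (w z) * (poly R z * cnj (poly T z))
        = (\<Sum>a<Suc m. \<Sum>c<m. coeff R a * cnj (coeff T c) * (complex_of_real (w z) * (z ^ a * cnj (z ^ c))))"
        by (simp only: sum_distrib_left complex_cnj_mult mult_ac)
    qed simp
    also have "\<dots> = (\<Sum>a<Suc m. \<Sum>z\<in>S. \<Sum>c<m. coeff R a * cnj (coeff T c) * (complex_of_real (w z) * (z ^ a * cnj (z ^ c))))"
      by (rule sum.swap)
    also have "\<dots> = (\<Sum>a<Suc m. \<Sum>c<m. \<Sum>z\<in>S. coeff R a * cnj (coeff T c) * (complex_of_real (w z) * (z ^ a * cnj (z ^ c))))"
      by (intro sum.cong refl sum.swap)
    finally show ?thesis unfolding M_def sum_distrib_left .
  qed
  have red: "M S w a c = (if c \<le> a then (\<Sum>z\<in>S. complex_of_real (w z) * z ^ (a - c))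
      else cnj (\<Sum>z\<in>S. complex_of_real (w z) * z ^ (c - a)))"
    if "\<And>z. z \<in> S \<Longrightarrow> cmod z = 1" for S w a c
  proof -
    have zz: "z ^ k * cnj (z ^ k) = 1" if "z \<in> S" for z k
      using \<open>\<And>z. z \<in> S \<Longrightarrow> cmod z = 1\<close>[OF that]
      by (metis complex_norm_square norm_power of_real_1 power_one)
    show ?thesis
    proof (cases "c \<le> a")
      case True
      have "z ^ a * cnj (z ^ c) = z ^ (a - c)" if "z \<in> S" for z
      proof -
        have "z ^ a = z ^ (a - c) * z ^ c" using True by (simp flip: power_add)
        then show ?thesis using zz[OF that, of c] by (simp add: mult.assoc)
      qed
      with True show ?thesis by (simp add: M_def)
    next
      case False
      have "z ^ a * cnj (z ^ c) = cnj (z ^ (c - a))" if "z \<in> S" for z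
      proof -
        have "z ^ c = z ^ a * z ^ (c - a)" using False by (simp flip: power_add)
        then have "z ^ a * cnj (z ^ c) = (z ^ a * cnj (z ^ a)) * cnj (z ^ (c - a))"
          by (simp only: complex_cnj_mult mult.assoc)
        then show ?thesis by (simp only: zz[OF that] mult_1)
      qed
      with False show ?thesis by (simp add: M_def)
    qed
  qed
  have "coeff R a * cnj (coeff T c) * M A u a c = coeff R a * cnj (coeff T c) * M B v a c"
    if "a < Suc m" "c < m" for a c
  proof (cases "c = 0")
    case True
    then show ?thesis using T by simp
  next
    case False
    then have "a - c < m" "c - a < m" using that by auto
    then have "M A u a c = M B v a c" using red[OF A(2)] red[OF B(2)] mo by simp
    then show ?thesis by simp
  qed
  then show ?thesis unfolding expand by (intro sum.cong) auto
qed

lemma degree_prod_roots: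
  fixes A :: "complex set"
  assumes "finite A"
  shows "degree (\<Prod>z\<in>A. [:- z, 1:]) = card A" "coeff (\<Prod>z\<in>A. [:- z, 1:]) (card A) = 1"
proof -
  show 1: "degree (\<Prod>z\<in>A. [:- z, 1:]) = card A"
    by (subst degree_prod_eq_sum_degree) auto
  have "lead_coeff (\<Prod>z\<in>A. [:- z, 1:]) = 1"
    by (simp add: lead_coeff_prod)
  then show "coeff (\<Prod>z\<in>A. [:- z, 1:]) (card A) = 1" by (simp add: 1)
qed

text \<open>Let \<open>D\<close> be the difference of the two nodal polynomials. It has degree less than \<open>m\<close> and vanishes at
  \<open>0\<close>, so each nodal polynomial is orthogonal to \<open>D\<close>: for its own measure trivially, and for the other
  one because the pairing only involves moments of order less than \<open>m\<close>. Hence \<open>D\<close> has norm zero.\<close>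

lemma moments_determine_measure:
  fixes A B :: "complex set" and u v :: "complex \<Rightarrow> real"
  assumes A: "finite A" "card A = m" "\<And>z. z \<in> A \<Longrightarrow> cmod z = 1" "\<And>z. z \<in> A \<Longrightarrow> u z > 0"
    and B: "finite B" "card B = m" "\<And>z. z \<in> B \<Longrightarrow> cmod z = 1"
    and m: "m \<ge> 1"
    and mo: "\<And>k. k < m \<Longrightarrow> (\<Sum>z\<in>A. complex_of_real (u z) * z ^ k) = (\<Sum>z\<in>B. complex_of_real (v z) * z ^ k)"
    and pr: "(\<Prod>z\<in>A. - z) = (\<Prod>z\<in>B. - z)"
  shows "A = B" and "\<And>z. z \<in> A \<Longrightarrow> u z = v z"
proof -
  define P where "P S = (\<Prod>z\<in>S. [:- z, 1:])" for S :: "complex set"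
  have Pz: "poly (P S) z = 0 \<longleftrightarrow> z \<in> S" if "finite S" for S z
    using that by (auto simp: P_def poly_prod)
  define D where "D = P A - P B"
  have PA: "degree (P A) = m" "coeff (P A) m = 1" and PB: "degree (P B) = m" "coeff (P B) m = 1"
    using degree_prod_roots[OF A(1)] degree_prod_roots[OF B(1)] A(2) B(2) by (simp_all add: P_def)
  have "degree D \<le> m" unfolding D_def using PA PB by (intro degree_diff_le) auto
  moreover have "coeff D m = 0" using PA PB by (simp add: D_def)
  ultimately have degD: "degree D < m" using m
    by (cases "D = 0") (auto simp: order.order_iff_strict)
  \<comment> \<open>The constant coefficients are the products of the negated nodes; their agreement
    makes up for the moment of order \<open>m\<close>.\<close>
  have D0: "coeff D 0 = 0"
    using pr by (simp add: D_def P_def poly_prod flip: poly_0_coeff_0)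
  note pairing = moments_determine_pairing[OF A(1,3) B(1,3) mo _ degD D0]
  have "(\<Sum>z\<in>A. complex_of_real (u z) * (poly (P B) z * cnj (poly D z))) =
        (\<Sum>z\<in>B. complex_of_real (v z) * (poly (P B) z * cnj (poly D z)))"
    by (rule pairing) (simp_all add: PB)
  also have "\<dots> = 0" using Pz[OF B(1)] by (intro sum.neutral) auto
  finally have *: "(\<Sum>z\<in>A. complex_of_real (u z) * (poly (P B) z * cnj (poly D z))) = 0" .
  have "(\<Sum>z\<in>A. complex_of_real (u z) * (poly D z * cnj (poly D z)))
     = (\<Sum>z\<in>A. - (complex_of_real (u z) * (poly (P B) z * cnj (poly D z))))"
  proof (rule sum.cong)
    fix z assume "z \<in> A"
    then have "poly D z = - poly (P B) z" using Pz[OF A(1)] by (simp add: D_def)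
    then show "complex_of_real (u z) * (poly D z * cnj (poly D z))
      = - (complex_of_real (u z) * (poly (P B) z * cnj (poly D z)))" by (simp only: mult_minus_left mult_minus_right)
  qed simp
  also have "\<dots> = 0" unfolding sum_negf * by simp
  finally have "(\<Sum>z\<in>A. complex_of_real (u z) * (poly D z * cnj (poly D z))) = 0" .
  then have "complex_of_real (\<Sum>z\<in>A. u z * (cmod (poly D z))\<^sup>2) = 0"
    by (simp only: of_real_sum of_real_mult complex_norm_square)
  then have "(\<Sum>z\<in>A. u z * (cmod (poly D z))\<^sup>2) = 0" by (simp only: of_real_eq_0_iff)
  then have "u z * (cmod (poly D z))\<^sup>2 = 0" if "z \<in> A" for z
    using that A by (subst (asm) sum_nonneg_eq_0_iff) (auto simp: less_imp_le)
  then have "A \<subseteq> {z. poly D z = 0}" using A(4) by fastforce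
  have "D = 0"
  proof (rule ccontr)
    assume nz: "D \<noteq> 0"
    have "card A \<le> card {z. poly D z = 0}"
      by (rule card_mono[OF poly_roots_finite[OF nz]]) fact
    also have "\<dots> \<le> degree D" by (rule card_poly_roots_bound[OF nz])
    finally show False using degD A(2) by simp
  qed
  then have "P A = P B" by (simp add: D_def)
  then show AB: "A = B" using Pz[OF A(1)] Pz[OF B(1)] by auto
  fix z assume z: "z \<in> A"
  \<comment> \<open>An unnormalized Lagrange polynomial at \<open>z\<close>: its integral isolates
    the weight at \<open>z\<close>, and its degree is below \<open>m\<close>, so known moments
    suffice.\<close>
  define l where "l = (\<Prod>x\<in>A - {z}. [:- x, 1:])"
  have "degree l = m - 1" using degree_prod_roots(1)[of "A - {z}"] A z by (simp add: l_def)
  then have l: "degree l < m" using m by simp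
  have lz: "poly l x = 0 \<longleftrightarrow> x \<in> A - {z}" for x using A(1) by (auto simp: l_def poly_prod)
  have ex: "(\<Sum>x\<in>A. complex_of_real (w x) * poly l x) = complex_of_real (w z) * poly l z" for w
  proof -
    have "(\<Sum>x\<in>A - {z}. complex_of_real (w x) * poly l x) = 0"
      using lz by (intro sum.neutral) auto
    then show ?thesis by (subst sum.remove[OF A(1) z]) simp
  qed
  have ex2: "(\<Sum>x\<in>A. complex_of_real (w x) * poly l x) = (\<Sum>t<m. coeff l t * (\<Sum>x\<in>A. complex_of_real (w x) * x ^ t))" for w
    unfolding poly_eq_sum_lessThan[OF l] sum_distrib_left
    by (subst sum.swap) (simp add: mult_ac)
  have "complex_of_real (u z) * poly l z = complex_of_real (v z) * poly l z"
    unfolding ex[symmetric] ex2 using mo AB by simp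
  then show "u z = v z" using lz[of z] by simp
qed

section \<open>Recovering the parameters from the moments\<close>

text \<open>The moment recursion solved for the parameter: the numerator is the integral of
  \<open>z * Phi k\<close>, expressed by moments. The guard \<open>l < k\<close> only serves
  termination and is removed in \<open>verblunsky_eq\<close>. For arbitrary \<open>c\<close> the
  denominator may vanish, hence the assumptions on \<open>sqnorm\<close> in what follows.\<close>

fun verblunsky :: "(nat \<Rightarrow> complex) \<Rightarrow> nat \<Rightarrow> complex" where
  "verblunsky c k = cnj ((\<Sum>i\<le>k. coeff (Phi (\<lambda>l. if l < k then verblunsky c l else 0) k) i * c (Suc i))
     / complex_of_real (sqnorm (\<lambda>l. if l < k then verblunsky c l else 0) k))"

declare verblunsky.simps [simp del]

lemma verblunsky_eq:
  "verblunsky c k = cnj ((\<Sum>i\<le>k. coeff (Phi (verblunsky c) k) i * c (Suc i)) / complex_of_real (sqnorm (verblunsky c) k))"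
proof -
  have "Phi (\<lambda>l. if l < k then verblunsky c l else 0) k = Phi (verblunsky c) k"
    "sqnorm (\<lambda>l. if l < k then verblunsky c l else 0) k = sqnorm (verblunsky c) k"
    by (auto intro!: Phi_cong sqnorm_cong)
  then show ?thesis by (subst verblunsky.simps) simp
qed

lemma verblunsky_of_moments:
  assumes "\<And>k. k \<le> K \<Longrightarrow> c k = moment \<alpha> k" and "\<And>k. k < K \<Longrightarrow> sqnorm \<alpha> k \<noteq> 0"
  shows "k < K \<Longrightarrow> verblunsky c k = \<alpha> k"
proof (induction k rule: less_induct)
  case (less k)
  have e: "Phi (verblunsky c) k = Phi \<alpha> k" "sqnorm (verblunsky c) k = sqnorm \<alpha> k"
    using less by (auto intro!: Phi_cong sqnorm_cong)
  have "(\<Sum>i\<le>k. coeff (Phi \<alpha> k) i * c (Suc i)) = (\<Sum>i\<le>k. coeff (Phi \<alpha> k) i * moment \<alpha> (Suc i))"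
    using less.prems assms(1) by (intro sum.cong) auto
  also have "\<dots> = cnj (\<alpha> k) * complex_of_real (sqnorm \<alpha> k)"
    by (simp add: moment.simps(2)[of _ k] flip: lessThan_Suc_atMost)
  finally show ?case
    using assms(2)[OF less.prems] by (subst verblunsky_eq) (simp add: e)
qed

lemma moments_of_verblunsky:
  assumes c0: "c 0 = 1" and nz: "\<And>k. k < K \<Longrightarrow> sqnorm (verblunsky c) k \<noteq> 0"
  shows "k \<le> K \<Longrightarrow> moment (verblunsky c) k = c k"
proof (induction k rule: less_induct)
  case (less k)
  show ?case
  proof (cases k)
    case 0
    then show ?thesis by (simp add: c0 moment.simps(1))
  next
    case (Suc j)
    have "(\<Sum>i<j. coeff (Phi (verblunsky c) j) i * moment (verblunsky c) (Suc i)) = (\<Sum>i<j. coeff (Phi (verblunsky c) j) i * c (Suc i))"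
      using less Suc by (intro sum.cong) auto
    moreover have "cnj (verblunsky c j) * complex_of_real (sqnorm (verblunsky c) j)
       = (\<Sum>i\<le>j. coeff (Phi (verblunsky c) j) i * c (Suc i))"
      using nz[of j] less.prems Suc by (subst (1) verblunsky_eq) simp
    ultimately show ?thesis
      by (simp add: Suc moment.simps(2)[of _ j] flip: lessThan_Suc_atMost)
  qed
qed

lemma verblunsky_real:
  assumes "\<And>i. i \<le> Suc k \<Longrightarrow> c i \<in> \<real>"
  shows "verblunsky c k \<in> \<real>"
  using assms
proof (induction k rule: less_induct)
  case (less k)
  have r: "verblunsky c l \<in> \<real>" if "l < k" for l using that less by auto
  have "(\<forall>i. coeff (Phi (verblunsky c) j) i \<in> \<real>) \<and> (\<forall>i. coeff (PhiStar (verblunsky c) j) i \<in> \<real>)" if "j \<le> k" for j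
    using that
  proof (induction j)
    case (Suc j)
    then have "cnj (verblunsky c j) \<in> \<real>" "verblunsky c j \<in> \<real>" using r[of j] by (auto simp: complex_is_Real_iff)
    with Suc show ?case
      by (auto simp: Phi_Suc PhiStar_Suc coeff_pCons split: nat.splits intro!: Reals_diff Reals_mult)
  qed (auto simp: coeff_1)
  then show ?case using less.prems
    by (subst verblunsky_eq) (auto simp: Reals_cnj_iff intro!: sum_in_Reals)
qed

text \<open>Written as a polynomial in the parameters and their conjugates, it is accessible to the
  product rule.\<close>

lemma complex_of_sqnorm: "complex_of_real (sqnorm \<alpha> k) = (\<Prod>l<k. 1 - \<alpha> l * cnj (\<alpha> l))"
  unfolding sqnorm_def of_real_prod of_real_diff complex_norm_square by simp

lemma coeff_Phi_differentiable:
  fixes A :: "'a::real_normed_vector \<Rightarrow> nat \<Rightarrow> complex"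
  assumes "\<And>l. l < k \<Longrightarrow> (\<lambda>x. A x l) differentiable (at p)"
  shows "(\<forall>i. (\<lambda>x. coeff (Phi (A x) k) i) differentiable (at p)) \<and>
         (\<forall>i. (\<lambda>x. coeff (PhiStar (A x) k) i) differentiable (at p))"
  using assms
proof (induction k)
  case (Suc k)
  have "(\<lambda>x. coeff (pCons 0 (Phi (A x) k)) i) differentiable (at p)" for i
    using Suc by (cases i) auto
  moreover have "(\<lambda>x. A x k) differentiable (at p)" "(\<lambda>x. cnj (A x k)) differentiable (at p)"
    using Suc.prems by (auto simp: differentiable_cnj_iff)
  ultimately show ?case using Suc
    by (auto simp: Phi_Suc PhiStar_Suc simp del: smult_pCons intro!: differentiable_diff differentiable_mult)
qed auto

lemma differentiable_prod:
  fixes f :: "nat \<Rightarrow> 'a::real_normed_vector \<Rightarrow> complex"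
  shows "(\<And>l. l < k \<Longrightarrow> f l differentiable (at p)) \<Longrightarrow> (\<lambda>x. \<Prod>l<k. f l x) differentiable (at p)"
  by (induction k) (auto intro!: differentiable_mult)

lemma sqnorm_differentiable:
  fixes A :: "'a::real_normed_vector \<Rightarrow> nat \<Rightarrow> complex"
  assumes "\<And>l. l < k \<Longrightarrow> (\<lambda>x. A x l) differentiable (at p)"
  shows "(\<lambda>x. complex_of_real (sqnorm (A x) k)) differentiable (at p)"
  unfolding complex_of_sqnorm using assms
  by (intro differentiable_prod differentiable_diff differentiable_mult) (auto simp: differentiable_cnj_iff)

lemma moment_differentiable:
  fixes A :: "'a::real_normed_vector \<Rightarrow> nat \<Rightarrow> complex"
  assumes "\<And>l. l < k \<Longrightarrow> (\<lambda>x. A x l) differentiable (at p)"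
  shows "(\<lambda>x. moment (A x) k) differentiable (at p)"
  using assms
proof (induction k rule: less_induct)
  case (less k)
  show ?case
  proof (cases k)
    case 0
    then show ?thesis by (simp add: moment.simps(1))
  next
    case (Suc j)
    have "(\<lambda>x. moment (A x) (Suc i)) differentiable (at p)" if "i < j" for i
      using less Suc that by auto
    moreover have "(\<lambda>x. coeff (Phi (A x) j) i) differentiable (at p)" for i
      using coeff_Phi_differentiable[of j A p] less.prems Suc by auto
    moreover have "(\<lambda>x. complex_of_real (sqnorm (A x) j)) differentiable (at p)"
      using sqnorm_differentiable[of j A p] less.prems Suc by auto
    moreover have "(\<lambda>x. cnj (A x j)) differentiable (at p)"
      using less.prems Suc by (simp add: differentiable_cnj_iff)
    ultimately show ?thesis unfolding Suc moment.simps(2)[of _ j]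
      by (intro differentiable_diff differentiable_mult differentiable_sum) auto
  qed
qed

lemma verblunsky_differentiable:
  fixes C :: "'a::real_normed_vector \<Rightarrow> nat \<Rightarrow> complex"
  assumes C: "\<And>i. (\<lambda>x. C x i) differentiable (at p)"
  shows "(\<And>l. l \<le> k \<Longrightarrow> sqnorm (verblunsky (C p)) l \<noteq> 0) \<Longrightarrow> (\<lambda>x. verblunsky (C x) k) differentiable (at p)"
proof (induction k rule: less_induct)
  case (less k)
  have d: "(\<lambda>x. verblunsky (C x) l) differentiable (at p)" if "l < k" for l
    using less that by auto
  have "(\<lambda>x. (\<Sum>i\<le>k. coeff (Phi (verblunsky (C x)) k) i * C x (Suc i)) / complex_of_real (sqnorm (verblunsky (C x)) k))
      differentiable (at p)"
    using less.prems[of k] C coeff_Phi_differentiable[of k "\<lambda>x. verblunsky (C x)" p, OF d]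
      sqnorm_differentiable[of k "\<lambda>x. verblunsky (C x)" p, OF d]
    by (intro differentiable_divide differentiable_sum differentiable_mult) auto
  then show ?case by (subst verblunsky_eq) (simp only: differentiable_cnj_iff)
qed

lemma sqnorm_pos_of_less:
  assumes "\<And>l. l < k \<Longrightarrow> cmod (\<alpha> l) < 1"
  shows "sqnorm \<alpha> k > 0"
  unfolding sqnorm_def using assms by (intro prod_pos) (auto simp: abs_square_less_1)

text \<open>By induction, because the parameter with index \<open>k\<close> is known to be
  continuous only where the earlier ones have modulus below 1, so that its denominator is
  nonzero.\<close>

lemma open_verblunsky_less:
  fixes C :: "'a::real_normed_vector \<Rightarrow> nat \<Rightarrow> complex"
  assumes C: "\<And>i p. (\<lambda>x. C x i) differentiable (at p)"
  shows "open {x. \<forall>l<k. cmod (verblunsky (C x) l) < 1}"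
proof (induction k)
  case (Suc k)
  let ?W = "{x. \<forall>l<k. cmod (verblunsky (C x) l) < 1}"
  have "continuous_on ?W (\<lambda>x. verblunsky (C x) k)"
  proof (rule continuous_at_imp_continuous_on, rule ballI)
    fix p assume p: "p \<in> ?W"
    have "sqnorm (verblunsky (C p)) l \<noteq> 0" if "l \<le> k" for l
      using sqnorm_pos_of_less[of l "verblunsky (C p)"] p that by fastforce
    then show "isCont (\<lambda>x. verblunsky (C x) k) p"
      by (intro differentiable_imp_continuous_within verblunsky_differentiable C)
  qed
  then have "open ((\<lambda>x. verblunsky (C x) k) -` ball 0 1 \<inter> ?W)"
    using Suc by (subst (asm) continuous_on_open_vimage) auto
  moreover have "(\<lambda>x. verblunsky (C x) k) -` ball 0 1 \<inter> ?W = {x. \<forall>l<Suc k. cmod (verblunsky (C x) l) < 1}"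
    by (auto simp: less_Suc_eq)
  ultimately show ?case by simp
qed simp

section \<open>Derivatives of spectral sums\<close>

text \<open>The square of \<open>q_of\<close> as a polynomial in the coordinates: without the root
  in the last component it is differentiable everywhere. By \<open>sqweight_eq_q_of\<close> it
  agrees with the square as long as the last \<open>q\<close> is positive.\<close>

definition sqweight :: "nat \<Rightarrow> (nat \<Rightarrow> 'd) \<Rightarrow> real ^ 'd \<Rightarrow> nat \<Rightarrow> real" where
  "sqweight n e x j =
     (if j < n - 1 then (vec_nth x (e (n + j)))\<^sup>2 else 1 - (\<Sum>i<n - 1. (vec_nth x (e (n + i)))\<^sup>2))"

definition spectral_sum :: "nat \<Rightarrow> (nat \<Rightarrow> 'd) \<Rightarrow> (real \<Rightarrow> complex) \<Rightarrow> real ^ 'd \<Rightarrow> complex" where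
  "spectral_sum n e R x = (\<Sum>j<n. complex_of_real (sqweight n e x j) * R (vec_nth x (e j)))"

definition sqweight' :: "nat \<Rightarrow> (nat \<Rightarrow> 'd) \<Rightarrow> real ^ 'd \<Rightarrow> nat \<Rightarrow> real ^ 'd \<Rightarrow> real" where
  "sqweight' n e x j h =
     (if j < n - 1 then 2 * vec_nth x (e (n + j)) * vec_nth h (e (n + j))
      else - (\<Sum>i<n - 1. 2 * vec_nth x (e (n + i)) * vec_nth h (e (n + i))))"

definition spectral_sum' ::
  "nat \<Rightarrow> (nat \<Rightarrow> 'd) \<Rightarrow> (real \<Rightarrow> complex) \<Rightarrow> (real \<Rightarrow> complex) \<Rightarrow> real ^ 'd \<Rightarrow> real ^ 'd \<Rightarrow> complex" where
  "spectral_sum' n e R R' x h =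
     (\<Sum>j<n. complex_of_real (sqweight n e x j) * (complex_of_real (vec_nth h (e j)) * R' (vec_nth x (e j)))
         + complex_of_real (sqweight' n e x j h) * R (vec_nth x (e j)))"

lemma has_derivative_vec_nth: "((\<lambda>x. vec_nth x i) has_derivative (\<lambda>h. vec_nth h i)) (at x)"
  for x :: "real ^ 'd::finite"
  by (intro bounded_linear_imp_has_derivative bounded_linear_vec_nth)

lemma sqweight_has_derivative:
  fixes x :: "real ^ 'd::finite"
  shows "((\<lambda>x. sqweight n e x j) has_derivative sqweight' n e x j) (at x)"
proof (cases "j < n - 1")
  case True
  then show ?thesis unfolding sqweight_def sqweight'_def
    by (auto intro!: derivative_eq_intros has_derivative_vec_nth simp: algebra_simps)
next
  case False
  have "((\<lambda>x. 1 - (\<Sum>i<n - 1. (vec_nth x (e (n + i)))\<^sup>2)) has_derivative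
     (\<lambda>h. 0 - (\<Sum>i<n - 1. 2 * vec_nth x (e (n + i)) * vec_nth h (e (n + i))))) (at x)"
    by (intro has_derivative_diff has_derivative_const has_derivative_sum)
       (auto intro!: derivative_eq_intros has_derivative_vec_nth simp: algebra_simps)
  then show ?thesis unfolding sqweight_def sqweight'_def using False by simp
qed

lemma spectral_sum_has_derivative:
  fixes x :: "real ^ 'd::finite"
  assumes R: "\<And>t. (R has_vector_derivative R' t) (at t)"
  shows "(spectral_sum n e R has_derivative spectral_sum' n e R R' x) (at x)"
  unfolding spectral_sum_def spectral_sum'_def
proof (intro has_derivative_sum has_derivative_mult has_derivative_of_real sqweight_has_derivative)
  fix j
  have "(R has_derivative (\<lambda>t. t *\<^sub>R R' (vec_nth x (e j)))) (at (vec_nth x (e j)))"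
    using R by (simp add: has_vector_derivative_def)
  from has_derivative_compose[OF has_derivative_vec_nth this]
  show "((\<lambda>x. R (vec_nth x (e j))) has_derivative
      (\<lambda>h. complex_of_real (vec_nth h (e j)) * R' (vec_nth x (e j)))) (at x)"
    by (simp add: scaleR_conv_of_real)
qed

text \<open>Raising a free weight lowers the last one by the same amount, hence the difference of
  two values in the weight columns; the factor \<open>2 * q\<close> comes from using
  \<open>q\<close> rather than the weight as coordinate.\<close>

lemma spectral_sum'_axis:
  fixes x :: "real ^ 'd::finite"
  assumes e: "bij_betw e {..<2 * n - 1} (UNIV :: 'd set)" and s: "s < 2 * n - 1"
  shows "spectral_sum' n e R R' x (axis (e s) 1) =
    (if s < n then complex_of_real (sqweight n e x s) * R' (vec_nth x (e s))
     else complex_of_real (2 * vec_nth x (e s)) * (R (vec_nth x (e (s - n))) - R (vec_nth x (e (n - 1)))))"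
proof -
  have inj: "e i = e j \<longleftrightarrow> i = j" if "i < 2 * n - 1" "j < 2 * n - 1" for i j
    using e that by (auto simp: bij_betw_def inj_on_def)
  have ax: "vec_nth (axis (e s) 1 :: real ^ 'd) (e i) = (if i = s then 1 else 0)" if "i < 2 * n - 1" for i
    using inj[OF that s] by (auto simp: axis_def)
  have n: "n \<ge> 1" using s by simp
  have w': "sqweight' n e x j (axis (e s) 1) =
     (if s < n then 0 else if j < n - 1 then (if j = s - n then 2 * vec_nth x (e s) else 0) else - 2 * vec_nth x (e s))"
    if "j < n" for j
  proof (cases "j < n - 1")
    case True
    then show ?thesis using that s by (auto simp: sqweight'_def ax)
  next
    case False
    have "(\<Sum>i<n - 1. 2 * vec_nth x (e (n + i)) * vec_nth (axis (e s) 1) (e (n + i)))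
       = (\<Sum>i<n - 1. if n + i = s then 2 * vec_nth x (e s) else 0)"
      by (intro sum.cong) (auto simp: ax)
    also have "\<dots> = (\<Sum>i<n - 1. if i = s - n \<and> n \<le> s then 2 * vec_nth x (e s) else 0)"
      by (intro sum.cong) auto
    also have "\<dots> = (if n \<le> s then 2 * vec_nth x (e s) else 0)"
      using s by (cases "n \<le> s") auto
    finally show ?thesis using False by (simp add: sqweight'_def)
  qed
  show ?thesis
  proof (cases "s < n")
    case True
    have "spectral_sum' n e R R' x (axis (e s) 1) =
      (\<Sum>j<n. if j = s then complex_of_real (sqweight n e x s) * R' (vec_nth x (e s)) else 0)"
      unfolding spectral_sum'_def using True by (intro sum.cong) (auto simp: ax w')
    then show ?thesis using True by simp
  next
    case False
    have sn: "s - n < n - 1" using s False by linarith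
    have "spectral_sum' n e R R' x (axis (e s) 1) =
      (\<Sum>j<n. complex_of_real (sqweight' n e x j (axis (e s) 1)) * R (vec_nth x (e j)))"
      unfolding spectral_sum'_def using False by (intro sum.cong) (auto simp: ax)
    also have "\<dots> = (\<Sum>j<n. (if j = s - n then complex_of_real (2 * vec_nth x (e s)) * R (vec_nth x (e j)) else 0)
       + (if j = n - 1 then - complex_of_real (2 * vec_nth x (e s)) * R (vec_nth x (e j)) else 0))"
      using False sn by (intro sum.cong) (auto simp: w')
    also have "\<dots> = complex_of_real (2 * vec_nth x (e s)) * R (vec_nth x (e (s - n)))
       - complex_of_real (2 * vec_nth x (e s)) * R (vec_nth x (e (n - 1)))"
      using sn n by (simp add: sum.distrib)
    finally show ?thesis using False by (simp add: algebra_simps)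
  qed
qed

text \<open>The test functions are polynomials in \<open>y\<close> times a common factor
  \<open>u\<close>, which covers \<open>z ^ (1 - n)\<close> in the unitary case and
  \<open>u = 1\<close> in the orthogonal one. The last of them is identically 1 and borders the
  matrix to confluent size.\<close>

lemma det_spectral_sum:
  fixes x :: "real ^ 'd::finite" and u y u' y' :: "real \<Rightarrow> complex"
  assumes n: "n \<ge> 1" and e: "bij_betw e {..<2 * n - 1} (UNIV :: 'd set)"
    and f: "\<And>r. r < 2 * n \<Longrightarrow> degree (f r) < 2 * n"
    and u: "\<And>t. (u has_vector_derivative u' t) (at t)" and y: "\<And>t. (y has_vector_derivative y' t) (at t)"
    and last: "\<And>t. u t * poly (f (2 * n - 1)) (y t) = 1"
  defines "R \<equiv> \<lambda>r t. u t * poly (f r) (y t)"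
    and "R' \<equiv> \<lambda>r t. u t * (y' t * poly (pderiv (f r)) (y t)) + u' t * poly (f r) (y t)"
    and "\<theta> \<equiv> \<lambda>j. vec_nth x (e j)"
  shows "\<And>r t. (R r has_vector_derivative R' r t) (at t)"
    and "cmod (Determinant.det (Matrix.mat (2 * n - 1) (2 * n - 1)
            (\<lambda>(r, s). spectral_sum' n e (R r) (R' r) x (axis (e s) 1))))
      = cmod (Determinant.det (Matrix.mat (2 * n) (2 * n) (\<lambda>(r, t). coeff (f r) t)))
        * (gaps n (\<lambda>j. y (\<theta> j)))\<^sup>2
        * ((\<Prod>j<n. \<bar>sqweight n e x j\<bar> * (cmod (u (\<theta> j)) * cmod (y' (\<theta> j))))
           * (\<Prod>j<n - 1. 2 * \<bar>vec_nth x (e (n + j))\<bar> * cmod (u (\<theta> j))) * cmod (u (\<theta> (n - 1))))"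
proof -
  have py: "((\<lambda>t. poly p (y t)) has_vector_derivative y' t * poly (pderiv p) (y t)) (at t)" for p t
    using field_vector_diff_chain_at[OF y poly_DERIV[of p "y t"]] by (simp add: o_def)
  show der: "(R r has_vector_derivative R' r t) (at t)" for r t
    unfolding R_def R'_def
    using has_vector_derivative_mult[OF u py] by (simp add: mult_ac)
  define a where "a j = complex_of_real (sqweight n e x j) * (u (\<theta> j) * y' (\<theta> j))" for j
  define a' where "a' j = complex_of_real (sqweight n e x j) * u' (\<theta> j)" for j
  define b where "b j = complex_of_real (2 * vec_nth x (e (n + j)))" for j
  define v where "v j = u (\<theta> j)" for j
  define z where "z j = y (\<theta> j)" for j
  \<comment> \<open>For \<open>s < 2 * n - 1\<close> these are the Jacobian columns. The column
    \<open>2 * n - 1\<close>, values at the last node, is added so that \<open>g\<close> takes the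
    form treated in \<open>det_confluent_system\<close>.\<close>
  define g where "g r s = (if s < n then a s * poly (pderiv (f r)) (z s) + a' s * poly (f r) (z s)
     else if s < 2 * n - 1 then b (s - n) * (v (s - n) * poly (f r) (z (s - n)) - v (n - 1) * poly (f r) (z (n - 1)))
     else v (n - 1) * poly (f r) (z (n - 1)))" for r s
  have "Matrix.mat (2 * n - 1) (2 * n - 1) (\<lambda>(r, s). spectral_sum' n e (R r) (R' r) x (axis (e s) 1))
     = Matrix.mat (2 * n - 1) (2 * n - 1) (\<lambda>(r, s). g r s)"
    by (rule eq_matI)
       (auto simp: spectral_sum'_axis[OF e] g_def a_def a'_def b_def v_def z_def R_def R'_def \<theta>_def algebra_simps)
  moreover have "Determinant.det (Matrix.mat (Suc (2 * n - 1)) (Suc (2 * n - 1)) (\<lambda>(r, s). g r s))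
     = Determinant.det (Matrix.mat (2 * n - 1) (2 * n - 1) (\<lambda>(r, s). g r s)) * g (2 * n - 1) (2 * n - 1)"
  proof (rule det_bordered)
    fix s assume s: "s < 2 * n - 1"
    have R1: "R (2 * n - 1) t = 1" for t using last by (simp add: R_def)
    \<comment> \<open>\<open>R'\<close> is a derivative of the constant 1. This makes the angle
      entries of the bordering row vanish, while its weight entries are
      \<open>1 - 1\<close>.\<close>
    have "R' (2 * n - 1) t = 0" for t
    proof -
      have "R (2 * n - 1) = (\<lambda>_. 1)" using R1 by auto
      with der[of "2 * n - 1" t] have "((\<lambda>_. 1) has_vector_derivative R' (2 * n - 1) t) (at t)" by simp
      then show ?thesis using vector_derivative_unique_at has_vector_derivative_const by blast
    qed
    then have 1: "u t * (y' t * poly (pderiv (f (2 * n - 1))) (y t)) + u' t * poly (f (2 * n - 1)) (y t) = 0" for t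
      by (simp add: R'_def)
    show "g (2 * n - 1) s = 0"
    proof (cases "s < n")
      case True
      have "g (2 * n - 1) s = complex_of_real (sqweight n e x s) *
         (u (\<theta> s) * (y' (\<theta> s) * poly (pderiv (f (2 * n - 1))) (y (\<theta> s))) + u' (\<theta> s) * poly (f (2 * n - 1)) (y (\<theta> s)))"
        using True by (simp add: g_def a_def a'_def z_def algebra_simps)
      then show ?thesis by (simp only: 1 mult_zero_right)
    next
      case False
      then show ?thesis using s last by (simp add: g_def v_def z_def)
    qed
  qed
  moreover have "Suc (2 * n - 1) = 2 * n" using n by simp
  moreover have "g (2 * n - 1) (2 * n - 1) = 1"
  proof -
    have "\<not> 2 * n - 1 < n" using n by linarith
    then show ?thesis using last by (simp add: g_def v_def z_def)
  qed
  ultimately have "Determinant.det (Matrix.mat (2 * n - 1) (2 * n - 1)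
            (\<lambda>(r, s). spectral_sum' n e (R r) (R' r) x (axis (e s) 1)))
     = Determinant.det (Matrix.mat (2 * n) (2 * n) (\<lambda>(r, s). g r s))" by simp
  also have "cmod \<dots> = cmod (Determinant.det (Matrix.mat (2 * n) (2 * n) (\<lambda>(r, t). coeff (f r) t))) * (gaps n z)\<^sup>2
      * ((\<Prod>j<n. cmod (a j)) * (\<Prod>j<n - 1. cmod (b j) * cmod (v j)) * cmod (v (n - 1)))"
    unfolding g_def by (rule det_confluent_system[OF n f])
  finally show "cmod (Determinant.det (Matrix.mat (2 * n - 1) (2 * n - 1)
            (\<lambda>(r, s). spectral_sum' n e (R r) (R' r) x (axis (e s) 1))))
      = cmod (Determinant.det (Matrix.mat (2 * n) (2 * n) (\<lambda>(r, t). coeff (f r) t)))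
        * (gaps n (\<lambda>j. y (\<theta> j)))\<^sup>2
        * ((\<Prod>j<n. \<bar>sqweight n e x j\<bar> * (cmod (u (\<theta> j)) * cmod (y' (\<theta> j))))
           * (\<Prod>j<n - 1. 2 * \<bar>vec_nth x (e (n + j))\<bar> * cmod (u (\<theta> j))) * cmod (u (\<theta> (n - 1))))"
    by (simp add: a_def b_def v_def z_def[abs_def] norm_mult)
qed

text \<open>Lets entries of a total derivative, known to exist on abstract grounds, be computed
  along lines in one real variable.\<close>

lemma derivative_along:
  fixes T :: "'a::real_normed_vector \<Rightarrow> 'b::real_normed_vector"
  assumes T: "(T has_derivative T') (at p)"
    and l: "((\<lambda>t. T (p + t *\<^sub>R v)) has_vector_derivative c) (at (0 :: real))"
  shows "T' v = c"
proof -
  have "((\<lambda>t. p + t *\<^sub>R v) has_derivative (\<lambda>t. t *\<^sub>R v)) (at (0 :: real))"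
    by (auto intro!: derivative_eq_intros)
  moreover have "(T has_derivative T') (at (p + (0 :: real) *\<^sub>R v))" using T by simp
  ultimately have "((\<lambda>t. T (p + t *\<^sub>R v)) has_derivative (\<lambda>t. T' (t *\<^sub>R v))) (at (0 :: real))"
    by (rule has_derivative_compose)
  then have "(\<lambda>t. T' (t *\<^sub>R v)) = (\<lambda>t. t *\<^sub>R c)"
    using l unfolding has_vector_derivative_def by (rule has_derivative_unique)
  from fun_cong[OF this, of 1] show ?thesis by simp
qed

text \<open>The chain rule for \<open>M = T o F\<close>: the matrix of \<open>M'\<close> is the
  matrix of \<open>T'\<close>, lower triangular by \<open>tri\<close>, times the real Jacobian of
  \<open>F\<close>. Only the diagonal of \<open>T'\<close> is therefore needed.\<close>

lemma det_triangular_chain: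
  fixes F :: "real ^ 'd::finite \<Rightarrow> real ^ 'd" and T M :: "nat \<Rightarrow> real ^ 'd \<Rightarrow> complex"
  assumes e: "bij_betw e {..<N} (UNIV :: 'd set)"
    and U: "open U" "x \<in> U"
    and F: "(F has_derivative F') (at x)"
    and T: "\<And>r. r < N \<Longrightarrow> (T r has_derivative T' r) (at (F x))"
    and M: "\<And>r. r < N \<Longrightarrow> (M r has_derivative M' r) (at x)"
    and eq: "\<And>r z. r < N \<Longrightarrow> z \<in> U \<Longrightarrow> M r z = T r (F z)"
    and tri: "\<And>r s. r < s \<Longrightarrow> s < N \<Longrightarrow> T' r (axis (e s) 1) = 0"
  shows "\<bar>Determinants.det (matrix F')\<bar> * (\<Prod>r<N. cmod (T' r (axis (e r) 1)))
     = cmod (Determinant.det (Matrix.mat N N (\<lambda>(r, s). M' r (axis (e s) 1))))"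
proof -
  have M'eq: "M' r = (\<lambda>h. T' r (F' h))" if r: "r < N" for r
  proof -
    have "((\<lambda>z. T r (F z)) has_derivative (\<lambda>h. T' r (F' h))) (at x)"
      by (rule has_derivative_compose[OF F T[OF r]])
    then have "(M r has_derivative (\<lambda>h. T' r (F' h))) (at x)"
      by (rule has_derivative_transform_within_open[OF _ U]) (simp add: eq[OF r])
    then show ?thesis using M[OF r] has_derivative_unique by blast
  qed
  have expand: "T' r h = (\<Sum>t<N. T' r (axis (e t) 1) * complex_of_real (vec_nth h (e t)))" if r: "r < N" for r h
  proof -
    have lin: "linear (T' r)" using T[OF r] has_derivative_linear by blast
    have "h = (\<Sum>i\<in>UNIV. vec_nth h i *\<^sub>R axis i 1)"
      using basis_expansion[of h] by (simp add: scalar_mult_eq_scaleR)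
    also have "\<dots> = (\<Sum>t<N. vec_nth h (e t) *\<^sub>R axis (e t) 1)"
      by (rule sum.reindex_bij_betw[OF e, symmetric])
    finally have "T' r h = T' r (\<Sum>t<N. vec_nth h (e t) *\<^sub>R axis (e t) 1)" by simp
    also have "\<dots> = (\<Sum>t<N. vec_nth h (e t) *\<^sub>R T' r (axis (e t) 1))"
      by (simp add: linear_sum[OF lin] linear_scale[OF lin])
    finally show ?thesis by (simp add: scaleR_conv_of_real mult.commute)
  qed
  let ?L = "Matrix.mat N N (\<lambda>(r, t). T' r (axis (e t) 1))"
  let ?J = "Matrix.mat N N (\<lambda>(t, s). vec_nth (vec_nth (matrix F') (e t)) (e s))"
  have "M' r (axis (e s) 1) = (\<Sum>t<N. T' r (axis (e t) 1) * complex_of_real (vec_nth (F' (axis (e s) 1)) (e t)))"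
    if "r < N" for r s
    unfolding M'eq[OF that] by (rule expand[OF that])
  then have "Matrix.mat N N (\<lambda>(r, s). M' r (axis (e s) 1)) = ?L * map_mat complex_of_real ?J"
    by (intro eq_matI) (simp_all add: scalar_prod_def matrix_def flip: lessThan_atLeast0)
  then have "Determinant.det (Matrix.mat N N (\<lambda>(r, s). M' r (axis (e s) 1)))
     = Determinant.det ?L * Determinant.det (map_mat complex_of_real ?J)"
    by (simp add: det_mult[of _ N])
  also have "Determinant.det (map_mat complex_of_real ?J) = complex_of_real (Determinant.det ?J)"
    by (rule of_real_hom.hom_det)
  also have "Determinant.det ?J = Determinants.det (matrix F')"
    by (rule det_reindex[OF e, symmetric])
  also have "Determinant.det ?L = (\<Prod>r<N. T' r (axis (e r) 1))"
    by (rule det_mat_lower_triangular) (rule tri)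
  finally show ?thesis by (simp add: norm_mult mult.commute flip: prod_norm)
qed

section \<open>Local inversion\<close>

lemma differentiable_vec_nth_iff:
  fixes F :: "'a::real_normed_vector \<Rightarrow> real ^ 'd::finite"
  shows "F differentiable (at p) \<longleftrightarrow> (\<forall>i. (\<lambda>x. vec_nth (F x) i) differentiable (at p))"
  by (subst differentiable_componentwise_within) (auto simp: Basis_vec_def inner_axis)

lemma Re_differentiable: "f differentiable (at p) \<Longrightarrow> (\<lambda>x. Re (f x)) differentiable (at p)"
  and Im_differentiable: "f differentiable (at p) \<Longrightarrow> (\<lambda>x. Im (f x)) differentiable (at p)"
  unfolding differentiable_def
  using bounded_linear.has_derivative[OF bounded_linear_Re] bounded_linear.has_derivative[OF bounded_linear_Im]
  by blast+

lemma vec_nth_differentiable: "(\<lambda>x. vec_nth x i) differentiable (at p)" for p :: "real ^ 'd::finite"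
  using has_derivative_vec_nth unfolding differentiable_def by blast

lemma of_real_differentiable:
  "f differentiable (at p) \<Longrightarrow> (\<lambda>x. complex_of_real (f x)) differentiable (at p)"
  unfolding differentiable_def using has_derivative_of_real by blast

lemma cis_has_vector_derivative: "(cis has_vector_derivative \<i> * cis t) (at t)"
  unfolding has_vector_derivative_def using has_derivative_cis[of "\<lambda>x. x" "\<lambda>x. x" t UNIV]
  by (simp add: has_derivative_ident)

lemma cis_mult_has_vector_derivative:
  "((\<lambda>t. cis (c * t)) has_vector_derivative (\<i> * of_real c * cis (c * t))) (at t)"
proof -
  have "((\<lambda>t. c * t) has_derivative (\<lambda>h. c * h)) (at t)" by (auto intro!: derivative_eq_intros)
  from has_derivative_cis[OF this] show ?thesis
    by (simp add: has_vector_derivative_def scaleR_conv_of_real mult_ac)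
qed

lemma cis_eq_imp_eq:
  assumes "cis a = cis b" "\<bar>a - b\<bar> < 2 * pi"
  shows "a = b"
proof -
  have "cis (a - b) = 1" using assms(1) by (simp flip: cis_divide)
  then have "cos (a - b) = 1" by (metis cis.sel(1) one_complex.sel(1))
  then obtain k :: int where k: "a - b = real_of_int k * 2 * pi" unfolding cos_one_2pi_int by blast
  then have "\<bar>real_of_int k\<bar> * (2 * pi) < 1 * (2 * pi)" using assms(2) by (simp add: abs_mult)
  then have "\<bar>real_of_int k\<bar> < 1" by (subst (asm) mult_less_cancel_right_pos) simp_all
  then have "k = 0" by linarith
  with k show ?thesis by simp
qed

text \<open>The inverse is continuous by invariance of domain, so that \<open>F\<close> need not be continuously
  differentiable.\<close>

lemma has_jacobian_atI:
  fixes F :: "real ^ 'd::finite \<Rightarrow> real ^ 'd" and T M :: "nat \<Rightarrow> real ^ 'd \<Rightarrow> complex"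
  assumes e: "bij_betw e {..<N} (UNIV :: 'd set)"
    and R: "R a x" and U: "open U" "x \<in> U" and D: "open D" "a \<in> D"
    and F: "\<And>z. z \<in> U \<Longrightarrow> F differentiable (at z)"
    and fwd: "\<And>z b. z \<in> U \<Longrightarrow> b \<in> D \<Longrightarrow> R b z \<Longrightarrow> b = F z"
    and bwd: "\<And>z. z \<in> U \<Longrightarrow> F z \<in> D \<Longrightarrow> R (F z) z"
    and inj: "\<And>z z' b. z \<in> U \<Longrightarrow> z' \<in> U \<Longrightarrow> R b z \<Longrightarrow> R b z' \<Longrightarrow> z = z'"
    and T: "\<And>r. r < N \<Longrightarrow> (T r has_derivative T' r) (at a)"
    and M: "\<And>r. r < N \<Longrightarrow> (M r has_derivative M' r) (at x)"
    and eq: "\<And>r z b. r < N \<Longrightarrow> R b z \<Longrightarrow> M r z = T r b"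
    and tri: "\<And>r s. r < s \<Longrightarrow> s < N \<Longrightarrow> T' r (axis (e s) 1) = 0"
    and nz: "(\<Prod>r<N. cmod (T' r (axis (e r) 1))) \<noteq> 0"
    and c: "c = cmod (Determinant.det (Matrix.mat N N (\<lambda>(r, s). M' r (axis (e s) 1))))
              / (\<Prod>r<N. cmod (T' r (axis (e r) 1)))"
  shows "has_jacobian_at R a x c"
proof -
  have cont: "continuous_on U F"
    by (intro continuous_at_imp_continuous_on ballI differentiable_imp_continuous_within F)
  define W where "W = F -` D \<inter> U"
  have W: "open W" using cont U(1) D(1) by (simp add: W_def continuous_on_open_vimage)
  have Fx: "F x = a" using fwd[OF U(2) D(2) R] by simp
  then have xW: "x \<in> W" using U D by (simp add: W_def)
  have WU: "W \<subseteq> U" by (auto simp: W_def)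
  have contW: "continuous_on W F" using cont WU continuous_on_subset by blast
  have iff: "R b z \<longleftrightarrow> b = F z" if "z \<in> W" "b \<in> F ` W" for z b
    using that fwd[of z b] bwd[of z] by (auto simp: W_def)
  have injW: "inj_on F W"
  proof (rule inj_onI)
    fix z z' assume z: "z \<in> W" "z' \<in> W" "F z = F z'"
    then have "R (F z) z" "R (F z) z'" using iff by auto
    then show "z = z'" using inj z WU by blast
  qed
  obtain G where G: "homeomorphism W (F ` W) F G"
    using invariance_of_domain_homeomorphism[OF W contW _ injW] by auto
  have V: "open (F ` W)" by (rule invariance_of_domain[OF contW W injW])
  obtain F' where F': "(F has_derivative F') (at x)" using F[OF U(2)] by (auto simp: differentiable_def)
  have "\<bar>Determinants.det (matrix F')\<bar> * (\<Prod>r<N. cmod (T' r (axis (e r) 1)))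
     = cmod (Determinant.det (Matrix.mat N N (\<lambda>(r, s). M' r (axis (e s) 1))))"
  proof (rule det_triangular_chain[OF e W xW F' _ M])
    show "(T r has_derivative T' r) (at (F x))" if "r < N" for r using T[OF that] Fx by simp
    show "M r z = T r (F z)" if "r < N" "z \<in> W" for r z
      using eq[OF that(1)] iff[of z "F z"] that by blast
  qed (use tri in auto)
  from arg_cong[OF this, of "\<lambda>y. y / (\<Prod>r<N. cmod (T' r (axis (e r) 1)))"]
  have "\<bar>Determinants.det (matrix F')\<bar> = c"
    unfolding c nonzero_mult_div_cancel_right[OF nz] .
  moreover have "F' = frechet_derivative F (at x)" by (rule frechet_derivative_at[OF F'])
  moreover have "F differentiable_on W"
    unfolding differentiable_on_def using F WU by (meson differentiable_at_withinI subsetD)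
  ultimately show ?thesis
    unfolding has_jacobian_at_def
    using W xW V G iff Fx by (intro exI[of _ W] exI[of _ "F ` W"] exI[of _ F] exI[of _ G]) auto
qed

context hessenberg_params
begin

lemma bij_betw_roots:
  assumes "f ` {..<m} = roots"
  shows "bij_betw f {..<m} roots"
  using assms card_roots by (auto simp: bij_betw_def intro!: eq_card_imp_inj_on)

lemma indexed_moments:
  assumes z: "bij_betw z {..<m} roots" and w: "\<And>j. j < m \<Longrightarrow> w j = wt (z j)"
  shows "k \<le> m \<Longrightarrow> (\<Sum>j<m. complex_of_real (w j) * z j ^ k) = moment \<alpha> k"
    and "(\<Prod>j<m. - z j) = - cnj (\<alpha> (m - 1))"
    and "gaps m z * (\<Prod>j<m. w j) = (\<Prod>k<m. sqnorm \<alpha> k)"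
proof -
  have "(\<Sum>j<m. complex_of_real (w j) * z j ^ k) = (\<Sum>j<m. complex_of_real (wt (z j)) * z j ^ k)"
    using w by simp
  also have "\<dots> = (\<Sum>x\<in>roots. complex_of_real (wt x) * x ^ k)"
    by (rule sum.reindex_bij_betw[OF z])
  finally show "k \<le> m \<Longrightarrow> (\<Sum>j<m. complex_of_real (w j) * z j ^ k) = moment \<alpha> k"
    using moments by simp
  have "(\<Prod>j<m. - z j) = (\<Prod>x\<in>roots. - x)" by (rule prod.reindex_bij_betw[OF z])
  then show "(\<Prod>j<m. - z j) = - cnj (\<alpha> (m - 1))" by (simp add: prod_neg_roots)
  show "gaps m z * (\<Prod>j<m. w j) = (\<Prod>k<m. sqnorm \<alpha> k)"
    using gaps_prod_wt[OF z] w by simp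
qed

text \<open>The moments fix the measure only jointly with the product of the nodes, which carries
  the last parameter. \<open>v\<close> turns weights indexed by \<open>j\<close> into a function of
  the node.\<close>

lemma roots_from_moments:
  assumes z: "inj_on z {..<m}" "\<And>j. j < m \<Longrightarrow> cmod (z j) = 1"
    and mo: "\<And>k. k < m \<Longrightarrow> (\<Sum>j<m. complex_of_real (w j) * z j ^ k) = moment \<alpha> k"
    and pr: "(\<Prod>j<m. - z j) = - cnj (\<alpha> (m - 1))"
  shows "z ` {..<m} = roots" and "\<And>j. j < m \<Longrightarrow> w j = wt (z j)"
proof -
  define v where "v x = w (the_inv_into {..<m} z x)" for x
  have v: "v (z j) = w j" if "j < m" for j
    using that z(1) by (simp add: v_def the_inv_into_f_f)
  have mo': "(\<Sum>x\<in>roots. complex_of_real (wt x) * x ^ k) = (\<Sum>x\<in>z ` {..<m}. complex_of_real (v x) * x ^ k)"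
    if "k < m" for k
    using that mo[OF that] moments[of k] by (simp add: sum.reindex[OF z(1)] v)
  have pr': "(\<Prod>x\<in>roots. - x) = (\<Prod>x\<in>z ` {..<m}. - x)"
    using pr by (simp add: prod.reindex[OF z(1)] prod_neg_roots)
  have c: "card (z ` {..<m}) = m" using z(1) by (simp add: card_image)
  have uni: "\<And>x. x \<in> z ` {..<m} \<Longrightarrow> cmod x = 1" using z(2) by auto
  have fin: "finite (z ` {..<m})" by simp
  note * = moments_determine_measure[OF finite_roots card_roots roots_unimodular wt_pos fin c uni m_pos mo' pr']
  show "z ` {..<m} = roots" using *(1) by simp
  show "w j = wt (z j)" if "j < m" for j using *(1) *(2)[of "z j"] v[OF that] that by auto
qed

lemma sum_wt: "(\<Sum>z\<in>roots. wt z) = 1"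
proof -
  have "complex_of_real (\<Sum>z\<in>roots. wt z) = 1" using moments[of 0] by (simp add: moment.simps(1))
  then show ?thesis by (simp only: of_real_eq_1_iff)
qed

end

lemma ex_spectral_coordinates:
  fixes e :: "nat \<Rightarrow> 'd::finite"
  assumes e: "bij_betw e {..<2 * n - 1} (UNIV :: 'd set)" and n: "n \<ge> 1"
    and q: "\<And>j. j < n \<Longrightarrow> q j > 0" "(\<Sum>j<n. (q j)\<^sup>2) = 1"
  shows "\<exists>x. (\<forall>j<n. angle_of e x j = \<theta> j) \<and> (\<forall>j<n. q_of n e x j = q j)"
proof -
  define idx where "idx = inv_into {..<2 * n - 1} e"
  have idx: "idx (e i) = i" if "i < 2 * n - 1" for i
    using e that by (simp add: idx_def bij_betw_inv_into_left)
  define x :: "real ^ 'd" where "x = (\<chi> d. if idx d < n then \<theta> (idx d) else q (idx d - n))"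
  have 1: "angle_of e x j = \<theta> j" if "j < n" for j using that idx[of j] by (simp add: angle_of_def x_def)
  have xq: "vec_nth x (e (n + j)) = q j" if "j < n - 1" for j using that idx[of "n + j"] by (simp add: x_def)
  have "q_of n e x j = q j" if "j < n" for j
  proof (cases "j < n - 1")
    case True
    then show ?thesis by (simp add: q_of_def xq)
  next
    case False
    with that have j: "j = n - 1" by simp
    have "{..<n} = insert (n - 1) {..<n - 1}" using n by auto
    then have "(\<Sum>i<n. (q i)\<^sup>2) = (q (n - 1))\<^sup>2 + (\<Sum>i<n - 1. (q i)\<^sup>2)" by simp
    then have "1 - (\<Sum>i<n - 1. (q i)\<^sup>2) = (q (n - 1))\<^sup>2" using q(2) by simp
    then show ?thesis using q(1)[of "n - 1"] n j by (simp add: q_of_def xq)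
  qed
  with 1 show ?thesis by blast
qed

lemma sqweight_eq_q_of:
  assumes "n \<ge> 1" "j < n" "q_of n e x (n - 1) > 0"
  shows "sqweight n e x j = (q_of n e x j)\<^sup>2"
  using assms by (auto simp: sqweight_def q_of_def real_sqrt_gt_0_iff)

lemma sum_sqweight: "n \<ge> 1 \<Longrightarrow> (\<Sum>j<n. sqweight n e x j) = 1"
proof -
  assume "n \<ge> 1"
  then have "{..<n} = insert (n - 1) {..<n - 1}" by auto
  then show ?thesis by (simp add: sqweight_def)
qed

text \<open>Equal eigenvalue sets must be matched index by index. Ordering inside a window of length
  \<open>2 * pi\<close> still permits a cyclic relabelling, so disjoint discs around the base nodes
  identify the index; closeness to \<open>t j\<close> then excludes a shift by
  \<open>2 * pi\<close>. The weights are functions of the node.\<close>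

lemma spectral_data_inj:
  fixes x x' :: "real ^ 'd::finite"
  assumes e: "bij_betw e {..<2 * n - 1} (UNIV :: 'd set)" and n: "n \<ge> 1"
    and sep: "\<And>i j. i < n \<Longrightarrow> j < n \<Longrightarrow> i \<noteq> j \<Longrightarrow> 2 * \<delta> \<le> dist (z i) (z j)"
    and near: "\<And>j. j < n \<Longrightarrow> dist (cis (vec_nth x (e j))) (z j) < \<delta>" "\<And>j. j < n \<Longrightarrow> dist (cis (vec_nth x' (e j))) (z j) < \<delta>"
    and close: "\<And>j. j < n \<Longrightarrow> \<bar>vec_nth x (e j) - t j\<bar> < 1" "\<And>j. j < n \<Longrightarrow> \<bar>vec_nth x' (e j) - t j\<bar> < 1"
    and nodes: "\<And>j. j < n \<Longrightarrow> cis (vec_nth x (e j)) \<in> (\<lambda>i. cis (vec_nth x' (e i))) ` {..<n}"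
    and w: "\<And>j. j < n \<Longrightarrow> q_of n e x j = w (cis (vec_nth x (e j)))" "\<And>j. j < n \<Longrightarrow> q_of n e x' j = w (cis (vec_nth x' (e j)))"
  shows "x = x'"
proof -
  have th: "vec_nth x (e j) = vec_nth x' (e j)" if j: "j < n" for j
  proof -
    obtain i where i: "i < n" "cis (vec_nth x (e j)) = cis (vec_nth x' (e i))" using nodes[OF j] by auto
    have "i = j"
    proof (rule ccontr)
      assume "i \<noteq> j"
      then have "2 * \<delta> \<le> dist (z i) (z j)" using sep i j by blast
      also have "\<dots> \<le> dist (cis (vec_nth x' (e i))) (z i) + dist (cis (vec_nth x' (e i))) (z j)"
        by (rule dist_triangle3)
      also have "\<dots> < 2 * \<delta>" using near(1)[OF j] near(2)[OF i(1)] i(2) by simp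
      finally show False by simp
    qed
    with i close(1)[OF j] close(2)[OF j] show ?thesis using pi_gt3 by (intro cis_eq_imp_eq) auto
  qed
  have "vec_nth x (e i) = vec_nth x' (e i)" if i: "i < 2 * n - 1" for i
  proof (cases "i < n")
    case False
    with i have "i - n < n - 1" by linarith
    then have "vec_nth x (e i) = q_of n e x (i - n)" "vec_nth x' (e i) = q_of n e x' (i - n)"
      using False by (simp_all add: q_of_def)
    then show ?thesis using w(1)[of "i - n"] w(2)[of "i - n"] th[of "i - n"] \<open>i - n < n - 1\<close> by simp
  qed (rule th)
  moreover have "\<exists>i<2 * n - 1. d = e i" for d using e by (metis UNIV_I bij_betw_def imageE lessThan_iff)
  ultimately show ?thesis unfolding Finite_Cartesian_Product.vec_eq_iff by metis
qed

lemma ex_separation: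
  assumes "inj_on z {..<n::nat}"
  shows "\<exists>\<delta>>0. \<forall>i<n. \<forall>j<n. i \<noteq> j \<longrightarrow> 2 * \<delta> \<le> dist (z i) (z j :: complex)"
proof -
  define S where "S = insert 1 ((\<lambda>(i, j). dist (z i) (z j) / 2) ` {(i, j). i < n \<and> j < n \<and> i \<noteq> j})"
  have "finite {(i, j). i < n \<and> j < n \<and> i \<noteq> j}"
    by (rule finite_subset[of _ "{..<n} \<times> {..<n}"]) auto
  then have fin: "finite S" by (simp add: S_def)
  have "Min S \<in> S" by (rule Min_in[OF fin]) (simp add: S_def)
  moreover have "\<forall>s\<in>S. s > 0" using assms by (auto simp: S_def inj_on_def)
  ultimately have "Min S > 0" by blast
  moreover have "2 * Min S \<le> dist (z i) (z j)" if "i < n" "j < n" "i \<noteq> j" for i j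
  proof -
    have "Min S \<le> dist (z i) (z j) / 2" using that by (intro Min_le[OF fin]) (auto simp: S_def)
    then show ?thesis by simp
  qed
  ultimately show ?thesis by blast
qed

section \<open>The unitary case\<close>

lemma prod_cis: "(\<Prod>j<n. cis (f j)) = cis (\<Sum>j<n. f j)"
  for n :: nat by (induction n) (simp_all add: cis_mult)

lemma open_Collect_all_less: "(\<And>j. j < n \<Longrightarrow> open {x. Q j x}) \<Longrightarrow> open {x. \<forall>j<n. Q j x}"
  for n :: nat
proof -
  assume "\<And>j. j < n \<Longrightarrow> open {x. Q j x}"
  then have "open (\<Inter>j\<in>{..<n}. {x. Q j x})" by (intro open_INT) auto
  moreover have "(\<Inter>j\<in>{..<n}. {x. Q j x}) = {x. \<forall>j<n. Q j x}" by auto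
  ultimately show ?thesis by simp
qed

text \<open>The affine dependence as an exact difference formula: everything except the term with
  the parameter of index \<open>k\<close> is unchanged.\<close>

lemma moment_change:
  assumes "\<And>l. l < k \<Longrightarrow> \<alpha> l = \<beta> l"
  shows "moment \<alpha> (Suc k) = moment \<beta> (Suc k) + (cnj (\<alpha> k) - cnj (\<beta> k)) * complex_of_real (sqnorm \<beta> k)"
proof -
  have "(\<Sum>i<k. coeff (Phi \<alpha> k) i * moment \<alpha> (Suc i)) = (\<Sum>i<k. coeff (Phi \<beta> k) i * moment \<beta> (Suc i))"
  proof (rule sum.cong)
    fix i assume "i \<in> {..<k}"
    then have "moment \<alpha> (Suc i) = moment \<beta> (Suc i)" using assms by (intro moment_cong) auto
    then show "coeff (Phi \<alpha> k) i * moment \<alpha> (Suc i) = coeff (Phi \<beta> k) i * moment \<beta> (Suc i)"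
      using Phi_cong[of k \<alpha> \<beta>] assms by simp
  qed simp
  moreover have "sqnorm \<alpha> k = sqnorm \<beta> k" using assms by (intro sqnorm_cong)
  ultimately show ?thesis by (simp add: moment.simps(2)[of _ k] algebra_simps)
qed

lemma spectral_sum_Re: "spectral_sum n e (\<lambda>t. complex_of_real (Re (f t))) x = complex_of_real (Re (spectral_sum n e f x))"
  and spectral_sum_Im: "spectral_sum n e (\<lambda>t. complex_of_real (Im (f t))) x = complex_of_real (Im (spectral_sum n e f x))"
  by (simp_all add: spectral_sum_def)

lemma trig_poly_value:
  assumes n: "n \<ge> 1" and r: "r < 2 * n"
  shows "cis (- real (n - 1) * t) * poly (trig_poly n r) (cis t) =
    (if r < 2 * n - 2 then
       if even r then complex_of_real (Re (cis t ^ Suc (r div 2))) else complex_of_real (Im (cis t ^ Suc (r div 2)))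
     else if r = 2 * n - 2 then cis t ^ n else 1)"
proof -
  have c: "cis (- real (n - 1) * t) * cis t ^ k = cis ((real k - real (n - 1)) * t)" for k
    by (simp only: Complex.DeMoivre cis_mult) (simp add: algebra_simps)
  have re: "complex_of_real (Re (cis s)) = (cis s + cis (- s)) / 2"
    and im: "complex_of_real (Im (cis s)) = - \<i> / 2 * cis s + \<i> / 2 * cis (- s)" for s
    by (simp_all add: complex_eq_iff)
  consider "r < 2 * n - 2" | "r = 2 * n - 2" | "r = 2 * n - 1" using r by linarith
  then show ?thesis
  proof cases
    case 1
    define k where "k = r div 2"
    have k: "k \<le> n - 2" "n \<ge> 2" using 1 by (auto simp: k_def)
    \<comment> \<open>The prefactor lowers all exponents by \<open>n - 1\<close>; so
      \<open>n + k\<close> and \<open>n - 2 - k\<close> become \<open>k + 1\<close> and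
      \<open>- (k + 1)\<close>, a conjugate pair on the circle.\<close>
    have e1: "(real (n + k) - real (n - 1)) * t = real (Suc k) * t"
      using n by (simp add: of_nat_diff)
    have e2: "(real (n - 2 - k) - real (n - 1)) * t = - (real (Suc k) * t)"
      using k n by (simp add: of_nat_diff algebra_simps)
    have X: "cis (- real (n - 1) * t) * (c1 * cis t ^ (n + k) + c2 * cis t ^ (n - 2 - k))
       = c1 * cis (real (Suc k) * t) + c2 * cis (- (real (Suc k) * t))" for c1 c2
    proof -
      have "cis (- real (n - 1) * t) * (c1 * cis t ^ (n + k) + c2 * cis t ^ (n - 2 - k))
        = c1 * (cis (- real (n - 1) * t) * cis t ^ (n + k)) + c2 * (cis (- real (n - 1) * t) * cis t ^ (n - 2 - k))"
        by (simp only: distrib_left mult_ac)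
      then show ?thesis unfolding c e1 e2 .
    qed
    have pt: "poly (trig_poly n r) (cis t) =
       (if even r then 1 / 2 else - \<i> / 2) * cis t ^ (n + k) + (if even r then 1 / 2 else \<i> / 2) * cis t ^ (n - 2 - k)"
      using 1 by (simp add: trig_poly_def poly_monom flip: k_def)
    have "cis (- real (n - 1) * t) * poly (trig_poly n r) (cis t) =
       (if even r then 1 / 2 else - \<i> / 2) * cis (real (Suc k) * t)
       + (if even r then 1 / 2 else \<i> / 2) * cis (- (real (Suc k) * t))"
      unfolding pt by (rule X)
    then show ?thesis
      using 1 unfolding k_def[symmetric] Complex.DeMoivre re im
      by (simp add: add_divide_distrib del: of_nat_Suc)
  next
    case 2
    have e: "real (2 * n - 1) - real (n - 1) = real n" using n by (simp add: of_nat_diff)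
    have "cis (- real (n - 1) * t) * cis t ^ (2 * n - 1) = cis t ^ n"
      by (subst c, subst e) (simp only: Complex.DeMoivre)
    then show ?thesis using 2 by (simp add: trig_poly_def poly_monom)
  next
    case 3
    have "\<not> 2 * n - 1 < 2 * n - 2" "2 * n - 1 \<noteq> 2 * n - 2" using n by auto
    then show ?thesis using 3 c[of "n - 1"] by (simp add: trig_poly_def poly_monom)
  qed
qed

lemma ex_strict_mono_enumeration:
  fixes S :: "'a::linorder set"
  assumes "finite S"
  shows "\<exists>h. bij_betw h {..<card S} S \<and> strict_mono_on {..<card S} h"
proof (intro exI conjI)
  let ?xs = "sorted_list_of_set S"
  show "bij_betw ((!) ?xs) {..<card S} S"
    by (rule bij_betw_nth) (use assms in auto)
  show "strict_mono_on {..<card S} ((!) ?xs)"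
  proof (rule strict_mono_onI)
    fix i j assume "i \<in> {..<card S}" "j \<in> {..<card S}" "i < j"
    then show "?xs ! i < ?xs ! j"
      using sorted_wrt_nth_less[OF strict_sorted_list_of_set, of i j S] by simp
  qed
qed

locale jacobian_coords =
  fixes n :: nat and e :: "nat \<Rightarrow> 'd::finite"
  assumes n: "n \<ge> 1" and e: "bij_betw e {..<2 * n - 1} (UNIV :: 'd set)"
begin

lemma e_eq_iff: "i < 2 * n - 1 \<Longrightarrow> j < 2 * n - 1 \<Longrightarrow> e i = e j \<longleftrightarrow> i = j"
  using e by (auto simp: bij_betw_def inj_on_def)

lemma axis_nth:
  "i < 2 * n - 1 \<Longrightarrow> s < 2 * n - 1 \<Longrightarrow> vec_nth (axis (e s) 1 :: real ^ 'd) (e i) = (if i = s then 1 else 0)"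
  using e_eq_iff[of i s] by (auto simp: axis_def)

lemma vec_eqI_coords:
  fixes b c :: "real ^ 'd"
  assumes "\<And>i. i < 2 * n - 1 \<Longrightarrow> vec_nth b (e i) = vec_nth c (e i)"
  shows "b = c"
proof -
  have "\<exists>i<2 * n - 1. d = e i" for d using e by (metis UNIV_I bij_betw_def imageE lessThan_iff)
  then show ?thesis unfolding Finite_Cartesian_Product.vec_eq_iff using assms by metis
qed

definition idx :: "'d \<Rightarrow> nat" where
  "idx = inv_into {..<2 * n - 1} e"

lemma idx_e: "i < 2 * n - 1 \<Longrightarrow> idx (e i) = i"
  using e by (simp add: idx_def bij_betw_inv_into_left)

abbreviation P :: "real ^ 'd \<Rightarrow> nat \<Rightarrow> complex" where
  "P \<equiv> unitary_params n e"

abbreviation C :: "real ^ 'd \<Rightarrow> nat \<Rightarrow> complex" where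
  "C x k \<equiv> spectral_sum n e (\<lambda>t. cis t ^ k) x"

lemma unitary_hessenberg_params: "a \<in> unitary_domain n e \<Longrightarrow> hessenberg_params n (P a)"
  using n by unfold_locales (auto simp: unitary_domain_def unitary_params_def)

lemma unitary_corrD:
  assumes "unitary_corr n e a x"
  shows "a \<in> unitary_domain n e"
    and "strict_mono_on {..<n} (angle_of e x)" and "angle_of e x (n - 1) < angle_of e x 0 + 2 * pi"
    and "\<And>j. j < n \<Longrightarrow> q_of n e x j > 0"
    and "bij_betw (\<lambda>j. cis (vec_nth x (e j))) {..<n} (hessenberg_params.roots n (P a))"
    and "\<And>j. j < n \<Longrightarrow> sqweight n e x j = hessenberg_params.wt n (P a) (cis (vec_nth x (e j)))"
    and "\<And>j. j < n \<Longrightarrow> sqweight n e x j = (q_of n e x j)\<^sup>2"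
proof -
  show a: "a \<in> unitary_domain n e" using assms by (simp add: unitary_corr_def)
  interpret h: hessenberg_params n "P a" by (rule unitary_hessenberg_params[OF a])
  note s = assms[unfolded unitary_corr_def unitary_spectral_data_def h.eigenvalue_roots h.eigen_weight_iff]
  show "strict_mono_on {..<n} (angle_of e x)" "angle_of e x (n - 1) < angle_of e x 0 + 2 * pi" using s by auto
  show q: "q_of n e x j > 0" if "j < n" for j using s that by auto
  show "bij_betw (\<lambda>j. cis (vec_nth x (e j))) {..<n} h.roots"
    by (rule h.bij_betw_roots) (use s in \<open>simp add: angle_of_def\<close>)
  show w: "sqweight n e x j = (q_of n e x j)\<^sup>2" if "j < n" for j
    using sqweight_eq_q_of[OF n that] q[of "n - 1"] n by simp
  show "sqweight n e x j = h.wt (cis (vec_nth x (e j)))" if "j < n" for j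
    using s that by (auto simp: w angle_of_def)
qed

text \<open>Checking finitely many moments and one product replaces any computation with
  eigenvectors when \<open>unitary_inverse\<close> is verified.\<close>

lemma unitary_corrI:
  assumes a: "a \<in> unitary_domain n e"
    and mono: "strict_mono_on {..<n} (angle_of e x)" and win: "angle_of e x (n - 1) < angle_of e x 0 + 2 * pi"
    and q: "\<And>j. j < n \<Longrightarrow> q_of n e x j > 0"
    and mo: "\<And>k. k < n \<Longrightarrow> C x k = moment (P a) k"
    and pr: "(\<Prod>j<n. - cis (vec_nth x (e j))) = - cnj (P a (n - 1))"
  shows "unitary_corr n e a x"
proof -
  interpret h: hessenberg_params n "P a" by (rule unitary_hessenberg_params[OF a])
  have inj: "inj_on (\<lambda>j. cis (vec_nth x (e j))) {..<n}"
  proof (rule linorder_inj_onI)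
    fix i j assume ij: "i < j" "i \<in> {..<n}" "j \<in> {..<n}"
    have "vec_nth x (e i) < vec_nth x (e j)"
      using mono ij by (auto simp: strict_mono_on_def angle_of_def)
    moreover have "vec_nth x (e 0) \<le> vec_nth x (e i)" "vec_nth x (e j) \<le> vec_nth x (e (n - 1))"
    proof -
      have le: "vec_nth x (e k) \<le> vec_nth x (e l)" if "k \<le> l" "l < n" for k l
        using mono that by (cases "k = l") (auto simp: strict_mono_on_def angle_of_def less_imp_le)
      show "vec_nth x (e 0) \<le> vec_nth x (e i)" "vec_nth x (e j) \<le> vec_nth x (e (n - 1))"
        using ij by (auto intro!: le)
    qed
    ultimately have "\<bar>vec_nth x (e i) - vec_nth x (e j)\<bar> < 2 * pi" "vec_nth x (e i) \<noteq> vec_nth x (e j)"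
      using win by (auto simp: angle_of_def)
    then show "cis (vec_nth x (e i)) \<noteq> cis (vec_nth x (e j))" using cis_eq_imp_eq by blast
  qed auto
  have uni: "\<And>j. j < n \<Longrightarrow> cmod (cis (vec_nth x (e j))) = 1" by simp
  have mo': "\<And>k. k < n \<Longrightarrow> (\<Sum>j<n. complex_of_real (sqweight n e x j) * cis (vec_nth x (e j)) ^ k) = moment (P a) k"
    using mo by (simp add: spectral_sum_def)
  note r = h.roots_from_moments[OF inj uni mo' pr]
  have w: "sqweight n e x j = (q_of n e x j)\<^sup>2" if "j < n" for j
    using sqweight_eq_q_of[OF n that] q[of "n - 1"] n by simp
  show ?thesis
    unfolding unitary_corr_def unitary_spectral_data_def h.eigenvalue_roots h.eigen_weight_iff
    using a mono win q r w by (auto simp: angle_of_def)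
qed

text \<open>Sorting the principal arguments of the eigenvalues supplies one admissible labelling:
  they lie in an interval of length \<open>2 * pi\<close> open at one end, so the window condition
  holds.\<close>

lemma ex_unitary_corr:
  assumes a: "a \<in> unitary_domain n e"
  shows "\<exists>x. unitary_corr n e a x"
proof -
  interpret h: hessenberg_params n "P a" by (rule unitary_hessenberg_params[OF a])
  have cA: "cis (Arg z) = z" if "z \<in> h.roots" for z
  proof -
    have "cmod z = 1" by (rule h.roots_unimodular[OF that])
    then show ?thesis using cis_Arg[of z] by (cases "z = 0") (simp_all add: sgn_eq)
  qed
  have inj: "inj_on Arg h.roots" using cA by (metis inj_onI)
  obtain \<theta> where t: "bij_betw \<theta> {..<n} (Arg ` h.roots)" "strict_mono_on {..<n} \<theta>"
    using ex_strict_mono_enumeration[of "Arg ` h.roots"] card_image[OF inj] h.card_roots by auto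
  have range: "- pi < \<theta> j \<and> \<theta> j \<le> pi" if "j < n" for j
  proof -
    have "\<theta> j \<in> Arg ` h.roots" using t(1) that by (auto simp: bij_betw_def)
    then show ?thesis using Arg_bounded by auto
  qed
  have im: "(\<lambda>j. cis (\<theta> j)) ` {..<n} = h.roots"
  proof -
    have "(\<lambda>j. cis (\<theta> j)) ` {..<n} = cis ` Arg ` h.roots"
      using t(1) by (metis bij_betw_imp_surj_on image_image)
    also have "\<dots> = h.roots" using cA by (force simp: image_iff)
    finally show ?thesis .
  qed
  have bij: "bij_betw (\<lambda>j. cis (\<theta> j)) {..<n} h.roots" by (rule h.bij_betw_roots[OF im])
  define q where "q j = sqrt (h.wt (cis (\<theta> j)))" for j
  have q: "q j > 0" "(q j)\<^sup>2 = h.wt (cis (\<theta> j))" for j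
    using h.wt_pos by (simp_all add: q_def less_imp_le)
  have "(\<Sum>j<n. (q j)\<^sup>2) = (\<Sum>z\<in>h.roots. h.wt z)"
    unfolding q(2) by (rule sum.reindex_bij_betw[OF bij])
  then have "(\<Sum>j<n. (q j)\<^sup>2) = 1" using h.sum_wt by simp
  then obtain x where x: "\<forall>j<n. angle_of e x j = \<theta> j" "\<forall>j<n. q_of n e x j = q j"
    using ex_spectral_coordinates[OF e n, where q = q and \<theta> = \<theta>] q(1) by blast
  have im': "(\<lambda>j. cis (angle_of e x j)) ` {..<n} = h.roots" using im x(1) by simp
  have sm: "strict_mono_on {..<n} (angle_of e x)"
    using t(2) x(1) by (auto simp: strict_mono_on_def)
  have "angle_of e x (n - 1) < angle_of e x 0 + 2 * pi"
    using x(1) n range[of "n - 1"] range[of 0] by simp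
  then have "unitary_corr n e a x"
    unfolding unitary_corr_def unitary_spectral_data_def h.eigenvalue_roots h.eigen_weight_iff
    using a sm im' x q by auto
  then show ?thesis by blast
qed

end

lemma cis_power_has_vector_derivative:
  "((\<lambda>t. cis t ^ k) has_vector_derivative \<i> * of_real (real k) * cis (real k * t)) (at t)"
  unfolding Complex.DeMoivre by (rule cis_mult_has_vector_derivative)

lemma spectral_sum_differentiable:
  fixes x :: "real ^ 'd::finite"
  assumes "\<And>t. (R has_vector_derivative R' t) (at t)"
  shows "spectral_sum n e R differentiable (at x)"
  using spectral_sum_has_derivative[OF assms] unfolding differentiable_def by blast

lemma prod_halves: "(\<Prod>r<2 * m. f (r div 2)) = (\<Prod>k<m. (f k)\<^sup>2)" for f :: "nat \<Rightarrow> real"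
  by (induction m) (simp_all add: power2_eq_square)

section \<open>The local map from spectral data to parameters and its Jacobian, unitary case\<close>

context jacobian_coords
begin

lemma unitary_params_nth:
  "j < n - 1 \<Longrightarrow> P b j = Complex (vec_nth b (e (2 * j))) (vec_nth b (e (2 * j + 1)))"
  "P b (n - 1) = cis (vec_nth b (e (2 * n - 2)))"
  by (simp_all add: unitary_params_def)

lemma unitary_params_differentiable:
  assumes "l < n"
  shows "(\<lambda>b. P b l) differentiable (at a)"
proof (cases "l < n - 1")
  case True
  have "(\<lambda>b. complex_of_real (vec_nth b (e (2 * l))) + \<i> * complex_of_real (vec_nth b (e (2 * l + 1)))) differentiable (at a)"
    by (intro differentiable_add differentiable_mult of_real_differentiable vec_nth_differentiable) auto
  then show ?thesis using True by (simp add: unitary_params_nth Complex_eq)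
next
  case False
  then have l: "l = n - 1" using assms by simp
  have "((\<lambda>b. cis (vec_nth b (e (2 * n - 2)))) has_derivative
     (\<lambda>h. vec_nth h (e (2 * n - 2)) *\<^sub>R (\<i> * cis (vec_nth a (e (2 * n - 2)))))) (at a)"
    by (intro has_derivative_cis has_derivative_vec_nth)
  then show ?thesis unfolding l unitary_params_nth(2) differentiable_def by blast
qed

lemma C_differentiable: "(\<lambda>x. C x k) differentiable (at p)"
  using spectral_sum_differentiable[OF cis_power_has_vector_derivative] .

lemma C_0: "C x 0 = 1"
  using sum_sqweight[OF n, of e x] by (simp add: spectral_sum_def flip: of_real_sum)

lemma unitary_corr_moments:
  assumes "unitary_corr n e a x"
  shows "k \<le> n \<Longrightarrow> C x k = moment (P a) k"
    and "(- 1) ^ n * cis (\<Sum>j<n. vec_nth x (e j)) = - cis (- vec_nth a (e (2 * n - 2)))"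
    and "gaps n (\<lambda>j. cis (vec_nth x (e j))) * (\<Prod>j<n. (q_of n e x j)\<^sup>2) = (\<Prod>k<n. sqnorm (P a) k)"
proof -
  note d = unitary_corrD[OF assms]
  interpret h: hessenberg_params n "P a" by (rule unitary_hessenberg_params[OF d(1)])
  note m = h.indexed_moments[OF d(5,6)]
  show "k \<le> n \<Longrightarrow> C x k = moment (P a) k" using m(1) by (simp add: spectral_sum_def)
  have "(\<Prod>j<n. - cis (vec_nth x (e j))) = (- 1) ^ n * cis (\<Sum>j<n. vec_nth x (e j))"
    by (simp add: prod_uminus prod_cis)
  then show "(- 1) ^ n * cis (\<Sum>j<n. vec_nth x (e j)) = - cis (- vec_nth a (e (2 * n - 2)))"
    using m(2) unfolding unitary_params_nth(2) cis_cnj by simp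
  show "gaps n (\<lambda>j. cis (vec_nth x (e j))) * (\<Prod>j<n. (q_of n e x j)\<^sup>2) = (\<Prod>k<n. sqnorm (P a) k)"
    using m(3) d(7) by simp
qed

text \<open>The product of the eigenvalues makes the last phase plus the sum of the angles constant
  modulo \<open>2 * pi\<close>. The base pair \<open>(a, x)\<close> enters only to select the branch
  of this phase.\<close>

definition unitary_inverse :: "real ^ 'd \<Rightarrow> real ^ 'd \<Rightarrow> real ^ 'd \<Rightarrow> real ^ 'd" where
  "unitary_inverse a x z = (\<chi> d.
     if idx d < 2 * n - 2 then
       if even (idx d) then Re (verblunsky (C z) (idx d div 2)) else Im (verblunsky (C z) (idx d div 2))
     else vec_nth a (e (2 * n - 2)) + ((\<Sum>j<n. vec_nth x (e j)) - (\<Sum>j<n. vec_nth z (e j))))"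

lemma unitary_inverse_nth:
  "i < 2 * n - 2 \<Longrightarrow> vec_nth (unitary_inverse a x z) (e i) =
     (if even i then Re (verblunsky (C z) (i div 2)) else Im (verblunsky (C z) (i div 2)))"
  "vec_nth (unitary_inverse a x z) (e (2 * n - 2)) =
     vec_nth a (e (2 * n - 2)) + ((\<Sum>j<n. vec_nth x (e j)) - (\<Sum>j<n. vec_nth z (e j)))"
  using n by (simp_all add: unitary_inverse_def idx_e)

lemma unitary_params_inverse: "j < n - 1 \<Longrightarrow> P (unitary_inverse a x z) j = verblunsky (C z) j"
proof -
  assume j: "j < n - 1"
  then have "2 * j < 2 * n - 2" "2 * j + 1 < 2 * n - 2" by linarith+
  then show ?thesis using j by (simp add: unitary_params_nth unitary_inverse_nth del: One_nat_def)
qed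

lemma unitary_inverse_differentiable:
  assumes "\<forall>l<n - 1. cmod (verblunsky (C z) l) < 1"
  shows "unitary_inverse a x differentiable (at z)"
  unfolding differentiable_vec_nth_iff
proof
  fix d
  have v: "(\<lambda>z. verblunsky (C z) k) differentiable (at z)" if "k < n - 1" for k
  proof (rule verblunsky_differentiable)
    show "sqnorm (verblunsky (C z)) l \<noteq> 0" if "l \<le> k" for l
      using sqnorm_pos_of_less[of l "verblunsky (C z)"] assms that \<open>k < n - 1\<close> by force
  qed (rule C_differentiable)
  consider "idx d < 2 * n - 2" "even (idx d)" | "idx d < 2 * n - 2" "odd (idx d)" | "\<not> idx d < 2 * n - 2" by blast
  then show "(\<lambda>z. vec_nth (unitary_inverse a x z) d) differentiable (at z)"
  proof cases
    case 1
    then have "idx d div 2 < n - 1" by linarith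
    then show ?thesis using 1 Re_differentiable[OF v] by (simp add: unitary_inverse_def)
  next
    case 2
    then have "idx d div 2 < n - 1" by linarith
    then show ?thesis using 2 Im_differentiable[OF v] by (simp add: unitary_inverse_def)
  next
    case 3
    have "(\<lambda>z. vec_nth a (e (2 * n - 2)) + ((\<Sum>j<n. vec_nth x (e j)) - (\<Sum>j<n. vec_nth z (e j)))) differentiable (at z)"
      by (intro differentiable_add differentiable_diff differentiable_sum) (auto intro: vec_nth_differentiable)
    then show ?thesis using 3 by (simp add: unitary_inverse_def)
  qed
qed

lemma unitary_corr_imp_inverse:
  assumes ax: "unitary_corr n e a x" and bz: "unitary_corr n e b z"
    and near: "\<bar>vec_nth b (e (2 * n - 2)) - vec_nth a (e (2 * n - 2))\<bar> < 1"
      "\<bar>(\<Sum>j<n. vec_nth x (e j)) - (\<Sum>j<n. vec_nth z (e j))\<bar> < 1"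
  shows "b = unitary_inverse a x z"
proof (rule vec_eqI_coords)
  fix i assume i: "i < 2 * n - 1"
  interpret h: hessenberg_params n "P b"
    using unitary_hessenberg_params unitary_corrD(1)[OF bz] by blast
  note mb = unitary_corr_moments[OF bz] and ma = unitary_corr_moments[OF ax]
  have v: "verblunsky (C z) l = P b l" if "l < n - 1" for l
  proof (rule verblunsky_of_moments[of "n - 1", OF _ _ that])
    show "C z k = moment (P b) k" if "k \<le> n - 1" for k using mb(1) that by simp
    show "sqnorm (P b) k \<noteq> 0" if "k < n - 1" for k
    proof -
      have "k < n" using that by linarith
      then show ?thesis using h.sqnorm_pos[of k] by simp
    qed
  qed
  show "vec_nth b (e i) = vec_nth (unitary_inverse a x z) (e i)"
  proof (cases "i < 2 * n - 2")
    case True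
    then have k: "i div 2 < n - 1" by linarith
    have "i = 2 * (i div 2) \<or> i = 2 * (i div 2) + 1" by presburger
    then show ?thesis using True v[OF k] unitary_params_nth(1)[OF k, of b]
      by (auto simp: unitary_inverse_nth elim!: evenE oddE)
  next
    case False
    with i have i': "i = 2 * n - 2" by simp
    let ?S = "\<lambda>z. \<Sum>j<n. vec_nth z (e j)"
    let ?p = "\<lambda>b. vec_nth b (e (2 * n - 2))"
    \<comment> \<open>Both related pairs give the same value -1, so phase plus angle sum agrees
      modulo \<open>2 * pi\<close>; the bounds in \<open>near\<close> then exclude a multiple of
      \<open>2 * pi\<close>.\<close>
    have "cis (?p b) * ((- 1) ^ n * cis (?S z)) = - 1"
      unfolding mb(2) by (simp add: cis_mult)
    moreover have "cis (?p a) * ((- 1) ^ n * cis (?S x)) = - 1"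
      unfolding ma(2) by (simp add: cis_mult)
    ultimately have "(- 1) ^ n * cis (?p b + ?S z) = (- 1) ^ n * cis (?p a + ?S x)"
      by (simp only: cis_mult mult.left_commute)
    then have "cis (?p b + ?S z) = cis (?p a + ?S x)" by simp
    moreover have "\<bar>(?p b + ?S z) - (?p a + ?S x)\<bar> < 2 * pi" using near pi_gt3 by linarith
    ultimately have "?p b + ?S z = ?p a + ?S x" by (rule cis_eq_imp_eq)
    then show ?thesis unfolding i' by (simp add: unitary_inverse_nth)
  qed
qed

lemma unitary_inverse_corr:
  assumes ax: "unitary_corr n e a x" and dom: "unitary_inverse a x z \<in> unitary_domain n e"
    and mono: "strict_mono_on {..<n} (angle_of e z)" "angle_of e z (n - 1) < angle_of e z 0 + 2 * pi"
    and q: "\<And>j. j < n \<Longrightarrow> q_of n e z j > 0"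
    and v: "\<forall>l<n - 1. cmod (verblunsky (C z) l) < 1"
  shows "unitary_corr n e (unitary_inverse a x z) z"
proof (rule unitary_corrI[OF dom mono q])
  fix k assume k: "k < n"
  have "moment (P (unitary_inverse a x z)) k = moment (verblunsky (C z)) k"
    using k by (intro moment_cong) (simp add: unitary_params_inverse)
  also have "\<dots> = C z k"
  proof (rule moments_of_verblunsky[of _ "n - 1"])
    show "sqnorm (verblunsky (C z)) l \<noteq> 0" if "l < n - 1" for l
      using sqnorm_pos_of_less[of l "verblunsky (C z)"] v that by force
  qed (use k C_0 in auto)
  finally show "C z k = moment (P (unitary_inverse a x z)) k" ..
next
  let ?S = "\<lambda>z. \<Sum>j<n. vec_nth z (e j)"
  let ?p = "\<lambda>b. vec_nth b (e (2 * n - 2))"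
  have "(\<Prod>j<n. - cis (vec_nth z (e j))) = (- 1) ^ n * cis (?S z)"
    by (simp add: prod_uminus prod_cis)
  also have "\<dots> = ((- 1) ^ n * cis (?S x)) * cis (?S z - ?S x)"
    by (simp add: cis_mult)
  also have "\<dots> = - (cis (- ?p a) * cis (?S z - ?S x))"
    unfolding unitary_corr_moments(2)[OF ax] by simp
  also have "\<dots> = - cis (- ?p (unitary_inverse a x z))"
    by (simp only: cis_mult unitary_inverse_nth(2)) (simp add: algebra_simps)
  also have "\<dots> = - cnj (P (unitary_inverse a x z) (n - 1))"
    by (simp only: unitary_params_nth(2) cis_cnj)
  finally show "(\<Prod>j<n. - cis (vec_nth z (e j))) = - cnj (P (unitary_inverse a x z) (n - 1))" .
qed

text \<open>On the spectral side the last coordinate is the complex moment of order \<open>n\<close>, of which only one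
  real direction is hit; this is why the matrices in \<open>det_triangular_chain\<close> are complex.\<close>

definition unitary_T :: "nat \<Rightarrow> real ^ 'd \<Rightarrow> complex" where
  "unitary_T r b = (if r < 2 * n - 2 then
       if even r then complex_of_real (Re (moment (P b) (Suc (r div 2)))) else complex_of_real (Im (moment (P b) (Suc (r div 2))))
     else moment (P b) n)"

lemma unitary_T_differentiable:
  assumes "r < 2 * n - 1"
  shows "unitary_T r differentiable (at a)"
proof -
  have m: "(\<lambda>b. moment (P b) k) differentiable (at a)" if "k \<le> n" for k
    using that by (intro moment_differentiable unitary_params_differentiable) simp
  show ?thesis
  proof (cases "r < 2 * n - 2")
    case True
    then have "Suc (r div 2) \<le> n" by linarith
    then show ?thesis using True m
      by (cases "even r") (auto simp: unitary_T_def[abs_def] intro!: of_real_differentiable Re_differentiable Im_differentiable)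
  next
    case False
    then show ?thesis using m by (simp add: unitary_T_def[abs_def])
  qed
qed

lemma unitary_params_line:
  assumes "s < 2 * n - 1"
  shows "j < n - 1 \<Longrightarrow> P (a + t *\<^sub>R axis (e s) 1) j =
      P a j + (if s = 2 * j then of_real t else if s = 2 * j + 1 then \<i> * of_real t else 0)"
    and "P (a + t *\<^sub>R axis (e s) 1) (n - 1) =
      cis (vec_nth a (e (2 * n - 2)) + (if s = 2 * n - 2 then t else 0))"
proof -
  assume j: "j < n - 1"
  then have "2 * j < 2 * n - 1" "2 * j + 1 < 2 * n - 1" by linarith+
  then show "P (a + t *\<^sub>R axis (e s) 1) j =
      P a j + (if s = 2 * j then of_real t else if s = 2 * j + 1 then \<i> * of_real t else 0)"
    using axis_nth[OF _ assms] j by (auto simp: unitary_params_nth complex_eq_iff simp del: One_nat_def)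
next
  have "2 * n - 2 < 2 * n - 1" using n by linarith
  then show "P (a + t *\<^sub>R axis (e s) 1) (n - 1) =
      cis (vec_nth a (e (2 * n - 2)) + (if s = 2 * n - 2 then t else 0))"
    unfolding unitary_params_nth(2) using axis_nth[OF _ assms] by auto
qed

text \<open>Rows alternate between real and imaginary parts, in step with the coordinates. The slope
  is real, so moving \<open>Im (\<alpha> k)\<close> leaves the real part of the moment of order
  \<open>k + 1\<close> fixed. The minus signs come from the conjugated parameter in the moment
  recursion.\<close>

lemma unitary_T_derivative:
  assumes T: "(unitary_T r has_derivative T') (at a)" and r: "r \<le> s" and s: "s < 2 * n - 1"
  shows "T' (axis (e s) 1) = (if r = s then
      if r = 2 * n - 2 then - \<i> * cis (- vec_nth a (e (2 * n - 2))) * complex_of_real (sqnorm (P a) (n - 1))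
      else if even r then complex_of_real (sqnorm (P a) (r div 2)) else - complex_of_real (sqnorm (P a) (r div 2))
    else 0)"
proof (rule derivative_along[OF T])
  let ?a = "\<lambda>t. a + t *\<^sub>R axis (e s) 1"
  let ?E = "\<lambda>k. complex_of_real (sqnorm (P a) k)"
  have ch: "moment (P (?a t)) (Suc k) = moment (P a) (Suc k) + (cnj (P (?a t) k) - cnj (P a k)) * ?E k"
    if "k \<le> s div 2" "k < n" for k t
  proof (rule moment_change)
    fix l assume "l < k"
    then have "l < n - 1" "s \<noteq> 2 * l" "s \<noteq> 2 * l + 1" using that by linarith+
    then show "P (?a t) l = P a l" using unitary_params_line(1)[OF s, of l a t] by simp
  qed
  show "((\<lambda>t. unitary_T r (?a t)) has_vector_derivative (if r = s then
      if r = 2 * n - 2 then - \<i> * cis (- vec_nth a (e (2 * n - 2))) * ?E (n - 1)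
      else if even r then ?E (r div 2) else - ?E (r div 2)
    else 0)) (at 0)"
  proof (cases "r < 2 * n - 2")
    case True
    define k where "k = r div 2"
    have k: "k < n - 1" "k < n" "k \<le> s div 2" using True r unfolding k_def by (linarith, linarith, simp add: div_le_mono)
    have rk: "r = 2 * k \<and> even r \<or> r = 2 * k + 1 \<and> odd r" unfolding k_def by presburger
    have "cnj (P (?a t) k) - cnj (P a k) =
        (if s = 2 * k then of_real t else if s = 2 * k + 1 then - \<i> * of_real t else 0)" for t
      unfolding unitary_params_line(1)[OF s k(1)] by simp
    then have ml: "moment (P (?a t)) (Suc k) = moment (P a) (Suc k) +
        (if s = 2 * k then of_real t else if s = 2 * k + 1 then - \<i> * of_real t else 0) * ?E k" for t
      using ch[OF k(3,2)] by simp
    from rk show ?thesis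
    proof (elim disjE conjE)
      assume a: "r = 2 * k" "even r"
      have "unitary_T r (?a t) = unitary_T r a + t *\<^sub>R (if r = s then ?E k else 0)" for t
        using True a unfolding unitary_T_def k_def[symmetric] ml by (auto simp: complex_eq_iff)
      then show ?thesis using a True
        by (auto intro!: derivative_eq_intros simp: has_vector_derivative_def)
    next
      assume a: "r = 2 * k + 1" "odd r"
      then have s': "s \<noteq> 2 * k" using r by linarith
      have "unitary_T r (?a t) = unitary_T r a + t *\<^sub>R (if r = s then - ?E k else 0)" for t
        using True a s' unfolding unitary_T_def k_def[symmetric] ml by (auto simp: complex_eq_iff)
      then show ?thesis using a True
        by (auto intro!: derivative_eq_intros simp: has_vector_derivative_def)
    qed
  next
    case False
    with r s have rs: "r = 2 * n - 2" "s = 2 * n - 2" by linarith+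
    have nn: "Suc (n - 1) = n" using n by simp
    have "n - 1 \<le> s div 2" "n - 1 < n" using rs n by linarith+
    from ch[OF this] have "unitary_T r (?a t) = moment (P a) n + (cis (- vec_nth a (e (2 * n - 2)) + (- 1) * t) - cnj (P a (n - 1))) * ?E (n - 1)" for t
      using False unitary_params_line(2)[OF s, of a t] rs by (simp add: unitary_T_def nn cis_cnj del: One_nat_def)
    moreover have "((\<lambda>t. moment (P a) n + (cis (- vec_nth a (e (2 * n - 2)) + (- 1) * t) - cnj (P a (n - 1))) * ?E (n - 1))
       has_vector_derivative (- \<i> * cis (- vec_nth a (e (2 * n - 2))) * ?E (n - 1))) (at 0)"
      unfolding has_vector_derivative_def
      by (auto intro!: derivative_eq_intros simp: scaleR_conv_of_real mult_ac)
    ultimately show ?thesis using rs by simp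
  qed
qed


lemma unitary_corr_sqnorm_pos:
  assumes "unitary_corr n e a x" "k < n"
  shows "sqnorm (P a) k > 0"
  using hessenberg_params.sqnorm_pos[OF unitary_hessenberg_params[OF unitary_corrD(1)[OF assms(1)]] assms(2)] .

text \<open>Ordering and positivity make the data admissible; the last two conditions keep each node
  in its own disc and each angle within distance 1 of its base value, as
  \<open>spectral_data_inj\<close> requires.\<close>

lemma open_spectral_region:
  fixes S :: "nat \<Rightarrow> real ^ 'd \<Rightarrow> complex"
  shows "open {z :: real ^ 'd. (\<forall>i<n. \<forall>j<n. i < j \<longrightarrow> vec_nth z (e i) < vec_nth z (e j)) \<and>
     (\<forall>j<n - 1. 0 < vec_nth z (e (n + j))) \<and> (\<Sum>i<n - 1. (vec_nth z (e (n + i)))\<^sup>2) < 1 \<and>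
     (\<forall>j<n. dist (cis (vec_nth z (e j))) (w j) < \<delta>) \<and> (\<forall>j<n. \<bar>vec_nth z (e j) - t j\<bar> < 1)}"
proof -
  have cis: "continuous_on UNIV cis"
    by (intro continuous_at_imp_continuous_on ballI)
       (metis cis_has_vector_derivative has_vector_derivative_continuous)
  have cc: "continuous_on UNIV (\<lambda>z :: real ^ 'd. cis (vec_nth z i))" for i
    by (rule continuous_on_compose2[OF cis]) (auto intro: continuous_intros)
  have "open {z :: real ^ 'd. i < j \<longrightarrow> vec_nth z (e i) < vec_nth z (e j)}" for i j
    by (cases "i < j") (auto intro!: open_Collect_less continuous_intros)
  moreover have "open {z :: real ^ 'd. dist (cis (vec_nth z (e j))) (w j) < \<delta>}" for j
    by (intro open_Collect_less continuous_intros cc)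
  ultimately show ?thesis
    by (intro open_Collect_conj open_Collect_all_less open_Collect_less continuous_intros) auto
qed

lemma q_of_pos_iff:
  "(\<forall>j<n. 0 < q_of n e z j) \<longleftrightarrow>
     (\<forall>j<n - 1. 0 < vec_nth z (e (n + j))) \<and> (\<Sum>i<n - 1. (vec_nth z (e (n + i)))\<^sup>2) < 1"
proof -
  have "j < n \<longleftrightarrow> j < n - 1 \<or> j = n - 1" for j using n by linarith
  then show ?thesis by (auto simp: q_of_def)
qed

lemma open_unitary_domain: "open (unitary_domain n e)"
  unfolding unitary_domain_def
proof (intro open_Collect_all_less open_Collect_less continuous_on_norm continuous_on_const)
  fix j assume "j < n - 1"
  then have "j < n" by linarith
  then show "continuous_on UNIV (\<lambda>b. P b j)"
    by (intro continuous_at_imp_continuous_on ballI differentiable_imp_continuous_within unitary_params_differentiable)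
qed

lemma unitary_jacobian:
  assumes ax: "unitary_corr n e a x"
  shows "has_jacobian_at (unitary_corr n e) a x
     ((\<Prod>i<n - 1. 1 - (cmod (P a i))\<^sup>2) / (q_of n e x (n - 1) * (\<Prod>i<n. q_of n e x i)))"
proof -
  note d = unitary_corrD[OF ax]
  let ?z = "\<lambda>j. cis (vec_nth x (e j))"
  obtain \<delta> where \<delta>: "\<delta> > 0" "\<And>i j. i < n \<Longrightarrow> j < n \<Longrightarrow> i \<noteq> j \<Longrightarrow> 2 * \<delta> \<le> dist (?z i) (?z j)"
    using ex_separation[OF bij_betw_imp_inj_on[OF d(5)]] by auto
  define U1 where "U1 = {z :: real ^ 'd. (\<forall>i<n. \<forall>j<n. i < j \<longrightarrow> vec_nth z (e i) < vec_nth z (e j)) \<and>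
     (\<forall>j<n - 1. 0 < vec_nth z (e (n + j))) \<and> (\<Sum>i<n - 1. (vec_nth z (e (n + i)))\<^sup>2) < 1 \<and>
     (\<forall>j<n. dist (cis (vec_nth z (e j))) (?z j) < \<delta>) \<and> (\<forall>j<n. \<bar>vec_nth z (e j) - vec_nth x (e j)\<bar> < 1)}"
  define U2 where "U2 = {z. \<forall>l<n - 1. cmod (verblunsky (C z) l) < 1}"
  \<comment> \<open>The bound 1 on the angle sum and the bound 1 on the phase in \<open>D\<close>
    together stay below \<open>2 * pi\<close>, which fixes the branch of the last phase.\<close>
  define U3 where "U3 = {z :: real ^ 'd. vec_nth z (e (n - 1)) < vec_nth z (e 0) + 2 * pi \<and>
     \<bar>(\<Sum>j<n. vec_nth x (e j)) - (\<Sum>j<n. vec_nth z (e j))\<bar> < 1}"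
  define D where "D = unitary_domain n e \<inter> {b. \<bar>vec_nth b (e (2 * n - 2)) - vec_nth a (e (2 * n - 2))\<bar> < 1}"
  let ?F = "unitary_inverse a x"
  have "open U1" unfolding U1_def by (rule open_spectral_region)
  moreover have "open U2" unfolding U2_def by (rule open_verblunsky_less) (rule C_differentiable)
  moreover have "open U3" unfolding U3_def
    by (intro open_Collect_conj open_Collect_less continuous_intros)
  ultimately have U: "open (U1 \<inter> U2 \<inter> U3)" by (intro open_Int)
  have Faa: "a = ?F x" by (rule unitary_corr_imp_inverse[OF ax ax]) auto
  have xU: "x \<in> U1 \<inter> U2 \<inter> U3"
  proof -
    have "cmod (verblunsky (C x) l) < 1" if "l < n - 1" for l
    proof -
      have "verblunsky (C x) l = P (?F x) l" by (rule unitary_params_inverse[OF that, symmetric])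
      moreover have "cmod (P a l) < 1" using d(1) that unfolding unitary_domain_def by blast
      ultimately show ?thesis using Faa by metis
    qed
    moreover have "\<forall>j<n. 0 < q_of n e x j" using d(4) by simp
    ultimately show ?thesis
      using d(2,3) \<delta>(1) unfolding q_of_pos_iff
      by (auto simp: U1_def U2_def U3_def strict_mono_on_def angle_of_def)
  qed
  have Dopen: "open D" unfolding D_def
    by (intro open_Int open_unitary_domain open_Collect_less continuous_intros)
  have aD: "a \<in> D" using d(1) by (simp add: D_def)
  have valid: "strict_mono_on {..<n} (angle_of e z)" "angle_of e z (n - 1) < angle_of e z 0 + 2 * pi"
    "\<And>j. j < n \<Longrightarrow> q_of n e z j > 0" "\<forall>l<n - 1. cmod (verblunsky (C z) l) < 1" if "z \<in> U1 \<inter> U2 \<inter> U3" for z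
    using that q_of_pos_iff[of z] by (auto simp: U1_def U2_def U3_def strict_mono_on_def angle_of_def)
  \<comment> \<open>With this unimodular \<open>u\<close> the test functions are real and imaginary
    parts of powers of \<open>cis t\<close>, then \<open>cis t ^ n\<close>, then 1; \<open>u\<close>
    and \<open>y'\<close> have modulus 1 and drop out of the determinant.\<close>
  define u y u' y' where "u = (\<lambda>t. cis (- real (n - 1) * t))" and "y = cis"
    and "u' = (\<lambda>t. \<i> * of_real (- real (n - 1)) * cis (- real (n - 1) * t))" and "y' = (\<lambda>t. \<i> * cis t)"
  have u: "(u has_vector_derivative u' t) (at t)" and y: "(y has_vector_derivative y' t) (at t)" for t
    unfolding u_def u'_def y_def y'_def by (rule cis_mult_has_vector_derivative cis_has_vector_derivative)+
  have lastrow: "u t * poly (trig_poly n (2 * n - 1)) (y t) = 1" for t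
  proof -
    have "\<not> 2 * n - 1 < 2 * n - 2" "2 * n - 1 \<noteq> 2 * n - 2" "2 * n - 1 < 2 * n" using n by linarith+
    then show ?thesis unfolding u_def y_def using trig_poly_value[OF n, of "2 * n - 1" t] by simp
  qed
  define R where "R r t = u t * poly (trig_poly n r) (y t)" for r t
  define R' where "R' r t = u t * (y' t * poly (pderiv (trig_poly n r)) (y t)) + u' t * poly (trig_poly n r) (y t)" for r t
  note ds1 = det_spectral_sum(1)[where f = "trig_poly n" and u = u and u' = u' and y = y and y' = y',
      OF n e degree_trig_poly[OF n] u y lastrow, folded R_def R'_def]
    and ds2 = det_spectral_sum(2)[where f = "trig_poly n" and u = u and u' = u' and y = y and y' = y' and x = x,
      OF n e degree_trig_poly[OF n] u y lastrow]
  let ?T' = "\<lambda>r. frechet_derivative (unitary_T r) (at a)"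
  have T: "(unitary_T r has_derivative ?T' r) (at a)" if "r < 2 * n - 1" for r
    using unitary_T_differentiable[OF that] frechet_derivative_works by blast
  let ?E = "sqnorm (P a)"
  have E: "?E k > 0" if "k < n" for k by (rule unitary_corr_sqnorm_pos[OF ax that])
  have Tdiag: "cmod (?T' r (axis (e r) 1)) = (if r = 2 * n - 2 then ?E (n - 1) else ?E (r div 2))" if "r < 2 * n - 1" for r
  proof -
    have "r div 2 < n" "n - 1 < n" using that by linarith+
    then show ?thesis using E[of "r div 2"] E[of "n - 1"] unfolding unitary_T_derivative[OF T[OF that] order_refl that]
      by (auto simp: norm_mult)
  qed
  have Tprod: "(\<Prod>r<2 * n - 1. cmod (?T' r (axis (e r) 1))) = (\<Prod>k<n - 1. (?E k)\<^sup>2) * ?E (n - 1)"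
  proof -
    have "(\<Prod>r<2 * n - 1. cmod (?T' r (axis (e r) 1)))
       = (\<Prod>r<Suc (2 * (n - 1)). if r = 2 * n - 2 then ?E (n - 1) else ?E (r div 2))"
      using n by (intro prod.cong) (auto simp: Tdiag)
    also have "\<dots> = (\<Prod>r<2 * (n - 1). ?E (r div 2)) * ?E (n - 1)"
      by (simp add: right_diff_distrib')
    finally show ?thesis unfolding prod_halves .
  qed
  define Q G where "Q = (\<Prod>i<n. q_of n e x i)" and "G = gaps n ?z"
  have Q: "Q > 0" unfolding Q_def using d(4) by (intro prod_pos) auto
  have qlast: "q_of n e x (n - 1) > 0" using d(4) n by simp
  have Qsplit: "Q = (\<Prod>i<n - 1. q_of n e x i) * q_of n e x (n - 1)"
  proof -
    have "{..<n} = insert (n - 1) {..<n - 1}" using n by auto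
    then show ?thesis by (simp add: Q_def mult.commute)
  qed
  \<comment> \<open>The relation that eliminates the Vandermonde product.\<close>
  have GQ: "G * Q\<^sup>2 = (\<Prod>k<n. ?E k)"
    using unitary_corr_moments(3)[OF ax] by (simp add: Q_def G_def prod_power_distrib)
  have Esplit: "(\<Prod>k<n. ?E k) = (\<Prod>k<n - 1. ?E k) * ?E (n - 1)"
  proof -
    have "{..<n} = insert (n - 1) {..<n - 1}" using n by auto
    then show ?thesis by (simp add: mult.commute)
  qed
  \<comment> \<open>The factor \<open>(1 / 2) ^ (n - 1)\<close> from passing to real and imaginary
    parts cancels against the \<open>n - 1\<close> factors 2 from the derivatives of
    \<open>q^2\<close>.\<close>
  have detM: "cmod (Determinant.det (Matrix.mat (2 * n - 1) (2 * n - 1)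
       (\<lambda>(r, s). spectral_sum' n e (R r) (R' r) x (axis (e s) 1)))) = G\<^sup>2 * Q\<^sup>2 * (\<Prod>i<n - 1. q_of n e x i)"
  proof -
    have "(\<Prod>j<n. \<bar>sqweight n e x j\<bar> * (cmod (u (vec_nth x (e j))) * cmod (y' (vec_nth x (e j))))) = Q\<^sup>2"
      unfolding Q_def prod_power_distrib by (intro prod.cong) (auto simp: d(7) u_def y'_def norm_mult)
    moreover have "(\<Prod>j<n - 1. 2 * \<bar>vec_nth x (e (n + j))\<bar> * cmod (u (vec_nth x (e j))))
       = (\<Prod>j<n - 1. 2 * q_of n e x j)"
    proof (intro prod.cong refl)
      fix j assume "j \<in> {..<n - 1}"
      then have "j < n - 1" "j < n" by auto
      then show "2 * \<bar>vec_nth x (e (n + j))\<bar> * cmod (u (vec_nth x (e j))) = 2 * q_of n e x j"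
        using d(4)[of j] by (simp add: q_of_def u_def)
    qed
    moreover have "cmod (u (vec_nth x (e (n - 1)))) = 1" by (simp add: u_def)
    moreover have "cmod (Determinant.det (Matrix.mat (2 * n - 1) (2 * n - 1)
         (\<lambda>(r, s). spectral_sum' n e (R r) (R' r) x (axis (e s) 1))))
       = (1 / 2) ^ (n - 1) * (gaps n (\<lambda>j. y (vec_nth x (e j))))\<^sup>2
         * ((\<Prod>j<n. \<bar>sqweight n e x j\<bar> * (cmod (u (vec_nth x (e j))) * cmod (y' (vec_nth x (e j)))))
         * (\<Prod>j<n - 1. 2 * \<bar>vec_nth x (e (n + j))\<bar> * cmod (u (vec_nth x (e j)))) * cmod (u (vec_nth x (e (n - 1)))))"
      unfolding R_def[abs_def] R'_def[abs_def] det_trig_poly[OF n, symmetric] by (rule ds2)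
    ultimately have "cmod (Determinant.det (Matrix.mat (2 * n - 1) (2 * n - 1)
         (\<lambda>(r, s). spectral_sum' n e (R r) (R' r) x (axis (e s) 1))))
       = (1 / 2) ^ (n - 1) * G\<^sup>2 * (Q\<^sup>2 * (\<Prod>j<n - 1. 2 * q_of n e x j) * 1)"
      by (simp only: G_def y_def)
    also have "\<dots> = G\<^sup>2 * Q\<^sup>2 * (\<Prod>i<n - 1. q_of n e x i)"
      by (simp add: prod.distrib power_divide)
    finally show ?thesis .
  qed
  show ?thesis
  proof (rule has_jacobian_atI[where R = "unitary_corr n e" and U = "U1 \<inter> U2 \<inter> U3" and D = D and F = ?F
        and T = unitary_T and M = "\<lambda>r. spectral_sum n e (R r)" and T' = ?T'
        and M' = "\<lambda>r. spectral_sum' n e (R r) (R' r) x", OF e ax U xU Dopen aD])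
    show "?F differentiable (at z)" if "z \<in> U1 \<inter> U2 \<inter> U3" for z
      by (rule unitary_inverse_differentiable[OF valid(4)[OF that]])
    show "b = ?F z" if "z \<in> U1 \<inter> U2 \<inter> U3" "b \<in> D" "unitary_corr n e b z" for z b
      using that by (intro unitary_corr_imp_inverse[OF ax]) (auto simp: U3_def D_def)
    show "unitary_corr n e (?F z) z" if "z \<in> U1 \<inter> U2 \<inter> U3" "?F z \<in> D" for z
      using valid[OF that(1)] that(2) by (intro unitary_inverse_corr[OF ax]) (auto simp: D_def)
    show "z = z'" if z: "z \<in> U1 \<inter> U2 \<inter> U3" "z' \<in> U1 \<inter> U2 \<inter> U3"
      and b: "unitary_corr n e b z" "unitary_corr n e b z'" for z z' b
    proof (rule spectral_data_inj[OF e n \<delta>(2), where t = "\<lambda>j. vec_nth x (e j)"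
          and w = "\<lambda>y. sqrt (hessenberg_params.wt n (P b) y)"])
      note dz = unitary_corrD[OF b(1)] and dz' = unitary_corrD[OF b(2)]
      show "cis (vec_nth z (e j)) \<in> (\<lambda>i. cis (vec_nth z' (e i))) ` {..<n}" if "j < n" for j
        using dz(5) dz'(5) that unfolding bij_betw_def by blast
      show "q_of n e z j = sqrt (hessenberg_params.wt n (P b) (cis (vec_nth z (e j))))" if "j < n" for j
        using dz(4)[OF that] dz(6)[OF that] dz(7)[OF that] by (metis less_imp_le real_sqrt_abs abs_of_pos)
      show "q_of n e z' j = sqrt (hessenberg_params.wt n (P b) (cis (vec_nth z' (e j))))" if "j < n" for j
        using dz'(4)[OF that] dz'(6)[OF that] dz'(7)[OF that] by (metis less_imp_le real_sqrt_abs abs_of_pos)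
    qed (use z in \<open>auto simp: U1_def\<close>)
    show "(spectral_sum n e (R r) has_derivative spectral_sum' n e (R r) (R' r) x) (at x)" for r
      by (rule spectral_sum_has_derivative) (rule ds1)
    show "spectral_sum n e (R r) z = unitary_T r b" if r: "r < 2 * n - 1" and b: "unitary_corr n e b z" for r z b
    proof -
      have Rr: "R r = (\<lambda>t. if r < 2 * n - 2 then
         if even r then complex_of_real (Re (cis t ^ Suc (r div 2))) else complex_of_real (Im (cis t ^ Suc (r div 2)))
         else cis t ^ n)"
        unfolding R_def[abs_def] u_def y_def using trig_poly_value[OF n, of r] r by (auto simp: fun_eq_iff)
      have "Suc (r div 2) \<le> n" using r by linarith
      then show ?thesis
        using unitary_corr_moments(1)[OF b, of "Suc (r div 2)"] unitary_corr_moments(1)[OF b, of n]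
        unfolding Rr unitary_T_def
        by (cases "r < 2 * n - 2"; cases "even r") (simp_all only: if_True if_False spectral_sum_Re spectral_sum_Im order_refl simp_thms)
    qed
    show "?T' r (axis (e s) 1) = 0" if "r < s" "s < 2 * n - 1" for r s
      using unitary_T_derivative[OF T, of r s] that by simp
    show "(\<Prod>r<2 * n - 1. cmod (?T' r (axis (e r) 1))) \<noteq> 0"
    proof -
      have "?E k \<noteq> 0" if "k < n" for k using E[OF that] by simp
      then show ?thesis unfolding Tprod using n by auto
    qed
    show "(\<Prod>i<n - 1. 1 - (cmod (P a i))\<^sup>2) / (q_of n e x (n - 1) * (\<Prod>i<n. q_of n e x i))
      = cmod (Determinant.det (Matrix.mat (2 * n - 1) (2 * n - 1)
          (\<lambda>(r, s). spectral_sum' n e (R r) (R' r) x (axis (e s) 1))))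
        / (\<Prod>r<2 * n - 1. cmod (?T' r (axis (e r) 1)))"
    proof -
      define E0 where "E0 = (\<Prod>k<n - 1. ?E k)"
      have E0: "E0 > 0" unfolding E0_def using E by (intro prod_pos) auto
      have En: "?E (n - 1) > 0" using E n by simp
      have "G = E0 * ?E (n - 1) / Q\<^sup>2" using GQ Q by (simp add: Esplit E0_def field_simps)
      moreover have "(\<Prod>i<n - 1. q_of n e x i) = Q / q_of n e x (n - 1)" using Qsplit qlast by simp
      moreover have "(\<Prod>k<n - 1. (?E k)\<^sup>2) = E0\<^sup>2" by (simp add: E0_def prod_power_distrib)
      moreover have "(\<Prod>i<n - 1. 1 - (cmod (P a i))\<^sup>2) = ?E (n - 1)" by (simp add: sqnorm_def)
      ultimately show ?thesis
        unfolding detM Tprod Q_def[symmetric] using Q E0 En qlast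
        by (simp add: power2_eq_square field_simps)
    qed
  qed (use T in auto)
qed

end

section \<open>The orthogonal case\<close>

lemma sum_lessThan_add:
  fixes f :: "nat \<Rightarrow> 'a::comm_monoid_add"
  shows "sum f {..<a + b} = sum f {..<a} + (\<Sum>i<b. f (a + i))"
  by (induction b) (simp_all add: add.assoc)

text \<open>The product of the two differences is \<open>cis a\<close> times
  \<open>2 * cos a - 2 * cos b\<close>. This turns node distances on the circle into distances
  between cosines.\<close>

lemma norm_cis_diff_mult:
  "cmod (cis a - cis b) * cmod (cis a - cis (- b)) = 2 * \<bar>cos a - cos b\<bar>"
proof -
  have 1: "cis b + cis (- b) = complex_of_real (2 * cos b)" "cis b * cis (- b) = 1"
    "cis a + cis (- a) = complex_of_real (2 * cos a)" "cis a * cis (- a) = 1"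
    by (simp_all add: complex_eq_iff cis_mult)
  have "(cis a - cis b) * (cis a - cis (- b)) = cis a * cis a - cis a * (cis b + cis (- b)) + cis b * cis (- b)"
    by (simp only: algebra_simps)
  also have "\<dots> = cis a * (cis a + cis (- a) - (cis b + cis (- b)))"
    using 1(2,4) by (simp add: algebra_simps del: cis_mult)
  also have "\<dots> = cis a * complex_of_real (2 * (cos a - cos b))"
    unfolding 1(1,3) by (simp add: algebra_simps)
  finally have "cmod ((cis a - cis b) * (cis a - cis (- b))) = 2 * \<bar>cos a - cos b\<bar>"
    by (simp only: norm_mult norm_cis norm_of_real abs_mult abs_numeral mult_1)
  then show ?thesis by (simp only: norm_mult)
qed

lemma norm_cis_diff_self: "0 < a \<Longrightarrow> a < pi \<Longrightarrow> cmod (cis a - cis (- a)) = 2 * sin a"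
proof -
  assume "0 < a" "a < pi"
  then have "sin a > 0" by (rule sin_gt_zero)
  have "cis a - cis (- a) = \<i> * complex_of_real (2 * sin a)" by (simp add: complex_eq_iff)
  then show ?thesis using \<open>sin a > 0\<close> by (simp add: norm_mult)
qed

definition paired :: "nat \<Rightarrow> (nat \<Rightarrow> real) \<Rightarrow> nat \<Rightarrow> complex" where
  "paired n t j = (if j < n then cis (t j) else cis (- t (j - n)))"

lemma paired_simps [simp]: "j < n \<Longrightarrow> paired n t j = cis (t j)" "paired n t (n + j) = cis (- t j)"
  by (simp_all add: paired_def)

lemma paired_image: "paired n t ` {..<2 * n} = (\<lambda>j. cis (t j)) ` {..<n} \<union> (\<lambda>j. cis (- t j)) ` {..<n}"
proof -
  have "{..<2 * n} = {..<n} \<union> (\<lambda>j. n + j) ` {..<n}"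
  proof (intro equalityI subsetI)
    fix x assume "x \<in> {..<2 * n}"
    then show "x \<in> {..<n} \<union> (\<lambda>j. n + j) ` {..<n}"
      by (cases "x < n") (auto intro!: image_eqI[of _ _ "x - n"])
  qed auto
  moreover have "paired n t ` {..<n} = (\<lambda>j. cis (t j)) ` {..<n}" by (rule image_cong) auto
  ultimately show ?thesis by (simp add: image_Un image_image)
qed

lemma inj_paired:
  assumes t: "\<And>j. j < n \<Longrightarrow> 0 < t j \<and> t j < pi" and inj: "inj_on t {..<n}"
  shows "inj_on (paired n t) {..<2 * n}"
proof -
  have sin: "sin (t j) > 0" if "j < n" for j using t[OF that] by (auto intro: sin_gt_zero)
  have eq: "i = j" if "cis (t i) = cis (t j)" "i < n" "j < n" for i j
  proof -
    have "\<bar>t i - t j\<bar> < 2 * pi" using t[OF that(2)] t[OF that(3)] by linarith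
    then have "t i = t j" using cis_eq_imp_eq that(1) by blast
    then show ?thesis using inj that by (auto simp: inj_on_def)
  qed
  have ne: "cis (t i) \<noteq> cis (- t j)" if "i < n" "j < n" for i j
    using sin[OF that(1)] sin[OF that(2)] by (auto simp: complex_eq_iff)
  have eq': "i = j" if "cis (- t i) = cis (- t j)" "i < n" "j < n" for i j
    using eq[of i j] that by (auto simp: complex_eq_iff)
  show ?thesis
  proof (rule inj_onI)
    fix i j assume ij: "i \<in> {..<2 * n}" "j \<in> {..<2 * n}" "paired n t i = paired n t j"
    then have "i < n \<or> i - n < n \<and> n \<le> i" "j < n \<or> j - n < n \<and> n \<le> j" by auto
    then show "i = j" using ij(3) eq[of i j] ne[of i "j - n"] ne[of j "i - n"] eq'[of "i - n" "j - n"]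
      by (auto simp: paired_def split: if_splits)
  qed
qed

text \<open>From a node, its own conjugate is at distance \<open>2 * sin\<close>, and each of the
  other \<open>n - 1\<close> conjugate pairs contributes \<open>2 * \<bar>cos - cos\<bar>\<close>: a
  factor \<open>2 ^ n\<close> per node. The square arises since both nodes of a pair give the same
  product.\<close>

lemma gaps_paired:
  assumes t: "\<And>j. j < n \<Longrightarrow> 0 < t j \<and> t j < pi"
  shows "gaps (2 * n) (paired n t) = (2 ^ (n * n) * (\<Prod>j<n. sin (t j)) * gaps n (\<lambda>j. complex_of_real (cos (t j))))\<^sup>2"
proof -
  let ?z = "paired n t"
  define g where "g j = (\<Prod>i\<in>{..<n} - {j}. cmod (complex_of_real (cos (t j)) - complex_of_real (cos (t i))))" for j
  have split: "(\<Prod>i\<in>{..<2 * n} - {j}. f i) = f (n + j) * (\<Prod>i\<in>{..<n} - {j}. f i * f (n + i))"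
    "(\<Prod>i\<in>{..<2 * n} - {n + j}. f i) = f j * (\<Prod>i\<in>{..<n} - {j}. f i * f (n + i))" if "j < n" for j and f :: "nat \<Rightarrow> real"
  proof -
    let ?S = "{..<n} - {j}"
    have S: "(\<Prod>i\<in>?S \<union> (+) n ` ?S. f i) = (\<Prod>i\<in>?S. f i * f (n + i))"
    proof -
      have "(\<Prod>i\<in>?S \<union> (+) n ` ?S. f i) = (\<Prod>i\<in>?S. f i) * (\<Prod>i\<in>(+) n ` ?S. f i)"
        by (rule prod.union_disjoint) auto
      also have "(\<Prod>i\<in>(+) n ` ?S. f i) = (\<Prod>i\<in>?S. f (n + i))"
        by (subst prod.reindex) auto
      finally show ?thesis by (simp add: prod.distrib)
    qed
    have m: "x \<in> (+) n ` A \<longleftrightarrow> n \<le> x \<and> x - n \<in> A" for x A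
    proof
      assume "n \<le> x \<and> x - n \<in> A"
      then show "x \<in> (+) n ` A" by (intro image_eqI[of _ _ "x - n"]) auto
    qed auto
    have 1: "{..<2 * n} - {j} = insert (n + j) (?S \<union> (+) n ` ?S)"
      using that by (auto simp: m)
    have 2: "{..<2 * n} - {n + j} = insert j (?S \<union> (+) n ` ?S)"
      using that by (auto simp: m)
    have "n + j \<notin> ?S \<union> (+) n ` ?S" "j \<notin> ?S \<union> (+) n ` ?S" using that by (auto simp: m)
    then show "(\<Prod>i\<in>{..<2 * n} - {j}. f i) = f (n + j) * (\<Prod>i\<in>{..<n} - {j}. f i * f (n + i))"
      "(\<Prod>i\<in>{..<2 * n} - {n + j}. f i) = f j * (\<Prod>i\<in>{..<n} - {j}. f i * f (n + i))"
      unfolding 1 2 by (simp_all only: prod.insert finite_Un finite_imageI finite_Diff finite_lessThan S simp_thms)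
  qed
  have pw: "(2::real) * 2 ^ (n - 1) = 2 ^ n" if "j < n" for j
    using that by (cases n) auto
  have A: "(\<Prod>i\<in>{..<2 * n} - {j}. cmod (?z j - ?z i)) = 2 ^ n * sin (t j) * g j" if j: "j < n" for j
  proof -
    have "(\<Prod>i\<in>{..<n} - {j}. cmod (?z j - ?z i) * cmod (?z j - ?z (n + i))) =
       (\<Prod>i\<in>{..<n} - {j}. 2 * cmod (complex_of_real (cos (t j)) - complex_of_real (cos (t i))))"
      using j by (intro prod.cong) (auto simp: norm_cis_diff_mult simp flip: of_real_diff)
    also have "\<dots> = 2 ^ (n - 1) * g j" using j by (simp add: prod.distrib g_def)
    finally show ?thesis
      unfolding split(1)[OF j] using j t[OF j] pw[OF j] by (simp add: norm_cis_diff_self)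
  qed
  have B: "(\<Prod>i\<in>{..<2 * n} - {n + j}. cmod (?z (n + j) - ?z i)) = 2 ^ n * sin (t j) * g j" if j: "j < n" for j
  proof -
    have "(\<Prod>i\<in>{..<n} - {j}. cmod (?z (n + j) - ?z i) * cmod (?z (n + j) - ?z (n + i))) =
       (\<Prod>i\<in>{..<n} - {j}. 2 * cmod (complex_of_real (cos (t j)) - complex_of_real (cos (t i))))"
      using j norm_cis_diff_mult[of "- t j"] by (intro prod.cong) (auto simp flip: of_real_diff)
    also have "\<dots> = 2 ^ (n - 1) * g j" using j by (simp add: prod.distrib g_def)
    finally show ?thesis
      unfolding split(2)[OF j] using j t[OF j] pw[OF j] norm_cis_diff_self[of "t j"]
      by (simp add: norm_minus_commute)
  qed
  have "gaps (2 * n) ?z = (\<Prod>j<n + n. \<Prod>i\<in>{..<2 * n} - {j}. cmod (?z j - ?z i))"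
    by (simp add: gaps_def mult_2)
  also have "\<dots> = (\<Prod>j<n. 2 ^ n * sin (t j) * g j) * (\<Prod>j<n. 2 ^ n * sin (t j) * g j)"
    unfolding prod_lessThan_add using A B by (simp cong: prod.cong_simp)
  also have "(\<Prod>j<n. 2 ^ n * sin (t j) * g j) = 2 ^ (n * n) * (\<Prod>j<n. sin (t j)) * gaps n (\<lambda>j. complex_of_real (cos (t j)))"
    by (simp add: prod.distrib gaps_def g_def power_mult)
  finally show ?thesis by (simp add: power2_eq_square)
qed

section \<open>Conjugate pairs of nodes, the map to real parameters and its Jacobian, orthogonal
  case\<close>

context jacobian_coords
begin

abbreviation Po :: "real ^ 'd \<Rightarrow> nat \<Rightarrow> complex" where
  "Po a \<equiv> \<lambda>j. complex_of_real (orthogonal_params n e a j)"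

abbreviation Co :: "real ^ 'd \<Rightarrow> nat \<Rightarrow> complex" where
  "Co x k \<equiv> spectral_sum n e (\<lambda>t. complex_of_real (cos (real k * t))) x"

abbreviation node :: "real ^ 'd \<Rightarrow> nat \<Rightarrow> complex" where
  "node x \<equiv> paired n (\<lambda>j. vec_nth x (e j))"

text \<open>Each conjugate pair shares the weight \<open>q j ^ 2\<close> equally; indices from
  \<open>n\<close> on denote the conjugate nodes, as in \<open>paired\<close>.\<close>

definition halfweight :: "real ^ 'd \<Rightarrow> nat \<Rightarrow> real" where
  "halfweight x j = sqweight n e x (if j < n then j else j - n) / 2"

lemma two_n: "2 * n = n + n" by simp

lemma node_moments: "(\<Sum>j<2 * n. complex_of_real (halfweight x j) * node x j ^ k) = Co x k"
proof -
  have c: "cis s ^ k + cis (- s) ^ k = complex_of_real (2 * cos (real k * s))" for s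
    by (simp add: Complex.DeMoivre complex_eq_iff)
  have "(\<Sum>j<2 * n. complex_of_real (halfweight x j) * node x j ^ k)
     = (\<Sum>j<n. complex_of_real (sqweight n e x j / 2) * (cis (vec_nth x (e j)) ^ k + cis (- vec_nth x (e j)) ^ k))"
    unfolding two_n sum_lessThan_add by (simp add: halfweight_def sum.distrib distrib_left del: of_real_divide)
  also have "\<dots> = Co x k" unfolding c spectral_sum_def by (intro sum.cong) simp_all
  finally show ?thesis .
qed

text \<open>Conjugate symmetry makes the product automatically compatible with the last parameter
  -1, so no phase coordinate is left over.\<close>

lemma node_prod: "(\<Prod>j<2 * n. - node x j) = 1"
  unfolding two_n prod_lessThan_add by (simp add: cis_mult flip: prod.distrib)

lemma orthogonal_hessenberg_params:
  "a \<in> orthogonal_domain n e \<Longrightarrow> hessenberg_params (2 * n) (Po a)"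
  using n by unfold_locales (auto simp: orthogonal_domain_def abs_less_iff, auto simp: orthogonal_params_def)

lemma orthogonal_corrD:
  assumes "orthogonal_corr n e a x"
  shows "a \<in> orthogonal_domain n e"
    and "strict_mono_on {..<n} (angle_of e x)" and "\<And>j. j < n \<Longrightarrow> 0 < vec_nth x (e j) \<and> vec_nth x (e j) < pi"
    and "\<And>j. j < n \<Longrightarrow> q_of n e x j > 0"
    and "bij_betw (node x) {..<2 * n} (hessenberg_params.roots (2 * n) (Po a))"
    and "\<And>j. j < 2 * n \<Longrightarrow> halfweight x j = hessenberg_params.wt (2 * n) (Po a) (node x j)"
    and "\<And>j. j < n \<Longrightarrow> sqweight n e x j = (q_of n e x j)\<^sup>2"
proof -
  show a: "a \<in> orthogonal_domain n e" using assms by (simp add: orthogonal_corr_def)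
  interpret h: hessenberg_params "2 * n" "Po a" by (rule orthogonal_hessenberg_params[OF a])
  note s = assms[unfolded orthogonal_corr_def orthogonal_spectral_data_def h.eigenvalue_roots h.eigen_weight_iff]
  show "strict_mono_on {..<n} (angle_of e x)" using s by auto
  show "0 < vec_nth x (e j) \<and> vec_nth x (e j) < pi" if "j < n" for j using s that by (auto simp: angle_of_def)
  show q: "q_of n e x j > 0" if "j < n" for j using s that by auto
  show "bij_betw (node x) {..<2 * n} h.roots"
    by (rule h.bij_betw_roots) (use s in \<open>simp add: paired_image angle_of_def\<close>)
  show w: "sqweight n e x j = (q_of n e x j)\<^sup>2" if "j < n" for j
    using sqweight_eq_q_of[OF n that] q[of "n - 1"] n by simp
  have s': "\<And>j. j < n \<Longrightarrow> (q_of n e x j)\<^sup>2 / 2 = h.wt (cis (vec_nth x (e j))) \<and> (q_of n e x j)\<^sup>2 / 2 = h.wt (cis (- vec_nth x (e j)))"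
    using s by (auto simp: angle_of_def)
  show "halfweight x j = h.wt (node x j)" if "j < 2 * n" for j
  proof (cases "j < n")
    case True
    then show ?thesis using s'[OF True] w[OF True] by (simp add: halfweight_def)
  next
    case False
    then have "j - n < n" using that by simp
    then show ?thesis using False s'[of "j - n"] w[of "j - n"] by (simp add: halfweight_def paired_def)
  qed
qed

lemma orthogonal_corrI:
  assumes a: "a \<in> orthogonal_domain n e"
    and mono: "strict_mono_on {..<n} (angle_of e x)" and range: "\<And>j. j < n \<Longrightarrow> 0 < vec_nth x (e j) \<and> vec_nth x (e j) < pi"
    and q: "\<And>j. j < n \<Longrightarrow> q_of n e x j > 0"
    and mo: "\<And>k. k < 2 * n \<Longrightarrow> Co x k = moment (Po a) k"
  shows "orthogonal_corr n e a x"
proof -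
  interpret h: hessenberg_params "2 * n" "Po a" by (rule orthogonal_hessenberg_params[OF a])
  have "inj_on (\<lambda>j. vec_nth x (e j)) {..<n}"
    using strict_mono_on_imp_inj_on[OF mono] by (simp add: angle_of_def[abs_def])
  then have inj: "inj_on (node x) {..<2 * n}" using range by (intro inj_paired) auto
  have uni: "\<And>j. j < 2 * n \<Longrightarrow> cmod (node x j) = 1" by (simp add: paired_def)
  have mo': "\<And>k. k < 2 * n \<Longrightarrow> (\<Sum>j<2 * n. complex_of_real (halfweight x j) * node x j ^ k) = moment (Po a) k"
    unfolding node_moments by (rule mo)
  have pr: "(\<Prod>j<2 * n. - node x j) = - cnj (Po a (2 * n - 1))"
    unfolding node_prod by (simp add: orthogonal_params_def)
  note r = h.roots_from_moments[OF inj uni mo' pr]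
  have w: "sqweight n e x j = (q_of n e x j)\<^sup>2" if "j < n" for j
    using sqweight_eq_q_of[OF n that] q[of "n - 1"] n by simp
  have "(q_of n e x j)\<^sup>2 / 2 = h.wt (cis (vec_nth x (e j)))" "(q_of n e x j)\<^sup>2 / 2 = h.wt (cis (- vec_nth x (e j)))" if "j < n" for j
    using r(2)[of j] r(2)[of "n + j"] w[OF that] that by (simp_all add: halfweight_def)
  then show ?thesis
    unfolding orthogonal_corr_def orthogonal_spectral_data_def h.eigenvalue_roots h.eigen_weight_iff
    using a mono range q r(1) by (auto simp: angle_of_def paired_image)
qed

lemma orthogonal_corr_moments:
  assumes "orthogonal_corr n e a x"
  shows "k \<le> 2 * n \<Longrightarrow> Co x k = moment (Po a) k"
    and "gaps (2 * n) (node x) * (\<Prod>j<2 * n. halfweight x j) = (\<Prod>k<2 * n. sqnorm (Po a) k)"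
proof -
  note d = orthogonal_corrD[OF assms]
  interpret h: hessenberg_params "2 * n" "Po a" by (rule orthogonal_hessenberg_params[OF d(1)])
  note m = h.indexed_moments[OF d(5,6)]
  show "k \<le> 2 * n \<Longrightarrow> Co x k = moment (Po a) k" using m(1) by (simp add: node_moments)
  show "gaps (2 * n) (node x) * (\<Prod>j<2 * n. halfweight x j) = (\<Prod>k<2 * n. sqnorm (Po a) k)"
    by (rule m(3))
qed

text \<open>The factor with index \<open>2 * n - 1\<close> equals 2 at both points: the parameter is
  -1 and its index is odd.\<close>

lemma orthogonal_Phi_at_one:
  assumes "a \<in> orthogonal_domain n e"
  shows "poly (Phi (Po a) (2 * n)) 1 = complex_of_real (2 * (\<Prod>l<2 * n - 1. 1 - orthogonal_params n e a l))"
    and "poly (Phi (Po a) (2 * n)) (- 1) = complex_of_real (2 * (\<Prod>l<2 * n - 1. 1 + (- 1) ^ l * orthogonal_params n e a l))"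
proof -
  have s: "{..<2 * n} = insert (2 * n - 1) {..<2 * n - 1}" using n by auto
  have l: "orthogonal_params n e a (2 * n - 1) = - 1" by (simp add: orthogonal_params_def)
  have o: "odd (2 * n - 1)" using n by simp
  have "poly (Phi (Po a) (2 * n)) 1 = (\<Prod>l<2 * n. 1 - Po a l)"
    using poly_Phi_one[of "2 * n" "Po a"] by simp
  also have "\<dots> = 2 * (\<Prod>l<2 * n - 1. 1 - Po a l)" unfolding s by (simp add: l del: One_nat_def)
  finally show "poly (Phi (Po a) (2 * n)) 1 = complex_of_real (2 * (\<Prod>l<2 * n - 1. 1 - orthogonal_params n e a l))"
    by simp
  have "poly (Phi (Po a) (2 * n)) (- 1) = (\<Prod>l<2 * n. 1 + (- 1) ^ l * Po a l)"
    using poly_Phi_minus_one[of "2 * n" "Po a"] by simp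
  also have "\<dots> = 2 * (\<Prod>l<2 * n - 1. 1 + (- 1) ^ l * Po a l)" unfolding s using o by (simp add: l del: One_nat_def)
  finally show "poly (Phi (Po a) (2 * n)) (- 1) = complex_of_real (2 * (\<Prod>l<2 * n - 1. 1 + (- 1) ^ l * orthogonal_params n e a l))"
    by simp
qed

lemma orthogonal_factor_pos:
  assumes "a \<in> orthogonal_domain n e" "l < 2 * n - 1"
  shows "1 - orthogonal_params n e a l > 0" "1 + (- 1) ^ l * orthogonal_params n e a l > 0"
  using assms by (auto simp: orthogonal_domain_def minus_one_power_iff)

text \<open>The values of the characteristic polynomial at 1 and -1 are positive, so no eigenvalue
  is real. The eigenvalues are closed under conjugation, with equal weights, hence exactly
  \<open>n\<close> lie in the upper half plane; their arguments are sorted.\<close>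

lemma ex_orthogonal_corr:
  assumes a: "a \<in> orthogonal_domain n e"
  shows "\<exists>x. orthogonal_corr n e a x"
proof -
  interpret h: hessenberg_params "2 * n" "Po a" by (rule orthogonal_hessenberg_params[OF a])
  have one: "1 \<notin> h.roots" "- 1 \<notin> h.roots"
  proof -
    have "(\<Prod>l<2 * n - 1. 1 - orthogonal_params n e a l) > 0" "(\<Prod>l<2 * n - 1. 1 + (- 1) ^ l * orthogonal_params n e a l) > 0"
      using orthogonal_factor_pos[OF a] by (auto intro!: prod_pos)
    then have "2 * (\<Prod>l<2 * n - 1. 1 - orthogonal_params n e a l) \<noteq> 0"
      "2 * (\<Prod>l<2 * n - 1. 1 + (- 1) ^ l * orthogonal_params n e a l) \<noteq> 0" by linarith+
    then show "1 \<notin> h.roots" "- 1 \<notin> h.roots"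
      unfolding h.roots_def mem_Collect_eq orthogonal_Phi_at_one[OF a] of_real_eq_0_iff by blast+
  qed
  have phi_cnj: "h.phi j (cnj z) = cnj (h.phi j z)" for j z
    using poly_Phi_real[of j "Po a" z] by (simp add: h.phi_def)
  have cnj_roots: "cnj z \<in> h.roots" if "z \<in> h.roots" for z
    using poly_Phi_real[of "2 * n" "Po a" z] that by (simp add: h.roots_def)
  have cnj_wt: "h.wt (cnj z) = h.wt z" for z by (simp add: h.wt_def phi_cnj)
  define A where "A = {z \<in> h.roots. Im z > 0}"
  have Im0: "Im z \<noteq> 0" if "z \<in> h.roots" for z
  proof
    assume "Im z = 0"
    then have "z = complex_of_real (Re z)" by (simp add: complex_eq_iff)
    moreover from this have "\<bar>Re z\<bar> = 1" using h.roots_unimodular[OF that] by (metis norm_of_real)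
    ultimately have "z = 1 \<or> z = - 1" by (metis abs_eq_iff abs_1 of_real_1 of_real_minus)
    then show False using one that by auto
  qed
  have roots: "h.roots = A \<union> cnj ` A"
  proof -
    have "z \<in> A \<union> cnj ` A" if "z \<in> h.roots" for z
    proof (cases "Im z > 0")
      case False
      with Im0[OF that] have "cnj z \<in> A" using cnj_roots[OF that] by (simp add: A_def)
      then show ?thesis by (metis UnI2 complex_cnj_cnj imageI)
    qed (use that in \<open>auto simp: A_def\<close>)
    then show ?thesis using cnj_roots by (auto simp: A_def)
  qed
  have finA: "finite A" by (simp add: A_def)
  have disj: "A \<inter> cnj ` A = {}" by (auto simp: A_def)
  have injc: "inj_on cnj A" by (auto simp: inj_on_def)
  have "2 * n = card A + card (cnj ` A)"
    using h.card_roots card_Un_disjoint[of A "cnj ` A"] finA disj roots by simp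
  then have cardA: "card A = n" using card_image[OF injc] by simp
  have cA: "cis (Arg z) = z" if "z \<in> A" for z
  proof -
    have "cmod z = 1" using that h.roots_unimodular by (simp add: A_def)
    then show ?thesis using cis_Arg[of z] by (cases "z = 0") (simp_all add: sgn_eq)
  qed
  have inj: "inj_on Arg A" using cA by (metis inj_onI)
  obtain \<theta> where t: "bij_betw \<theta> {..<n} (Arg ` A)" "strict_mono_on {..<n} \<theta>"
    using ex_strict_mono_enumeration[of "Arg ` A"] card_image[OF inj] cardA finA by auto
  have tA: "cis (\<theta> j) \<in> A" if "j < n" for j
  proof -
    have "\<theta> j \<in> Arg ` A" using t(1) that by (auto simp: bij_betw_def)
    then show ?thesis using cA by auto
  qed
  have range: "0 < \<theta> j \<and> \<theta> j < pi" if "j < n" for j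
  proof -
    have "\<theta> j \<in> Arg ` A" using t(1) that by (auto simp: bij_betw_def)
    then obtain z where "\<theta> j = Arg z" by auto
    then have b: "- pi < \<theta> j" "\<theta> j \<le> pi" using Arg_bounded by auto
    have s: "sin (\<theta> j) > 0" using tA[OF that] by (simp add: A_def)
    have "\<theta> j \<noteq> pi" using s by auto
    moreover have "0 < \<theta> j"
    proof (rule ccontr)
      assume "\<not> 0 < \<theta> j"
      then have "sin (- \<theta> j) \<ge> 0" using b by (intro sin_ge_zero) auto
      then show False using s by simp
    qed
    ultimately show ?thesis using b by simp
  qed
  have imA: "(\<lambda>j. cis (\<theta> j)) ` {..<n} = A"
  proof -
    have "(\<lambda>j. cis (\<theta> j)) ` {..<n} = cis ` Arg ` A"
      using t(1) by (metis bij_betw_imp_surj_on image_image)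
    also have "\<dots> = A" using cA by (force simp: image_iff)
    finally show ?thesis .
  qed
  have imc: "(\<lambda>j. cis (- \<theta> j)) ` {..<n} = cnj ` A"
    unfolding imA[symmetric] image_image by (simp add: cis_cnj)
  have bijA: "bij_betw (\<lambda>j. cis (\<theta> j)) {..<n} A"
    using imA cardA by (auto simp: bij_betw_def intro!: eq_card_imp_inj_on)
  define q where "q j = sqrt (2 * h.wt (cis (\<theta> j)))" for j
  have q: "q j > 0" "(q j)\<^sup>2 = 2 * h.wt (cis (\<theta> j))" for j
    using h.wt_pos[of "cis (\<theta> j)"] by (simp_all add: q_def)
  have "(\<Sum>j<n. (q j)\<^sup>2) = 2 * (\<Sum>z\<in>A. h.wt z)"
    unfolding q(2) sum_distrib_left[symmetric] using sum.reindex_bij_betw[OF bijA] by metis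
  also have "\<dots> = (\<Sum>z\<in>h.roots. h.wt z)"
    unfolding roots by (subst sum.union_disjoint) (use finA disj in \<open>auto simp: sum.reindex[OF injc] cnj_wt\<close>)
  finally have "(\<Sum>j<n. (q j)\<^sup>2) = 1" using h.sum_wt by simp
  then obtain x where x: "\<forall>j<n. angle_of e x j = \<theta> j" "\<forall>j<n. q_of n e x j = q j"
    using ex_spectral_coordinates[OF e n, where q = q and \<theta> = \<theta>] q(1) by blast
  have im': "(\<lambda>j. cis (angle_of e x j)) ` {..<n} \<union> (\<lambda>j. cis (- angle_of e x j)) ` {..<n} = h.roots"
    using imA imc x(1) roots by simp
  have sm: "strict_mono_on {..<n} (angle_of e x)"
    using t(2) x(1) by (auto simp: strict_mono_on_def)
  have w: "h.wt (cis (- \<theta> j)) = h.wt (cis (\<theta> j))" for j using cnj_wt[of "cis (\<theta> j)"] by (simp add: cis_cnj)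
  have "orthogonal_corr n e a x"
    unfolding orthogonal_corr_def orthogonal_spectral_data_def h.eigenvalue_roots h.eigen_weight_iff
    using a sm im' x q w range by auto
  then show ?thesis by blast
qed


lemma cos_has_vector_derivative:
  "((\<lambda>t. complex_of_real (cos (c * t))) has_vector_derivative of_real (- (sin (c * t) * c))) (at t)"
proof -
  have "((\<lambda>t. cos (c * t)) has_derivative (\<lambda>h. h * (- (sin (c * t) * c)))) (at t)"
    by (auto intro!: derivative_eq_intros)
  from has_derivative_of_real[OF this] show ?thesis
    by (simp add: has_vector_derivative_def scaleR_conv_of_real)
qed

lemma Co_differentiable: "(\<lambda>x. Co x k) differentiable (at p)"
  using spectral_sum_differentiable[OF cos_has_vector_derivative] .

lemma Co_0: "Co x 0 = 1"
  using sum_sqweight[OF n, of e x] by (simp add: spectral_sum_def flip: of_real_sum)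

lemma Co_real: "Co x k \<in> \<real>"
  unfolding spectral_sum_def by (intro sum_in_Reals Reals_mult) auto

lemma orthogonal_corr_sqnorm_pos:
  assumes "orthogonal_corr n e a x" "k < 2 * n"
  shows "sqnorm (Po a) k > 0"
  using hessenberg_params.sqnorm_pos[OF orthogonal_hessenberg_params[OF orthogonal_corrD(1)[OF assms(1)]] assms(2)] .

text \<open>In contrast to the unitary case no base point is involved, as there is no phase to
  choose. Taking real parts loses nothing, because real moments yield real parameters.\<close>

definition orthogonal_inverse :: "real ^ 'd \<Rightarrow> real ^ 'd" where
  "orthogonal_inverse z = (\<chi> d. Re (verblunsky (Co z) (idx d)))"

lemma orthogonal_inverse_nth: "i < 2 * n - 1 \<Longrightarrow> vec_nth (orthogonal_inverse z) (e i) = Re (verblunsky (Co z) i)"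
  by (simp add: orthogonal_inverse_def idx_e)

lemma orthogonal_params_inverse: "j < 2 * n - 1 \<Longrightarrow> Po (orthogonal_inverse z) j = verblunsky (Co z) j"
  using verblunsky_real[of j "Co z"] Co_real by (simp add: orthogonal_params_def orthogonal_inverse_nth of_real_Re)

lemma orthogonal_inverse_differentiable:
  assumes "\<forall>l<2 * n - 1. cmod (verblunsky (Co z) l) < 1"
  shows "orthogonal_inverse differentiable (at z)"
  unfolding differentiable_vec_nth_iff
proof
  fix d
  obtain i where i: "i < 2 * n - 1" "d = e i" using e by (metis UNIV_I bij_betw_def imageE lessThan_iff)
  have "(\<lambda>z. verblunsky (Co z) i) differentiable (at z)"
  proof (rule verblunsky_differentiable)
    show "sqnorm (verblunsky (Co z)) l \<noteq> 0" if "l \<le> i" for l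
      using sqnorm_pos_of_less[of l "verblunsky (Co z)"] assms that i by force
  qed (rule Co_differentiable)
  then show "(\<lambda>z. vec_nth (orthogonal_inverse z) d) differentiable (at z)"
    unfolding i(2) orthogonal_inverse_nth[OF i(1)] by (rule Re_differentiable)
qed

lemma orthogonal_corr_imp_inverse:
  assumes bz: "orthogonal_corr n e b z"
  shows "b = orthogonal_inverse z"
proof (rule vec_eqI_coords)
  fix i assume i: "i < 2 * n - 1"
  note mb = orthogonal_corr_moments[OF bz]
  have "verblunsky (Co z) i = Po b i"
  proof (rule verblunsky_of_moments[of "2 * n - 1", OF _ _ i])
    show "Co z k = moment (Po b) k" if "k \<le> 2 * n - 1" for k using mb(1) that by simp
    show "sqnorm (Po b) k \<noteq> 0" if "k < 2 * n - 1" for k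
    proof -
      have "k < 2 * n" using that by linarith
      then show ?thesis using orthogonal_corr_sqnorm_pos[OF bz, of k] by simp
    qed
  qed
  then show "vec_nth b (e i) = vec_nth (orthogonal_inverse z) (e i)"
    using i by (simp add: orthogonal_inverse_nth orthogonal_params_def)
qed

lemma orthogonal_inverse_corr:
  assumes dom: "orthogonal_inverse z \<in> orthogonal_domain n e"
    and mono: "strict_mono_on {..<n} (angle_of e z)" "\<And>j. j < n \<Longrightarrow> 0 < vec_nth z (e j) \<and> vec_nth z (e j) < pi"
    and q: "\<And>j. j < n \<Longrightarrow> q_of n e z j > 0"
    and v: "\<forall>l<2 * n - 1. cmod (verblunsky (Co z) l) < 1"
  shows "orthogonal_corr n e (orthogonal_inverse z) z"
proof (rule orthogonal_corrI[OF dom mono q])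
  fix k assume k: "k < 2 * n"
  have "moment (Po (orthogonal_inverse z)) k = moment (verblunsky (Co z)) k"
    using k by (intro moment_cong orthogonal_params_inverse) linarith
  also have "\<dots> = Co z k"
  proof (rule moments_of_verblunsky[of _ "2 * n - 1"])
    show "sqnorm (verblunsky (Co z)) l \<noteq> 0" if "l < 2 * n - 1" for l
      using sqnorm_pos_of_less[of l "verblunsky (Co z)"] v that by force
  qed (use k Co_0 in auto)
  finally show "Co z k = moment (Po (orthogonal_inverse z)) k" ..
qed

lemma open_orthogonal_domain: "open (orthogonal_domain n e)"
proof -
  have "open {b. - 1 < orthogonal_params n e b j \<and> orthogonal_params n e b j < 1}" if "j < 2 * n - 1" for j
    using that unfolding orthogonal_params_def
    by simp (intro open_Collect_conj open_Collect_less continuous_intros)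
  then show ?thesis unfolding orthogonal_domain_def by (rule open_Collect_all_less)
qed

lemma orthogonal_moment_differentiable:
  "(\<lambda>b. moment (Po b) k) differentiable (at a)"
proof (rule moment_differentiable)
  fix l
  have "(\<lambda>b. orthogonal_params n e b l) differentiable (at a)"
    unfolding orthogonal_params_def using vec_nth_differentiable by (cases "l < 2 * n - 1") auto
  then show "(\<lambda>b. Po b l) differentiable (at a)" by (rule of_real_differentiable)
qed

lemma orthogonal_moment_derivative:
  assumes T: "((\<lambda>b. moment (Po b) (Suc r)) has_derivative T') (at a)" and r: "r \<le> s" and s: "s < 2 * n - 1"
  shows "T' (axis (e s) 1) = (if r = s then complex_of_real (sqnorm (Po a) r) else 0)"
proof (rule derivative_along[OF T])
  let ?a = "\<lambda>t. a + t *\<^sub>R axis (e s) 1"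
  have line: "Po (?a t) l = Po a l + (if l = s then of_real t else 0)" if "l < 2 * n - 1" for l t
    using axis_nth[OF that s] that by (simp add: orthogonal_params_def)
  have "moment (Po (?a t)) (Suc r) = moment (Po a) (Suc r) + (cnj (Po (?a t) r) - cnj (Po a r)) * complex_of_real (sqnorm (Po a) r)" for t
  proof (rule moment_change)
    fix l assume "l < r"
    then have "l < 2 * n - 1" "l \<noteq> s" using r s by linarith+
    then show "Po (?a t) l = Po a l" using line[of l t] by simp
  qed
  moreover have "r < 2 * n - 1" using r s by simp
  note lr = line[OF this]
  have "cnj (Po (?a t) r) - cnj (Po a r) = (if r = s then of_real t else 0)" for t
    unfolding lr by simp
  ultimately have "moment (Po (?a t)) (Suc r) = moment (Po a) (Suc r) + t *\<^sub>R (if r = s then complex_of_real (sqnorm (Po a) r) else 0)" for t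
    by (simp add: scaleR_conv_of_real)
  then show "((\<lambda>t. moment (Po (?a t)) (Suc r)) has_vector_derivative (if r = s then complex_of_real (sqnorm (Po a) r) else 0)) (at 0)"
    by (auto intro!: derivative_eq_intros simp: has_vector_derivative_def)
qed

text \<open>Multiply the values of the characteristic polynomial at 1 and -1: each conjugate pair
  contributes \<open>4 * (sin \<theta>)^2\<close>. The last parameter accounts for a factor 2 in
  each value, so the square of the left side is \<open>4 ^ (n - 1)\<close> times the squared product
  of sines.\<close>

lemma prod_sqrt_factors:
  assumes ax: "orthogonal_corr n e a x"
  shows "(\<Prod>k<2 * n - 1. sqrt (1 - orthogonal_params n e a k) * sqrt (1 + (- 1) ^ k * orthogonal_params n e a k))
     = 2 ^ (n - 1) * (\<Prod>j<n. sin (vec_nth x (e j)))"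
proof -
  note d = orthogonal_corrD[OF ax]
  interpret h: hessenberg_params "2 * n" "Po a" by (rule orthogonal_hessenberg_params[OF d(1)])
  let ?s = "\<Prod>j<n. sin (vec_nth x (e j))"
  let ?p = "\<Prod>l<2 * n - 1. 1 - orthogonal_params n e a l"
  let ?m = "\<Prod>l<2 * n - 1. 1 + (- 1) ^ l * orthogonal_params n e a l"
  let ?S = "\<Prod>k<2 * n - 1. sqrt (1 - orthogonal_params n e a k) * sqrt (1 + (- 1) ^ k * orthogonal_params n e a k)"
  have s: "?s > 0" using d(3) by (intro prod_pos) (auto intro: sin_gt_zero)
  have val: "poly (Phi (Po a) (2 * n)) c = (\<Prod>j<n. (c - cis (vec_nth x (e j))) * (c - cis (- vec_nth x (e j))))" for c
  proof -
    have "poly (Phi (Po a) (2 * n)) c = (\<Prod>z\<in>h.roots. c - z)"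
      unfolding h.Phi_eq_prod poly_prod by simp
    also have "\<dots> = (\<Prod>j<2 * n. c - node x j)" by (rule prod.reindex_bij_betw[OF d(5), symmetric])
    finally show ?thesis unfolding two_n prod_lessThan_add by (simp add: prod.distrib)
  qed
  have quad: "((1 - cis t) * (1 - cis (- t))) * ((- 1 - cis t) * (- 1 - cis (- t))) = complex_of_real (4 * (sin t)\<^sup>2)" for t
  proof -
    have 1: "cis t * cis (- t) = 1" "cis t + cis (- t) = complex_of_real (2 * cos t)"
      by (simp_all add: complex_eq_iff cis_mult)
    have 2: "(1 - p) * (1 - q) = 1 - (p + q) + p * q" "(- 1 - p) * (- 1 - q) = 1 + (p + q) + p * q" for p q :: complex
      by (simp_all add: algebra_simps)
    have "((1 - cis t) * (1 - cis (- t))) * ((- 1 - cis t) * (- 1 - cis (- t)))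
      = (1 - (cis t + cis (- t)) + cis t * cis (- t)) * (1 + (cis t + cis (- t)) + cis t * cis (- t))"
      unfolding 2 ..
    also have "\<dots> = complex_of_real (4 * (1 - (cos t)\<^sup>2))"
      unfolding 1 by (simp add: algebra_simps power2_eq_square)
    finally show ?thesis by (simp add: sin_squared_eq)
  qed
  have "complex_of_real ((2 * ?p) * (2 * ?m)) = poly (Phi (Po a) (2 * n)) 1 * poly (Phi (Po a) (2 * n)) (- 1)"
    unfolding orthogonal_Phi_at_one[OF d(1)] by simp
  also have "\<dots> = (\<Prod>j<n. complex_of_real (4 * (sin (vec_nth x (e j)))\<^sup>2))"
    unfolding val prod.distrib[symmetric] quad ..
  also have "\<dots> = complex_of_real (4 ^ n * ?s\<^sup>2)"
    by (simp add: prod.distrib prod_power_distrib)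
  finally have pm: "(2 * ?p) * (2 * ?m) = 4 ^ n * ?s\<^sup>2" by (simp only: of_real_eq_iff)
  have S0: "?S \<ge> 0" using orthogonal_factor_pos[OF d(1)] by (intro prod_nonneg) (auto simp: less_imp_le)
  have "?S\<^sup>2 = (\<Prod>k<2 * n - 1. (1 - orthogonal_params n e a k) * (1 + (- 1) ^ k * orthogonal_params n e a k))"
    unfolding prod_power_distrib
  proof (intro prod.cong refl)
    fix k assume "k \<in> {..<2 * n - 1}"
    then have "k < 2 * n - 1" by simp
    note p = orthogonal_factor_pos[OF d(1) this]
    show "(sqrt (1 - orthogonal_params n e a k) * sqrt (1 + (- 1) ^ k * orthogonal_params n e a k))\<^sup>2
      = (1 - orthogonal_params n e a k) * (1 + (- 1) ^ k * orthogonal_params n e a k)"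
      using p by (simp only: power_mult_distrib real_sqrt_pow2 less_imp_le)
  qed
  then have "4 * ?S\<^sup>2 = 4 ^ n * ?s\<^sup>2" using pm by (simp add: prod.distrib)
  moreover have "(4 :: real) ^ n = 4 * (2 ^ (n - 1))\<^sup>2"
  proof -
    obtain k where "n = Suc k" using n by (metis Suc_le_D One_nat_def)
    then show ?thesis by (simp add: power2_eq_square flip: power_mult_distrib)
  qed
  ultimately have "?S\<^sup>2 = (2 ^ (n - 1) * ?s)\<^sup>2" by (simp add: power_mult_distrib)
  then show ?thesis using S0 s by (simp add: power2_eq_iff_nonneg)
qed

lemma orthogonal_jacobian:
  assumes ax: "orthogonal_corr n e a x"
  shows "has_jacobian_at (orthogonal_corr n e) a x
     (2 ^ (n - 1) / (q_of n e x (n - 1) * (\<Prod>i<n. q_of n e x i))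
      * ((\<Prod>l<2 * n - 1. 1 - \<bar>orthogonal_params n e a l\<bar>\<^sup>2)
         / (\<Prod>k<2 * n - 1. sqrt (1 - orthogonal_params n e a k) * sqrt (1 + (- 1) ^ k * orthogonal_params n e a k))))"
proof -
  note d = orthogonal_corrD[OF ax]
  let ?th = "\<lambda>j. vec_nth x (e j)"
  let ?z = "\<lambda>j. cis (?th j)"
  have injz: "inj_on ?z {..<n}"
  proof (rule inj_onI)
    fix i j assume "i \<in> {..<n}" "j \<in> {..<n}" "?z i = ?z j"
    then show "i = j" using bij_betw_imp_inj_on[OF d(5)] by (auto dest!: inj_onD[of _ _ i j])
  qed
  obtain \<delta> where \<delta>: "\<delta> > 0" "\<And>i j. i < n \<Longrightarrow> j < n \<Longrightarrow> i \<noteq> j \<Longrightarrow> 2 * \<delta> \<le> dist (?z i) (?z j)"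
    using ex_separation[OF injz] by auto
  define U1 where "U1 = {z :: real ^ 'd. (\<forall>i<n. \<forall>j<n. i < j \<longrightarrow> vec_nth z (e i) < vec_nth z (e j)) \<and>
     (\<forall>j<n - 1. 0 < vec_nth z (e (n + j))) \<and> (\<Sum>i<n - 1. (vec_nth z (e (n + i)))\<^sup>2) < 1 \<and>
     (\<forall>j<n. dist (cis (vec_nth z (e j))) (?z j) < \<delta>) \<and> (\<forall>j<n. \<bar>vec_nth z (e j) - ?th j\<bar> < 1)}"
  define U2 where "U2 = {z. \<forall>l<2 * n - 1. cmod (verblunsky (Co z) l) < 1}"
  define U3 where "U3 = {z :: real ^ 'd. \<forall>j<n. 0 < vec_nth z (e j) \<and> vec_nth z (e j) < pi}"
  have "open U1" unfolding U1_def by (rule open_spectral_region)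
  moreover have "open U2" unfolding U2_def by (rule open_verblunsky_less) (rule Co_differentiable)
  moreover have "open U3" unfolding U3_def
    by (intro open_Collect_all_less open_Collect_conj open_Collect_less continuous_intros)
  ultimately have U: "open (U1 \<inter> U2 \<inter> U3)" by (intro open_Int)
  have Faa: "a = orthogonal_inverse x" by (rule orthogonal_corr_imp_inverse[OF ax])
  have xU: "x \<in> U1 \<inter> U2 \<inter> U3"
  proof -
    have "cmod (verblunsky (Co x) l) < 1" if "l < 2 * n - 1" for l
    proof -
      have "verblunsky (Co x) l = Po (orthogonal_inverse x) l" by (rule orthogonal_params_inverse[OF that, symmetric])
      then have "verblunsky (Co x) l = Po a l" using Faa by simp
      moreover have "- 1 < orthogonal_params n e a l" "orthogonal_params n e a l < 1"
        using d(1) that unfolding orthogonal_domain_def by blast+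
      ultimately show ?thesis by simp
    qed
    moreover have "\<forall>j<n. 0 < q_of n e x j" using d(4) by simp
    ultimately show ?thesis
      using d(2,3) \<delta>(1) unfolding q_of_pos_iff
      by (auto simp: U1_def U2_def U3_def strict_mono_on_def angle_of_def)
  qed
  have valid: "strict_mono_on {..<n} (angle_of e z)" "\<And>j. j < n \<Longrightarrow> 0 < vec_nth z (e j) \<and> vec_nth z (e j) < pi"
    "\<And>j. j < n \<Longrightarrow> q_of n e z j > 0" "\<forall>l<2 * n - 1. cmod (verblunsky (Co z) l) < 1" if "z \<in> U1 \<inter> U2 \<inter> U3" for z
    using that q_of_pos_iff[of z] by (auto simp: U1_def U2_def U3_def strict_mono_on_def angle_of_def)
  \<comment> \<open>In the variable \<open>cos t\<close> the test functions are Chebyshev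
    polynomials; \<open>y' = - sin\<close> puts one factor \<open>sin \<theta>\<close> per angle
    into the determinant.\<close>
  define u y u' y' where "u = (\<lambda>t :: real. 1 :: complex)" and "y = (\<lambda>t. complex_of_real (cos t))"
    and "u' = (\<lambda>t :: real. 0 :: complex)" and "y' = (\<lambda>t. complex_of_real (- sin t))"
  have u: "(u has_vector_derivative u' t) (at t)" for t unfolding u_def u'_def by simp
  have y: "(y has_vector_derivative y' t) (at t)" for t
    using cos_has_vector_derivative[of 1 t] by (simp add: y_def y'_def)
  have lastrow: "u t * poly (cheb_row n (2 * n - 1)) (y t) = 1" for t
    by (simp add: u_def cheb_row_def)
  define R where "R r t = u t * poly (cheb_row n r) (y t)" for r t
  define R' where "R' r t = u t * (y' t * poly (pderiv (cheb_row n r)) (y t)) + u' t * poly (cheb_row n r) (y t)" for r t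
  note ds1 = det_spectral_sum(1)[where f = "cheb_row n" and u = u and u' = u' and y = y and y' = y',
      OF n e degree_cheb_row[OF n] u y lastrow, folded R_def R'_def]
    and ds2 = det_spectral_sum(2)[where f = "cheb_row n" and u = u and u' = u' and y = y and y' = y' and x = x,
      OF n e degree_cheb_row[OF n] u y lastrow]
  let ?T = "\<lambda>r b. moment (Po b) (Suc r)"
  let ?T' = "\<lambda>r. frechet_derivative (?T r) (at a)"
  have T: "(?T r has_derivative ?T' r) (at a)" for r
    using orthogonal_moment_differentiable frechet_derivative_works by blast
  let ?E = "sqnorm (Po a)"
  have E: "?E k > 0" if "k < 2 * n" for k by (rule orthogonal_corr_sqnorm_pos[OF ax that])
  define E0 where "E0 = (\<Prod>k<2 * n - 1. ?E k)"
  have E0: "E0 > 0" unfolding E0_def using E by (intro prod_pos) auto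
  have Tprod: "(\<Prod>r<2 * n - 1. cmod (?T' r (axis (e r) 1))) = E0"
    unfolding E0_def
  proof (intro prod.cong refl)
    fix r assume "r \<in> {..<2 * n - 1}"
    then have r: "r < 2 * n - 1" "r < 2 * n" by auto
    show "cmod (?T' r (axis (e r) 1)) = ?E r"
      unfolding orthogonal_moment_derivative[OF T order_refl r(1)] using E[OF r(2)] by simp
  qed
  define Q G sn where "Q = (\<Prod>i<n. q_of n e x i)" and "G = gaps n (\<lambda>j. complex_of_real (cos (?th j)))"
    and "sn = (\<Prod>j<n. sin (?th j))"
  have sin: "sin (?th j) > 0" if "j < n" for j using d(3)[OF that] by (auto intro: sin_gt_zero)
  have Q: "Q > 0" unfolding Q_def using d(4) by (intro prod_pos) auto
  have sn: "sn > 0" unfolding sn_def using sin by (intro prod_pos) auto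
  have qlast: "q_of n e x (n - 1) > 0" using d(4) n by simp
  have Qsplit: "(\<Prod>i<n - 1. q_of n e x i) = Q / q_of n e x (n - 1)"
  proof -
    have "{..<n} = insert (n - 1) {..<n - 1}" using n by auto
    then show ?thesis using qlast by (simp add: Q_def)
  qed
  have hw: "(\<Prod>j<2 * n. halfweight x j) = (Q\<^sup>2 / 2 ^ n)\<^sup>2"
  proof -
    have "(\<Prod>j<2 * n. halfweight x j) = (\<Prod>j<n. (q_of n e x j)\<^sup>2 / 2) * (\<Prod>j<n. (q_of n e x j)\<^sup>2 / 2)"
      unfolding two_n prod_lessThan_add
      by (intro arg_cong2[of _ _ _ _ times] prod.cong) (auto simp: halfweight_def d(7))
    also have "(\<Prod>j<n. (q_of n e x j)\<^sup>2 / 2) = Q\<^sup>2 / 2 ^ n"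
      by (simp add: prod_dividef prod_power_distrib Q_def)
    finally show ?thesis by (simp add: power2_eq_square)
  qed
  have Esplit: "(\<Prod>k<2 * n. ?E k) = E0 * ?E (2 * n - 1)"
  proof -
    have "{..<2 * n} = insert (2 * n - 1) {..<2 * n - 1}" using n by auto
    then show ?thesis by (simp add: E0_def mult.commute)
  qed
  have gp: "gaps (2 * n) (node x) = (2 ^ (n * n) * sn * G)\<^sup>2"
    unfolding sn_def G_def by (rule gaps_paired) (rule d(3))
  have pw: "(2 :: real) ^ (n * n) / 2 ^ n = 2 ^ (n * (n - 1))"
    using n by (simp add: right_diff_distrib' flip: power_diff)
  \<comment> \<open>The \<open>2 * n\<close> weights are \<open>q^2 / 2\<close> each, which lowers
    the power \<open>2 ^ (n * n)\<close> from the paired gaps to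
    \<open>2 ^ (n * (n - 1))\<close>.\<close>
  have rel: "(2 ^ (n * (n - 1)) * sn * G * Q\<^sup>2)\<^sup>2 = E0 * ?E (2 * n - 1)"
  proof -
    have "(2 ^ (n * (n - 1)) * sn * G * Q\<^sup>2)\<^sup>2 = (2 ^ (n * n) * sn * G)\<^sup>2 * (Q\<^sup>2 / 2 ^ n)\<^sup>2"
      unfolding pw[symmetric] by (simp add: power_mult_distrib power_divide)
    then show ?thesis using orthogonal_corr_moments(2)[OF ax] unfolding gp hw Esplit by simp
  qed
  \<comment> \<open>Powers of 2: the first comes from the leading Chebyshev coefficients,
    \<open>2 ^ (n - 1)\<close> from the derivatives of \<open>q^2\<close>.\<close>
  have detM: "cmod (Determinant.det (Matrix.mat (2 * n - 1) (2 * n - 1)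
       (\<lambda>(r, s). spectral_sum' n e (R r) (R' r) x (axis (e s) 1))))
     = 2 ^ ((2 * n - 1) * (n - 1)) * G\<^sup>2 * (Q\<^sup>2 * sn * (2 ^ (n - 1) * (Q / q_of n e x (n - 1))))"
  proof -
    have "(\<Prod>j<n. \<bar>sqweight n e x j\<bar> * (cmod (u (?th j)) * cmod (y' (?th j)))) = Q\<^sup>2 * sn"
    proof -
      have "(\<Prod>j<n. \<bar>sqweight n e x j\<bar> * (cmod (u (?th j)) * cmod (y' (?th j))))
         = (\<Prod>j<n. (q_of n e x j)\<^sup>2 * sin (?th j))"
        using sin by (intro prod.cong) (auto simp: d(7) u_def y'_def less_imp_le)
      then show ?thesis by (simp add: Q_def sn_def prod.distrib prod_power_distrib)
    qed
    moreover have "(\<Prod>j<n - 1. 2 * \<bar>vec_nth x (e (n + j))\<bar> * cmod (u (?th j)))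
       = (\<Prod>j<n - 1. 2 * q_of n e x j)"
    proof (intro prod.cong refl)
      fix j assume "j \<in> {..<n - 1}"
      then have "j < n - 1" "j < n" by auto
      then show "2 * \<bar>vec_nth x (e (n + j))\<bar> * cmod (u (?th j)) = 2 * q_of n e x j"
        using d(4)[of j] by (simp add: q_of_def u_def)
    qed
    moreover have "(\<Prod>j<n - 1. 2 * q_of n e x j) = 2 ^ (n - 1) * (Q / q_of n e x (n - 1))"
      unfolding prod.distrib Qsplit by simp
    moreover have "cmod (u (?th (n - 1))) = 1" by (simp add: u_def)
    moreover have "cmod (Determinant.det (Matrix.mat (2 * n - 1) (2 * n - 1)
         (\<lambda>(r, s). spectral_sum' n e (R r) (R' r) x (axis (e s) 1))))
       = 2 ^ ((2 * n - 1) * (n - 1)) * (gaps n (\<lambda>j. y (?th j)))\<^sup>2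
         * ((\<Prod>j<n. \<bar>sqweight n e x j\<bar> * (cmod (u (?th j)) * cmod (y' (?th j))))
         * (\<Prod>j<n - 1. 2 * \<bar>vec_nth x (e (n + j))\<bar> * cmod (u (?th j))) * cmod (u (?th (n - 1))))"
      unfolding R_def[abs_def] R'_def[abs_def] det_cheb_row[OF n, symmetric] by (rule ds2)
    ultimately show ?thesis
      by (simp only: G_def y_def mult_1_right)
  qed
  show ?thesis
  proof (rule has_jacobian_atI[where R = "orthogonal_corr n e" and U = "U1 \<inter> U2 \<inter> U3" and D = "orthogonal_domain n e"
        and F = orthogonal_inverse and T = ?T and M = "\<lambda>r. spectral_sum n e (R r)" and T' = ?T'
        and M' = "\<lambda>r. spectral_sum' n e (R r) (R' r) x", OF e ax U xU open_orthogonal_domain d(1)])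
    show "orthogonal_inverse differentiable (at z)" if "z \<in> U1 \<inter> U2 \<inter> U3" for z
      by (rule orthogonal_inverse_differentiable[OF valid(4)[OF that]])
    show "b = orthogonal_inverse z" if "orthogonal_corr n e b z" for z b
      by (rule orthogonal_corr_imp_inverse[OF that])
    show "orthogonal_corr n e (orthogonal_inverse z) z"
      if "z \<in> U1 \<inter> U2 \<inter> U3" "orthogonal_inverse z \<in> orthogonal_domain n e" for z
      using valid[OF that(1)] that(2) by (intro orthogonal_inverse_corr) auto
    show "z = z'" if z: "z \<in> U1 \<inter> U2 \<inter> U3" "z' \<in> U1 \<inter> U2 \<inter> U3"
      and b: "orthogonal_corr n e b z" "orthogonal_corr n e b z'" for z z' b
    proof (rule spectral_data_inj[OF e n \<delta>(2), where t = ?th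
          and w = "\<lambda>y. sqrt (2 * hessenberg_params.wt (2 * n) (Po b) y)"])
      note dz = orthogonal_corrD[OF b(1)] and dz' = orthogonal_corrD[OF b(2)]
      show "cis (vec_nth z (e j)) \<in> (\<lambda>i. cis (vec_nth z' (e i))) ` {..<n}" if j: "j < n" for j
      proof -
        have "node z j \<in> node z ` {..<2 * n}" using j by (intro imageI) simp
        then have "node z j \<in> node z' ` {..<2 * n}"
          using dz(5) dz'(5) by (simp only: bij_betw_def)
        then have "cis (vec_nth z (e j)) \<in> (\<lambda>i. cis (vec_nth z' (e i))) ` {..<n} \<union> (\<lambda>i. cis (- vec_nth z' (e i))) ` {..<n}"
          using j by (simp add: paired_image)
        moreover have "cis (vec_nth z (e j)) \<noteq> cis (- vec_nth z' (e i))" if "i < n" for i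
        proof -
          have "sin (vec_nth z (e j)) > 0" "sin (vec_nth z' (e i)) > 0"
            using dz(3)[OF j] dz'(3)[OF that] by (auto intro: sin_gt_zero)
          then show ?thesis by (auto simp: complex_eq_iff)
        qed
        ultimately show ?thesis by auto
      qed
      show "q_of n e z j = sqrt (2 * hessenberg_params.wt (2 * n) (Po b) (cis (vec_nth z (e j))))" if "j < n" for j
      proof -
        have "2 * hessenberg_params.wt (2 * n) (Po b) (cis (vec_nth z (e j))) = (q_of n e z j)\<^sup>2"
          using dz(6)[of j] dz(7)[OF that] that by (simp add: halfweight_def)
        then show ?thesis using dz(4)[OF that] by simp
      qed
      show "q_of n e z' j = sqrt (2 * hessenberg_params.wt (2 * n) (Po b) (cis (vec_nth z' (e j))))" if "j < n" for j
      proof -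
        have "2 * hessenberg_params.wt (2 * n) (Po b) (cis (vec_nth z' (e j))) = (q_of n e z' j)\<^sup>2"
          using dz'(6)[of j] dz'(7)[OF that] that by (simp add: halfweight_def)
        then show ?thesis using dz'(4)[OF that] by simp
      qed
    qed (use z in \<open>auto simp: U1_def\<close>)
    show "(spectral_sum n e (R r) has_derivative spectral_sum' n e (R r) (R' r) x) (at x)" for r
      by (rule spectral_sum_has_derivative) (rule ds1)
    show "spectral_sum n e (R r) z = moment (Po b) (Suc r)" if r: "r < 2 * n - 1" and b: "orthogonal_corr n e b z" for r z b
    proof -
      have "R r = (\<lambda>t. complex_of_real (cos (real (Suc r) * t)))"
        unfolding R_def[abs_def] u_def y_def using r by (simp add: cheb_row_def poly_cheb del: of_nat_Suc)
      moreover have "Suc r \<le> 2 * n" using r by linarith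
      ultimately show ?thesis using orthogonal_corr_moments(1)[OF b] by (simp only:)
    qed
    show "?T' r (axis (e s) 1) = 0" if "r < s" "s < 2 * n - 1" for r s
      using orthogonal_moment_derivative[OF T, of r s] that by simp
    show "(\<Prod>r<2 * n - 1. cmod (?T' r (axis (e r) 1))) \<noteq> 0"
      unfolding Tprod using E0 by simp
    show "2 ^ (n - 1) / (q_of n e x (n - 1) * (\<Prod>i<n. q_of n e x i))
      * ((\<Prod>l<2 * n - 1. 1 - \<bar>orthogonal_params n e a l\<bar>\<^sup>2)
         / (\<Prod>k<2 * n - 1. sqrt (1 - orthogonal_params n e a k) * sqrt (1 + (- 1) ^ k * orthogonal_params n e a k)))
      = cmod (Determinant.det (Matrix.mat (2 * n - 1) (2 * n - 1)
          (\<lambda>(r, s). spectral_sum' n e (R r) (R' r) x (axis (e s) 1))))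
        / (\<Prod>r<2 * n - 1. cmod (?T' r (axis (e r) 1)))"
    proof -
      let ?q = "q_of n e x (n - 1)" and ?En = "?E (2 * n - 1)"
      \<comment> \<open>The two powers of 2 in \<open>detM\<close> multiply to \<open>k^2\<close>,
        the same power as in \<open>rel\<close>, so they cancel. One factor \<open>sn\<close>
        remains in the denominator; the \<open>2 ^ (n - 1)\<close> of the claim is what
        \<open>prod_sqrt_factors\<close> requires to express it by the parameters.\<close>
      define k :: real where "k = 2 ^ (n * (n - 1))"
      have En: "(\<Prod>l<2 * n - 1. 1 - \<bar>orthogonal_params n e a l\<bar>\<^sup>2) = ?En"
        by (simp add: sqnorm_def)
      have "(2 * n - 1) * (n - 1) + (n - 1) = n * (n - 1) * 2"
      proof -
        obtain j where "n = Suc j" using n by (metis Suc_le_D One_nat_def)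
        then show ?thesis by simp
      qed
      then have kk: "(2 :: real) ^ ((2 * n - 1) * (n - 1)) * 2 ^ (n - 1) = k\<^sup>2"
        unfolding k_def power_add[symmetric] power_mult[symmetric] by (simp only:)
      have "(2 :: real) ^ ((2 * n - 1) * (n - 1)) * G\<^sup>2 * (Q\<^sup>2 * sn * (2 ^ (n - 1) * (Q / ?q))) / E0
         = (2 ^ ((2 * n - 1) * (n - 1)) * 2 ^ (n - 1)) * G\<^sup>2 * (Q\<^sup>2 * sn * (Q / ?q)) / E0"
        by (simp only: mult_ac)
      also have "\<dots> = (k * sn * G * Q\<^sup>2)\<^sup>2 / (E0 * (?q * Q * sn))"
        unfolding kk using Q qlast sn E0 by (simp add: field_simps power2_eq_square)
      also have "\<dots> = ?En / (?q * Q * sn)"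
        using rel E0 by (simp add: k_def)
      also have "\<dots> = 2 ^ (n - 1) / (?q * Q) * (?En / (2 ^ (n - 1) * sn))"
        by simp
      finally show ?thesis
        unfolding detM Tprod prod_sqrt_factors[OF ax] En Q_def[symmetric] sn_def[symmetric] by simp
    qed
  qed (use T in auto)
qed

end

theorem theorem2:
  fixes n :: nat and e :: "nat \<Rightarrow> 'd::finite"
  assumes "n \<ge> 1"
    and "bij_betw e {..<2 * n - 1} (UNIV :: 'd set)"
  shows "((\<forall>a \<in> unitary_domain n e. \<exists>x. unitary_corr n e a x) \<and>
          (\<forall>a x. unitary_corr n e a x \<longrightarrow>
             has_jacobian_at (unitary_corr n e) a x
               ((\<Prod>i<n - 1. 1 - (cmod (unitary_params n e a i))\<^sup>2)
                  / (q_of n e x (n - 1) * (\<Prod>i<n. q_of n e x i))))) \<and>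
         ((\<forall>a \<in> orthogonal_domain n e. \<exists>x. orthogonal_corr n e a x) \<and>
          (\<forall>a x. orthogonal_corr n e a x \<longrightarrow>
             has_jacobian_at (orthogonal_corr n e) a x
               (2 ^ (n - 1) / (q_of n e x (n - 1) * (\<Prod>i<n. q_of n e x i))
                * ((\<Prod>l<2 * n - 1. 1 - \<bar>orthogonal_params n e a l\<bar>\<^sup>2)
                   / (\<Prod>k<2 * n - 1. sqrt (1 - orthogonal_params n e a k)
                                     * sqrt (1 + (- 1) ^ k * orthogonal_params n e a k))))))"
proof -
  interpret jacobian_coords n e using assms by unfold_locales
  show ?thesis
    using ex_unitary_corr unitary_jacobian ex_orthogonal_corr orthogonal_jacobian by blast
qed

end
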